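(* Let $G=(V,E)$ be a graph, $\tilde{\mathbf{c}}\colon V\to[1,N_c]$ a cost function and $\tilde{\mathbf{w}}\colon V\to[1,N_w]$ a weight function (integer-valued). If $N_c,N_w\le|V|^{\mathcal{O}(1)}$, then there is an algorithm that, given for every prime quotient graph $H\in\mathcal{H}_p(G)$ a tree decomposition of $H$ of width $k$, computes an independent set $X$ of $G$ lexicographically maximizing $(\tilde{\mathbf{c}}(X),\tilde{\mathbf{w}}(X))$ in time $\mathcal{O}^*(2^k)$.
   Context: For a set $X$, $\tilde{\mathbf{c}}(X)=\sum_{v\in X}\tilde{\mathbf{c}}(v)$ and similarly for $\tilde{\mathbf{w}}$. $\mathcal{O}^*$ hides factors polynomial in the input size. A module of $G$ is a set $M\subseteq V$ with $N(v)\setminus M=N(w)\setminus M$ for all $v,w\in M$; it is strong if for every module $M'$: $M\cap M'=\emptyset$, $M\subseteq M'$ or $M'\subseteq M$. Nonempty strong modules ordered by inclusion form the modular decomposition tree (root $V$, leaves singletons). For a graph with at least two vertices, $\Pi_{mod}(G)$ is the partition of $V$ into the inclusion-maximal strong modules different from $V$. The quotient graph $G/\Pi$ has vertex set $\Pi$ and an edge between distinct parts iff some edge of $G$ joins them. For each non-singleton strong module $M$, the quotient graph at $M$ is $G[M]/\Pi_{mod}(G[M])$, which is edgeless, complete, or prime (only trivial modules). $\mathcal{H}_p(G)$ is the set of these quotient graphs that are prime. *)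

theory Defs
  imports "HOL-Library.Log_Nat"
begin

section \<open>Simple graphs and modular decomposition\<close>

record 'a ugraph =
  verts :: "'a set"
  edges :: "'a set set"

definition simple_graph :: "'a ugraph \<Rightarrow> bool" where
  "simple_graph G \<longleftrightarrow> finite (verts G) \<and>
     edges G \<subseteq> {{u, v} | u v. u \<in> verts G \<and> v \<in> verts G \<and> u \<noteq> v}"

definition neighbours :: "'a ugraph \<Rightarrow> 'a \<Rightarrow> 'a set" where
  "neighbours G v = {u. {u, v} \<in> edges G}"

definition induced :: "'a ugraph \<Rightarrow> 'a set \<Rightarrow> 'a ugraph" where
  "induced G S = \<lparr> verts = verts G \<inter> S, edges = {e \<in> edges G. e \<subseteq> S} \<rparr>"

definition independent_set :: "'a ugraph \<Rightarrow> 'a set \<Rightarrow> bool" where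
  "independent_set G X \<longleftrightarrow> X \<subseteq> verts G \<and> (\<forall>u\<in>X. \<forall>v\<in>X. {u, v} \<notin> edges G)"

definition is_module :: "'a ugraph \<Rightarrow> 'a set \<Rightarrow> bool" where
  "is_module G M \<longleftrightarrow> M \<subseteq> verts G \<and>
     (\<forall>v\<in>M. \<forall>w\<in>M. neighbours G v - M = neighbours G w - M)"

definition strong_module :: "'a ugraph \<Rightarrow> 'a set \<Rightarrow> bool" where
  "strong_module G M \<longleftrightarrow> is_module G M \<and>
     (\<forall>M'. is_module G M' \<longrightarrow> M \<inter> M' = {} \<or> M \<subseteq> M' \<or> M' \<subseteq> M)"

definition Pi_mod :: "'a ugraph \<Rightarrow> 'a set set" where
  "Pi_mod G = {M. strong_module G M \<and> M \<noteq> verts G \<and>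
     (\<forall>M'. strong_module G M' \<and> M' \<noteq> verts G \<and> M \<subseteq> M' \<longrightarrow> M' = M)}"

definition quotient_graph :: "'a ugraph \<Rightarrow> 'a set set \<Rightarrow> 'a set ugraph" where
  "quotient_graph G P = \<lparr> verts = P,
     edges = {{A, B} | A B. A \<in> P \<and> B \<in> P \<and> A \<noteq> B \<and> (\<exists>a\<in>A. \<exists>b\<in>B. {a, b} \<in> edges G)} \<rparr>"

text \<open>Graphs on two vertices have only trivial modules, so they are prime in this sense.\<close>

definition prime_graph :: "'a ugraph \<Rightarrow> bool" where
  "prime_graph G \<longleftrightarrow>
     (\<forall>M. is_module G M \<longrightarrow> M = {} \<or> M = verts G \<or> (\<exists>v. M = {v}))"

definition prime_quotients :: "'a ugraph \<Rightarrow> 'a set ugraph set" where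
  "prime_quotients G =
     {H. \<exists>M. strong_module G M \<and> 2 \<le> card M \<and>
           H = quotient_graph (induced G M) (Pi_mod (induced G M)) \<and> prime_graph H}"

section \<open>Tree decompositions\<close>

definition connected_graph :: "'a ugraph \<Rightarrow> bool" where
  "connected_graph G \<longleftrightarrow>
     (\<forall>u\<in>verts G. \<forall>v\<in>verts G. (u, v) \<in> {(x, y). {x, y} \<in> edges G}\<^sup>*)"

definition is_cycle :: "'a ugraph \<Rightarrow> 'a list \<Rightarrow> bool" where
  "is_cycle G xs \<longleftrightarrow> 3 \<le> length xs \<and> distinct xs \<and>
     (\<forall>i < length xs. {xs ! i, xs ! (Suc i mod length xs)} \<in> edges G)"

definition is_tree :: "'a ugraph \<Rightarrow> bool" where
  "is_tree T \<longleftrightarrow> simple_graph T \<and> verts T \<noteq> {} \<and> connected_graph T \<and> (\<nexists>xs. is_cycle T xs)"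

definition tree_decomposition :: "'a ugraph \<Rightarrow> 't ugraph \<Rightarrow> ('t \<Rightarrow> 'a set) \<Rightarrow> bool" where
  "tree_decomposition H T B \<longleftrightarrow> is_tree T \<and>
     (\<Union>t\<in>verts T. B t) = verts H \<and>
     (\<forall>e\<in>edges H. \<exists>t\<in>verts T. e \<subseteq> B t) \<and>
     (\<forall>v\<in>verts H. connected_graph (induced T {t. v \<in> B t}))"

definition td_width :: "'t ugraph \<Rightarrow> ('t \<Rightarrow> 'a set) \<Rightarrow> nat" where
  "td_width T B = Max ((\<lambda>t. card (B t)) ` verts T) - 1"

section \<open>Model of computation\<close>

text \<open>
  Algorithms are programs of a deterministic first-order functional language over binary trees
  whose leaves carry natural numbers. A program is a list of function bodies; in the body of a
  function, variable i denotes its i-th argument, and a let-bound value is pushed in front.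
  Functions may be mutually recursive.

  Evaluation comes with a running time. Constructing, inspecting, testing and passing on a tree
  takes one step (trees are shared, so that this manipulates a pointer), and an arithmetic
  operation is charged the bit length of its operands. This is the logarithmic cost criterion;
  random access machines and this language simulate each other with an overhead that is polynomial
  in the input size and the logarithm of the running time, which leaves the class of running times
  of the form 2 to the k times a polynomial unchanged.
\<close>

datatype val = Atom nat | Node val val

datatype arith_op = Add | Sub | Less

datatype exp =
    Var nat
  | Const nat
  | MkNode exp exp
  | Left exp
  | Right exp
  | IsNode exp
  | Arith arith_op exp exp
  | Cond exp exp exp
  | LetIn exp exp
  | Call nat "exp list"

type_synonym program = "exp list"

fun arith :: "arith_op \<Rightarrow> nat \<Rightarrow> nat \<Rightarrow> nat" where
  "arith Add m n = m + n"
| "arith Sub m n = m - n"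
| "arith Less m n = (if m < n then 1 else 0)"

abbreviation bit_length :: "nat \<Rightarrow> nat" where
  "bit_length n \<equiv> floorlog 2 n"

fun is_node :: "val \<Rightarrow> bool" where
  "is_node (Atom n) = False"
| "is_node (Node a b) = True"

text \<open>
  \<open>eval P env e v t\<close>: expression \<open>e\<close> evaluates to \<open>v\<close> in exactly \<open>t\<close> steps.
  Run-time errors and non-termination both show as the absence of a derivation.
\<close>

inductive eval :: "program \<Rightarrow> val list \<Rightarrow> exp \<Rightarrow> val \<Rightarrow> nat \<Rightarrow> bool"
  and evals :: "program \<Rightarrow> val list \<Rightarrow> exp list \<Rightarrow> val list \<Rightarrow> nat \<Rightarrow> bool"
  for P :: program
where
  eval_Var: "i < length env \<Longrightarrow> eval P env (Var i) (env ! i) 1"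
| eval_Const: "eval P env (Const n) (Atom n) 1"
| eval_MkNode: "eval P env e1 a t1 \<Longrightarrow> eval P env e2 b t2 \<Longrightarrow>
    eval P env (MkNode e1 e2) (Node a b) (t1 + t2 + 1)"
| eval_Left: "eval P env e (Node a b) t \<Longrightarrow> eval P env (Left e) a (t + 1)"
| eval_Right: "eval P env e (Node a b) t \<Longrightarrow> eval P env (Right e) b (t + 1)"
| eval_IsNode: "eval P env e a t \<Longrightarrow>
    eval P env (IsNode e) (Atom (if is_node a then 1 else 0)) (t + 1)"
| eval_Arith: "eval P env e1 (Atom m) t1 \<Longrightarrow> eval P env e2 (Atom n) t2 \<Longrightarrow>
    eval P env (Arith f e1 e2) (Atom (arith f m n)) (t1 + t2 + bit_length m + bit_length n + 1)"
| eval_Cond_true: "eval P env e (Atom n) t \<Longrightarrow> n \<noteq> 0 \<Longrightarrow> eval P env e1 v t1 \<Longrightarrow>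
    eval P env (Cond e e1 e2) v (t + t1 + 1)"
| eval_Cond_false: "eval P env e (Atom n) t \<Longrightarrow> n = 0 \<Longrightarrow> eval P env e2 v t2 \<Longrightarrow>
    eval P env (Cond e e1 e2) v (t + t2 + 1)"
| eval_LetIn: "eval P env e1 a t1 \<Longrightarrow> eval P (a # env) e2 v t2 \<Longrightarrow>
    eval P env (LetIn e1 e2) v (t1 + t2 + 1)"
| eval_Call: "evals P env es vs t1 \<Longrightarrow> f < length P \<Longrightarrow> eval P vs (P ! f) v t2 \<Longrightarrow>
    eval P env (Call f es) v (t1 + t2 + 1)"
| evals_Nil: "evals P env [] [] 0"
| evals_Cons: "eval P env e v t1 \<Longrightarrow> evals P env es vs t2 \<Longrightarrow>
    evals P env (e # es) (v # vs) (t1 + t2)"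

inductive_cases eval_elims:
  "eval P env (Var i) v t" "eval P env (Const n) v t" "eval P env (MkNode e1 e2) v t"
  "eval P env (Left e) v t" "eval P env (Right e) v t" "eval P env (IsNode e) v t"
  "eval P env (Arith f e1 e2) v t" "eval P env (Cond e e1 e2) v t" "eval P env (LetIn e1 e2) v t"
  "eval P env (Call f es) v t" "evals P env [] vs t" "evals P env (e # es) vs t"

lemma eval_deterministic:
  "eval P env e v t \<Longrightarrow> eval P env e v' t' \<Longrightarrow> v = v' \<and> t = t'"
  "evals P env es vs s \<Longrightarrow> evals P env es vs' s' \<Longrightarrow> vs = vs' \<and> s = s'"
proof (induction arbitrary: v' t' and vs' s' rule: eval_evals.inducts)
  case eval_Var
  then show ?case by (auto elim: eval_elims(1))
next
  case eval_Const
  then show ?case by (auto elim: eval_elims(2))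
next
  case eval_MkNode
  from eval_MkNode.prems show ?case
    by (rule eval_elims(3)) (auto dest!: eval_MkNode.IH(2,4))
next
  case eval_Left
  from eval_Left.prems show ?case
    by (rule eval_elims(4)) (auto dest!: eval_Left.IH(2))
next
  case eval_Right
  from eval_Right.prems show ?case
    by (rule eval_elims(5)) (auto dest!: eval_Right.IH(2))
next
  case eval_IsNode
  from eval_IsNode.prems show ?case
    by (rule eval_elims(6)) (auto dest!: eval_IsNode.IH(2))
next
  case eval_Arith
  from eval_Arith.prems show ?case
    by (rule eval_elims(7)) (auto dest!: eval_Arith.IH(2,4))
next
  case eval_Cond_true
  from eval_Cond_true.prems show ?case
    by (rule eval_elims(8)) (auto dest!: eval_Cond_true.IH(2,4) simp: eval_Cond_true.hyps)
next
  case eval_Cond_false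
  from eval_Cond_false.prems show ?case
    by (rule eval_elims(8)) (auto dest!: eval_Cond_false.IH(2,4) simp: eval_Cond_false.hyps)
next
  case eval_LetIn
  from eval_LetIn.prems show ?case
    by (rule eval_elims(9)) (auto dest!: eval_LetIn.IH(2,4))
next
  case eval_Call
  from eval_Call.prems show ?case
    by (rule eval_elims(10)) (auto dest!: eval_Call.IH(2,5))
next
  case evals_Nil
  then show ?case by (auto elim: eval_elims(11))
next
  case evals_Cons
  from evals_Cons.prems show ?case
    by (rule eval_elims(12)) (auto dest!: evals_Cons.IH(2,4))
qed

definition computes :: "program \<Rightarrow> val \<Rightarrow> val \<Rightarrow> nat \<Rightarrow> bool" where
  "computes P x y t \<longleftrightarrow> eval P [x] (Call 0 [Var 0]) y t"

fun val_size :: "val \<Rightarrow> nat" where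
  "val_size (Atom n) = 1 + bit_length n"
| "val_size (Node a b) = 1 + val_size a + val_size b"

section \<open>Encoding of instances\<close>

text \<open>
  Encodings are relations between mathematical objects and values: a set is represented by a
  list of its elements without repetition, in any order.
\<close>

fun val_of_list :: "val list \<Rightarrow> val" where
  "val_of_list [] = Atom 0"
| "val_of_list (x # xs) = Node x (val_of_list xs)"

definition rep_nat :: "nat \<Rightarrow> val \<Rightarrow> bool" where
  "rep_nat n v \<longleftrightarrow> v = Atom n"

definition rep_prod ::
  "('a \<Rightarrow> val \<Rightarrow> bool) \<Rightarrow> ('b \<Rightarrow> val \<Rightarrow> bool) \<Rightarrow> 'a \<times> 'b \<Rightarrow> val \<Rightarrow> bool" where
  "rep_prod R S p v \<longleftrightarrow> (\<exists>a b. v = Node a b \<and> R (fst p) a \<and> S (snd p) b)"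

definition rep_set :: "('a \<Rightarrow> val \<Rightarrow> bool) \<Rightarrow> 'a set \<Rightarrow> val \<Rightarrow> bool" where
  "rep_set R A v \<longleftrightarrow>
     (\<exists>xs vs. distinct xs \<and> set xs = A \<and> list_all2 R xs vs \<and> v = val_of_list vs)"

text \<open>The vertices with their costs and weights, and the edges.\<close>

definition rep_weighted_graph ::
  "nat ugraph \<times> (nat \<Rightarrow> nat) \<times> (nat \<Rightarrow> nat) \<Rightarrow> val \<Rightarrow> bool" where
  "rep_weighted_graph = (\<lambda>(G, c, w).
     rep_prod (rep_set (rep_prod rep_nat (rep_prod rep_nat rep_nat))) (rep_set (rep_set rep_nat))
       ((\<lambda>v. (v, c v, w v)) ` verts G, edges G))"

text \<open>
  A tree decomposition of a quotient graph: the nodes with their bags, and the edges of the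
  tree. The vertices of a quotient graph are sets of vertices, and bags are sets of those.
\<close>

definition rep_td :: "nat ugraph \<times> (nat \<Rightarrow> nat set set) \<Rightarrow> val \<Rightarrow> bool" where
  "rep_td = (\<lambda>(T, B).
     rep_prod (rep_set (rep_prod rep_nat (rep_set (rep_set rep_nat)))) (rep_set (rep_set rep_nat))
       ((\<lambda>t. (t, B t)) ` verts T, edges T))"

text \<open>
  The input consists of the weighted graph and one tree decomposition for every prime quotient
  graph. Neither the modules nor the quotient graphs themselves are part of the input.
\<close>

definition rep_instance ::
  "nat ugraph \<Rightarrow> (nat \<Rightarrow> nat) \<Rightarrow> (nat \<Rightarrow> nat) \<Rightarrow>
   (nat set ugraph \<Rightarrow> nat ugraph) \<Rightarrow> (nat set ugraph \<Rightarrow> nat \<Rightarrow> nat set set) \<Rightarrow> val \<Rightarrow> bool" where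
  "rep_instance G c w T B v \<longleftrightarrow>
     (\<exists>g ds. v = Node g ds \<and> rep_weighted_graph (G, c, w) g \<and>
        rep_set (\<lambda>H. rep_td (T H, B H)) (prime_quotients G) ds)"

section \<open>The optimisation problem\<close>

definition lex_max_independent_set ::
  "'a ugraph \<Rightarrow> ('a \<Rightarrow> nat) \<Rightarrow> ('a \<Rightarrow> nat) \<Rightarrow> 'a set \<Rightarrow> bool" where
  "lex_max_independent_set G c w X \<longleftrightarrow> independent_set G X \<and>
     (\<forall>Y. independent_set G Y \<longrightarrow>
        sum c Y < sum c X \<or> (sum c Y = sum c X \<and> sum w Y \<le> sum w X))"

end

theory Submission
  imports Defs "HOL-Library.Multiset"
begin

text \<open>
  An independent set of \<open>G[S]\<close>, for a module \<open>S\<close>, is optimised recursively. If \<open>G[S]\<close> or its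
  complement is disconnected, one splits off a component and adds the two optima, respectively
  keeps the better one. Otherwise \<open>S\<close> is automatically a strong module and, by Gallai's theorem, its
  quotient is prime; hence a tree decomposition of the quotient is part of the input and is
  recognised by the union of its parts. The parts are weighted by their optima, each part is
  represented by its minimum, and the quotient is solved by variable elimination on decision trees.
  Visiting the nodes of the tree decomposition along tree edges yields an elimination order for which
  every tree has its variables in one bag, so that it has fewer than \<open>2^(k+2)\<close> nodes. The correctness
  of the elimination does not depend on the tree decomposition. Lexicographic maximisation is
  maximisation of \<open>c * (1 + sum of w) + w\<close>, whose values are polynomial in the input size.
\<close>

section \<open>Modules and prime quotients\<close>

text \<open>What remains after splitting off one of several components is a module, but it need not
  be strong and need not occur in the modular decomposition tree. The recursion therefore runs over
  arbitrary modules, and strongness is recovered only where a tree decomposition must be looked up.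
  The decompositions arrive unlabelled; since the vertices of a quotient are vertex sets, their
  union is the module itself and can serve as the label.

  For the running time one number N bounds the input size as well as all values, list lengths and
  keys that occur. Bit lengths can then be estimated by the numbers themselves, and multiplication
  may be repeated addition. A module with n vertices causes at most 2 n - 1 calls, because the
  recursion tree has n leaves and every inner node has at least two sons. The exponential term
  occurs in one summand of the cost of a single call. It is not multiplied along the recursion,
  because both merging and adding decision trees keep the variables within one bag.\<close>

abbreviation adj :: "'a ugraph \<Rightarrow> 'a \<Rightarrow> 'a \<Rightarrow> bool" where
  "adj G x y \<equiv> {x, y} \<in> edges G"

lemma adj_sym: "adj G x y \<longleftrightarrow> adj G y x"
  by (simp add: insert_commute)

lemma simple_graphD:
  assumes "simple_graph G"
  shows "finite (verts G)" "adj G x y \<Longrightarrow> x \<in> verts G \<and> y \<in> verts G \<and> x \<noteq> y" "\<not> adj G x x"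
proof -
  have *: "x \<in> verts G \<and> y \<in> verts G \<and> x \<noteq> y" if "adj G x y" for x y
    using assms that unfolding simple_graph_def by (fastforce simp: doubleton_eq_iff)
  show "finite (verts G)" using assms by (simp add: simple_graph_def)
  show "adj G x y \<Longrightarrow> x \<in> verts G \<and> y \<in> verts G \<and> x \<noteq> y" "\<not> adj G x x"
    using * by blast+
qed

lemma is_module_iff:
  "is_module G M \<longleftrightarrow> M \<subseteq> verts G \<and> (\<forall>v\<in>M. \<forall>w\<in>M. \<forall>u. u \<notin> M \<longrightarrow> adj G u v = adj G u w)"
  unfolding is_module_def neighbours_def by blast

lemma is_moduleD:
  "is_module G M \<Longrightarrow> v \<in> M \<Longrightarrow> w \<in> M \<Longrightarrow> u \<notin> M \<Longrightarrow> adj G u v = adj G u w"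
  unfolding is_module_iff by blast

lemma verts_induced [simp]: "verts (induced G S) = verts G \<inter> S"
  by (simp add: induced_def)

lemma adj_induced [simp]: "adj (induced G S) x y \<longleftrightarrow> adj G x y \<and> x \<in> S \<and> y \<in> S"
  by (auto simp: induced_def)

lemma simple_graph_induced: "simple_graph G \<Longrightarrow> simple_graph (induced G S)"
proof -
  assume G: "simple_graph G"
  have "e \<in> {{u, v} |u v. u \<in> verts (induced G S) \<and> v \<in> verts (induced G S) \<and> u \<noteq> v}"
    if e: "e \<in> edges (induced G S)" for e
  proof -
    obtain u v where uv: "e = {u, v}" "u \<noteq> v" "u \<in> verts G" "v \<in> verts G"
      using G e unfolding simple_graph_def induced_def by auto
    then show ?thesis using e by (auto simp: induced_def)
  qed
  then show ?thesis using G unfolding simple_graph_def by auto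
qed

text \<open>Connectedness in terms of cuts. The two ends of a cut pair are always different, so the
  relation \<open>\<not> adj G x y\<close>, although reflexive, expresses connectedness of the
  complement.\<close>

definition cohesive :: "('a \<Rightarrow> 'a \<Rightarrow> bool) \<Rightarrow> 'a set \<Rightarrow> bool" where
  "cohesive r S \<longleftrightarrow> (\<forall>A. A \<subseteq> S \<and> A \<noteq> {} \<and> A \<noteq> S \<longrightarrow> (\<exists>x\<in>A. \<exists>y\<in>S - A. r x y))"

lemma cohesiveD: "cohesive r S \<Longrightarrow> A \<subseteq> S \<Longrightarrow> A \<noteq> {} \<Longrightarrow> A \<noteq> S \<Longrightarrow> \<exists>x\<in>A. \<exists>y\<in>S - A. r x y"
  unfolding cohesive_def by blast

lemma cohesive_cong:
  assumes "cohesive r S" "\<And>x y. x \<in> S \<Longrightarrow> y \<in> S \<Longrightarrow> r x y = r' x y"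
  shows "cohesive r' S"
  unfolding cohesive_def
proof (intro allI impI)
  fix A assume "A \<subseteq> S \<and> A \<noteq> {} \<and> A \<noteq> S"
  then obtain x y where "x \<in> A" "y \<in> S - A" "r x y" "A \<subseteq> S"
    using cohesiveD[OF assms(1)] by blast
  then show "\<exists>x\<in>A. \<exists>y\<in>S - A. r' x y" using assms(2)[of x y] by blast
qed

text \<open>If a module M overlapped S, the cut between \<open>S \<inter> M\<close> and
  \<open>S - M\<close> would contain an edge and a non-edge. As M is a module, a vertex y of M
  outside S would then be adjacent to one vertex of \<open>S - M\<close> and not to another,
  although S is a module.\<close>

lemma strong_if_cohesive:
  assumes S: "is_module G S" and c: "cohesive (adj G) S" "cohesive (\<lambda>x y. \<not> adj G x y) S"
  shows "strong_module G S"
  unfolding strong_module_def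
proof (intro conjI allI impI S)
  fix M assume M: "is_module G M"
  show "S \<inter> M = {} \<or> S \<subseteq> M \<or> M \<subseteq> S"
  proof (rule ccontr)
    assume "\<not> ?thesis"
    then obtain y where y: "y \<in> M" "y \<notin> S" and A: "S \<inter> M \<subseteq> S" "S \<inter> M \<noteq> {}" "S \<inter> M \<noteq> S"
      by blast
    obtain x z where 1: "x \<in> S \<inter> M" "z \<in> S - M" "adj G x z"
      using cohesiveD[OF c(1) A] by blast
    obtain x' z' where 2: "x' \<in> S \<inter> M" "z' \<in> S - M" "\<not> adj G x' z'"
      using cohesiveD[OF c(2) A] by blast
    have "adj G z y" using is_moduleD[OF M, of x y z] 1 y adj_sym by fast
    moreover have "\<not> adj G z' y" using is_moduleD[OF M, of x' y z'] 2 y adj_sym by fast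
    moreover have "adj G y z = adj G y z'" using is_moduleD[OF S, of z z' y] 1 2 y by blast
    ultimately show False using adj_sym by fast
  qed
qed

text \<open>The parts of a quotient are modules of an induced subgraph, whereas the recursion needs
  modules of G.\<close>

lemma module_trans:
  assumes S: "is_module G S" and M: "is_module (induced G S) M"
  shows "is_module G M"
  unfolding is_module_iff
proof (intro conjI ballI allI impI)
  show sub: "M \<subseteq> verts G" using M by (auto simp: is_module_iff)
  have MS: "M \<subseteq> S" using M by (auto simp: is_module_iff)
  fix v w u assume *: "v \<in> M" "w \<in> M" "u \<notin> M"
  show "adj G u v = adj G u w"
  proof (cases "u \<in> S")
    case True
    then show ?thesis using is_moduleD[OF M *] MS * by auto
  next
    case False
    then show ?thesis using is_moduleD[OF S, of v w u] MS * by blast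
  qed
qed

lemma strong_moduleD:
  "strong_module G M \<Longrightarrow> is_module G M"
  "strong_module G M \<Longrightarrow> is_module G M' \<Longrightarrow> M \<inter> M' = {} \<or> M \<subseteq> M' \<or> M' \<subseteq> M"
  unfolding strong_module_def by blast+

lemma is_module_single: "v \<in> verts G \<Longrightarrow> is_module G {v}"
  unfolding is_module_iff by blast

lemma strong_module_single: "v \<in> verts G \<Longrightarrow> strong_module G {v}"
  unfolding strong_module_def using is_module_single by fast

section \<open>The partition into maximal strong modules and its quotient graph\<close>

lemma Pi_mod_disjoint:
  assumes "A \<in> Pi_mod G" "B \<in> Pi_mod G" "A \<inter> B \<noteq> {}"
  shows "A = B"
  using assms strong_moduleD[of G A] strong_moduleD[of G B] unfolding Pi_mod_def by blast

lemma Pi_mod_module: "A \<in> Pi_mod G \<Longrightarrow> is_module G A"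
  unfolding Pi_mod_def strong_module_def by blast

lemma Pi_mod_maximal:
  assumes "finite (verts G)" "strong_module G M" "M \<noteq> verts G"
  shows "\<exists>P\<in>Pi_mod G. M \<subseteq> P"
proof -
  let ?F = "{P. strong_module G P \<and> P \<noteq> verts G \<and> M \<subseteq> P}"
  have "?F \<subseteq> Pow (verts G)" unfolding strong_module_def is_module_iff by blast
  then have "finite ?F" using assms(1) by (meson finite_Pow_iff finite_subset)
  moreover have "M \<in> ?F" using assms by simp
  ultimately obtain P where P: "P \<in> ?F" "\<And>P'. P' \<in> ?F \<Longrightarrow> P \<subseteq> P' \<Longrightarrow> P = P'"
    by (metis (lifting) finite_has_maximal2)
  then have "P \<in> Pi_mod G" unfolding Pi_mod_def by blast
  then show ?thesis using P(1) by blast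
qed

text \<open>With two vertices every singleton is a proper strong module. Hence every vertex is
  covered, and the empty module, although strong, is never maximal.\<close>

lemma Pi_mod_partition:
  assumes "finite (verts G)" "2 \<le> card (verts G)"
  shows "\<Union>(Pi_mod G) = verts G" "{} \<notin> Pi_mod G" "finite (Pi_mod G)"
proof -
  have s: "{v} \<noteq> verts G" for v
  proof
    assume "{v} = verts G"
    then have "card (verts G) = 1" by (metis is_singletonI is_singleton_altdef)
    then show False using assms(2) by simp
  qed
  have ex: "\<exists>P\<in>Pi_mod G. v \<in> P" if "v \<in> verts G" for v
    using Pi_mod_maximal[OF assms(1) strong_module_single[OF that] s] by blast
  have sub: "Pi_mod G \<subseteq> Pow (verts G)" using Pi_mod_module unfolding is_module_iff by blast
  then show "\<Union>(Pi_mod G) = verts G" using ex by blast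
  show "finite (Pi_mod G)" using sub assms(1) by (meson finite_Pow_iff finite_subset)
  show "{} \<notin> Pi_mod G"
  proof
    assume e: "{} \<in> Pi_mod G"
    obtain v where v: "v \<in> verts G" using assms by fastforce
    have "{v} = {}" using e strong_module_single[OF v] s unfolding Pi_mod_def by blast
    then show False by simp
  qed
qed

text \<open>Moving one endpoint inside B and then the other inside A preserves adjacency, since both
  are modules and disjoint. So any representatives decide adjacency in the quotient, in particular
  the minima used by the program.\<close>

lemma adj_quotient:
  assumes "A \<in> Pi_mod G" "B \<in> Pi_mod G" "a \<in> A" "b \<in> B"
  shows "adj (quotient_graph G (Pi_mod G)) A B \<longleftrightarrow> A \<noteq> B \<and> adj G a b"
proof -
  have "adj G a b" if "A \<noteq> B" "a' \<in> A" "b' \<in> B" "adj G a' b'" for a' b'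
  proof -
    have d: "A \<inter> B = {}" using Pi_mod_disjoint assms that by blast
    have "adj G a' b' = adj G a' b"
      by (rule is_moduleD[OF Pi_mod_module[OF assms(2)]]) (use that assms d in blast)+
    moreover have "adj G b a' = adj G b a"
      by (rule is_moduleD[OF Pi_mod_module[OF assms(1)]]) (use that assms d in blast)+
    ultimately show ?thesis
      using that(4) adj_sym[of b a' G] adj_sym[of b a G] by simp
  qed
  moreover have "adj (quotient_graph G (Pi_mod G)) A B \<longleftrightarrow> A \<noteq> B \<and> (\<exists>a\<in>A. \<exists>b\<in>B. adj G a b)"
    (is "_ \<longleftrightarrow> ?R A B")
  proof
    assume "adj (quotient_graph G (Pi_mod G)) A B"
    then obtain A' B' where "{A, B} = {A', B'}" "?R A' B'"
      unfolding quotient_graph_def by auto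
    then show "?R A B" using adj_sym by (metis doubleton_eq_iff)
  next
    assume "?R A B"
    then show "adj (quotient_graph G (Pi_mod G)) A B"
      unfolding quotient_graph_def using assms(1,2) by auto
  qed
  ultimately show ?thesis using assms(3,4) by blast
qed

section \<open>Gallai's theorem for graphs that are connected together with their complement\<close>

lemma module_Un:
  assumes "is_module G A" "is_module G B" "A \<inter> B \<noteq> {}"
  shows "is_module G (A \<union> B)"
proof -
  obtain z where z: "z \<in> A" "z \<in> B" using assms(3) by blast
  have "adj G u v = adj G u z" if "v \<in> A \<union> B" "u \<notin> A \<union> B" for u v
    using that z is_moduleD[OF assms(1), of v z u] is_moduleD[OF assms(2), of v z u] by blast
  moreover have "A \<union> B \<subseteq> verts G" using assms(1,2) by (auto simp: is_module_iff)
  ultimately show ?thesis unfolding is_module_iff by simp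
qed

text \<open>If A and B covered all vertices, the complement of \<open>A - B\<close> would be B, and
  all pairs between the two would have the same adjacency, because y can be moved inside B and x
  inside A. Such a cut contradicts one of the two cohesion hypotheses.\<close>

lemma modules_dont_cover:
  assumes "cohesive (adj G) (verts G)" "cohesive (\<lambda>x y. \<not> adj G x y) (verts G)"
    and A: "is_module G A" "A \<noteq> verts G" and B: "is_module G B" "B \<noteq> verts G" and AB: "A \<inter> B \<noteq> {}"
  shows "A \<union> B \<noteq> verts G"
proof
  assume V: "A \<union> B = verts G"
  obtain z where z: "z \<in> A" "z \<in> B" using AB by blast
  obtain y0 where y0: "y0 \<in> B" "y0 \<notin> A" using V A(2) by blast
  have const: "adj G x y = adj G y0 z" if "x \<in> A - B" "y \<in> B" for x y
  proof -
    have "adj G x y = adj G x y0" by (rule is_moduleD[OF B(1)]) (use that y0 in blast)+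
    also have "\<dots> = adj G y0 x" by (rule adj_sym)
    also have "\<dots> = adj G y0 z" by (rule is_moduleD[OF A(1)]) (use that z y0 in blast)+
    finally show ?thesis .
  qed
  have *: "A - B \<subseteq> verts G" "A - B \<noteq> {}" "A - B \<noteq> verts G" using V B(2) z by blast+
  have "verts G - (A - B) \<subseteq> B" using V by blast
  then show False
    using cohesiveD[OF assms(1) *] cohesiveD[OF assms(2) *] const by blast
qed

text \<open>The union with an overlapping proper module is again a proper module, so by maximality
  it adds nothing.\<close>

lemma maximal_module_strong:
  assumes "cohesive (adj G) (verts G)" "cohesive (\<lambda>x y. \<not> adj G x y) (verts G)"
    and P: "is_module G P" "P \<noteq> verts G" and max: "\<And>M. is_module G M \<Longrightarrow> M \<noteq> verts G \<Longrightarrow> P \<subseteq> M \<Longrightarrow> M = P"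
  shows "strong_module G P"
  unfolding strong_module_def
proof (intro conjI allI impI P)
  fix M assume M: "is_module G M"
  show "P \<inter> M = {} \<or> P \<subseteq> M \<or> M \<subseteq> P"
  proof (cases "P \<inter> M = {} \<or> M = verts G")
    case True
    then show ?thesis using P(1) unfolding is_module_iff by blast
  next
    case False
    then have "P \<union> M \<noteq> verts G" using modules_dont_cover[OF assms(1,2) P M] by blast
    then have "P \<union> M = P" using max[OF module_Un[OF P(1) M]] False by blast
    then show ?thesis by blast
  qed
qed

text \<open>The core of Gallai's theorem: a maximal proper module is strong and hence a part, so the
  parts bound all proper modules and not only the strong ones.\<close>

lemma module_below_Pi_mod:
  assumes "finite (verts G)" "cohesive (adj G) (verts G)" "cohesive (\<lambda>x y. \<not> adj G x y) (verts G)"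
    and "is_module G M" "M \<noteq> verts G"
  shows "\<exists>P\<in>Pi_mod G. M \<subseteq> P"
proof -
  let ?F = "{P. is_module G P \<and> P \<noteq> verts G \<and> M \<subseteq> P}"
  have "?F \<subseteq> Pow (verts G)" unfolding is_module_iff by blast
  then have "finite ?F" using assms(1) by (meson finite_Pow_iff finite_subset)
  moreover have "M \<in> ?F" using assms by simp
  ultimately obtain P where P: "P \<in> ?F" "\<And>P'. P' \<in> ?F \<Longrightarrow> P \<subseteq> P' \<Longrightarrow> P = P'"
    by (metis (lifting) finite_has_maximal2)
  have max: "M' = P" if "is_module G M'" "M' \<noteq> verts G" "P \<subseteq> M'" for M'
    using P(2)[of M'] P(1) that by blast
  then have "strong_module G P"
    using P(1) by (intro maximal_module_strong[OF assms(2,3)]) auto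
  moreover have "M' = P" if "strong_module G M'" "M' \<noteq> verts G" "P \<subseteq> M'" for M'
    using max[OF strong_moduleD(1)[OF that(1)] that(2,3)] .
  ultimately have "P \<in> Pi_mod G" using P(1) by (simp add: Pi_mod_def)
  then show ?thesis using P(1) by blast
qed

lemma verts_quotient [simp]: "verts (quotient_graph G P) = P"
  by (simp add: quotient_graph_def)

text \<open>The union of a proper nonempty module of the quotient is a proper module of G and thus
  lies inside one part; since the parts are disjoint and nonempty, the module consists of that part
  alone.\<close>

lemma prime_quotient_if_cohesive:
  assumes G: "simple_graph G" "2 \<le> card (verts G)"
    and c: "cohesive (adj G) (verts G)" "cohesive (\<lambda>x y. \<not> adj G x y) (verts G)"
  shows "prime_graph (quotient_graph G (Pi_mod G))"
  unfolding prime_graph_def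
proof (intro allI impI)
  note fin = simple_graphD(1)[OF G(1)] G(2)
  let ?Q = "quotient_graph G (Pi_mod G)"
  fix \<M> assume M: "is_module ?Q \<M>"
  then have sub: "\<M> \<subseteq> Pi_mod G" by (simp add: is_module_iff)
  show "\<M> = {} \<or> \<M> = verts ?Q \<or> (\<exists>P. \<M> = {P})"
  proof (cases "\<M> = Pi_mod G \<or> \<M> = {}")
    case False
    then obtain C where C: "C \<in> Pi_mod G" "C \<notin> \<M>" using sub by blast
    note part = Pi_mod_partition[OF fin]
    have "is_module G (\<Union>\<M>)"
      unfolding is_module_iff
    proof (intro conjI ballI allI impI)
      show "\<Union>\<M> \<subseteq> verts G" using sub part(1) by blast
      fix v w u assume vwu: "v \<in> \<Union>\<M>" "w \<in> \<Union>\<M>" "u \<notin> \<Union>\<M>"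
      show "adj G u v = adj G u w"
      \<comment> \<open>In the definition of a module u ranges over the whole type; outside the
        graph it has no edges.\<close>
      proof (cases "u \<in> verts G")
        case True
        then obtain U where U: "U \<in> Pi_mod G" "u \<in> U" using part(1) by blast
        obtain A B where AB: "A \<in> \<M>" "v \<in> A" "B \<in> \<M>" "w \<in> B" using vwu by blast
        have UM: "U \<notin> \<M>" using vwu(3) U by blast
        then have "adj ?Q U A = adj ?Q U B" using is_moduleD[OF M AB(1,3)] by blast
        then show ?thesis
          using adj_quotient[OF U(1) _ U(2) AB(2)] adj_quotient[OF U(1) _ U(2) AB(4)] AB sub UM by blast
      next
        case False
        then show ?thesis using simple_graphD(2)[OF G(1)] by blast
      qed
    qed
    moreover have "\<Union>\<M> \<noteq> verts G"
    proof -
      obtain x where x: "x \<in> C" using C part(2) by fastforce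
      have "x \<notin> A" if "A \<in> \<M>" for A
        using Pi_mod_disjoint[of A G C] that C sub x by auto
      then show ?thesis using x C part(1) by blast
    qed
    ultimately obtain P where P: "P \<in> Pi_mod G" "\<Union>\<M> \<subseteq> P"
      using module_below_Pi_mod[OF fin(1) c] by blast
    have "A = P" if "A \<in> \<M>" for A
    proof (rule Pi_mod_disjoint)
      show "A \<in> Pi_mod G" "P \<in> Pi_mod G" using that sub P by auto
      show "A \<inter> P \<noteq> {}" using that sub P part(2) by (metis Int_absorb2 Sup_le_iff subsetD)
    qed
    then show ?thesis using False by blast
  qed auto
qed

section \<open>Symbolic execution of programs\<close>

text \<open>Total correctness including time: the existential excludes run-time errors and
  non-termination, and the postcondition receives the exact number of steps.\<close>

definition wp :: "program \<Rightarrow> val list \<Rightarrow> exp \<Rightarrow> (val \<Rightarrow> nat \<Rightarrow> bool) \<Rightarrow> bool" where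
  "wp P env e Q \<longleftrightarrow> (\<exists>v t. eval P env e v t \<and> Q v t)"

definition wps :: "program \<Rightarrow> val list \<Rightarrow> exp list \<Rightarrow> (val list \<Rightarrow> nat \<Rightarrow> bool) \<Rightarrow> bool" where
  "wps P env es Q \<longleftrightarrow> (\<exists>vs t. evals P env es vs t \<and> Q vs t)"

text \<open>A separate constant for function bodies stops the simplifier at every call. The call is
  then resolved by a \<open>run\<close> fact instead of unfolding a recursion.\<close>

definition wpc :: "program \<Rightarrow> nat \<Rightarrow> val list \<Rightarrow> (val \<Rightarrow> nat \<Rightarrow> bool) \<Rightarrow> bool" where
  "wpc P f vs Q \<longleftrightarrow> wp P vs (P ! f) Q"

text \<open>These congruences make the simplifier execute a program from the inside out.\<close>

lemma wp_cong [cong]: "env = env' \<Longrightarrow> e = e' \<Longrightarrow> wp P env e Q = wp P env' e' Q"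
  by simp

lemma wps_cong [cong]: "env = env' \<Longrightarrow> es = es' \<Longrightarrow> wps P env es Q = wps P env' es' Q"
  by simp

lemma wpc_cong [cong]: "vs = vs' \<Longrightarrow> wpc P f vs Q = wpc P f vs' Q"
  by simp

lemma wp_simps:
  "wp P env (Var i) Q \<longleftrightarrow> i < length env \<and> Q (env ! i) 1"
  "wp P env (Const n) Q \<longleftrightarrow> Q (Atom n) 1"
  "wp P env (MkNode e1 e2) Q \<longleftrightarrow>
    wp P env e1 (\<lambda>a t1. wp P env e2 (\<lambda>b t2. Q (Node a b) (t1 + t2 + 1)))"
  "wp P env (Left e) Q \<longleftrightarrow> wp P env e (\<lambda>v t. \<exists>a b. v = Node a b \<and> Q a (t + 1))"
  "wp P env (Right e) Q \<longleftrightarrow> wp P env e (\<lambda>v t. \<exists>a b. v = Node a b \<and> Q b (t + 1))"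
  "wp P env (IsNode e) Q \<longleftrightarrow>
    wp P env e (\<lambda>v t. Q (Atom (if is_node v then 1 else 0)) (t + 1))"
  "wp P env (Arith g e1 e2) Q \<longleftrightarrow>
    wp P env e1 (\<lambda>a t1. wp P env e2 (\<lambda>b t2. \<exists>m n. a = Atom m \<and> b = Atom n \<and>
      Q (Atom (arith g m n)) (t1 + t2 + bit_length m + bit_length n + 1)))"
  "wp P env (Cond e e1 e2) Q \<longleftrightarrow>
    wp P env e (\<lambda>a t. \<exists>n. a = Atom n \<and>
      (if n \<noteq> 0 then wp P env e1 (\<lambda>v t1. Q v (t + t1 + 1))
       else wp P env e2 (\<lambda>v t1. Q v (t + t1 + 1))))"
  "wp P env (LetIn e1 e2) Q \<longleftrightarrow>
    wp P env e1 (\<lambda>a t1. wp P (a # env) e2 (\<lambda>v t2. Q v (t1 + t2 + 1)))"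
  "wp P env (Call f es) Q \<longleftrightarrow>
    wps P env es (\<lambda>vs t1. f < length P \<and> wpc P f vs (\<lambda>v t2. Q v (t1 + t2 + 1)))"
  "wps P env [] R \<longleftrightarrow> R [] 0"
  "wps P env (e # es) R \<longleftrightarrow>
    wp P env e (\<lambda>v t1. wps P env es (\<lambda>vs t2. R (v # vs) (t1 + t2)))"
  unfolding wp_def wps_def wpc_def
  by (rule iffI; (elim exE conjE eval_elims)?;
      fastforce intro: eval_evals.intros split: if_splits)+

section \<open>Time bounds for calls\<close>

definition run :: "program \<Rightarrow> nat \<Rightarrow> val list \<Rightarrow> val \<Rightarrow> nat \<Rightarrow> bool" where
  "run P f vs v T \<longleftrightarrow> (\<exists>t\<le>T. eval P vs (P ! f) v t)"

text \<open>A term for the exact time lets \<open>run_wpc\<close> be an equation, which an upper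
  bound alone would not; \<open>run_cost\<close> brings the bound back once the execution is
  finished.\<close>

definition cost :: "program \<Rightarrow> nat \<Rightarrow> val list \<Rightarrow> nat" where
  "cost P f vs = (THE t. \<exists>v. eval P vs (P ! f) v t)"

lemma runI: "wp P vs (P ! f) (\<lambda>v' t. v' = v \<and> t \<le> T) \<Longrightarrow> run P f vs v T"
  unfolding wp_def run_def by blast

lemma eval_cost: "eval P vs (P ! f) v t \<Longrightarrow> cost P f vs = t"
  unfolding cost_def using eval_deterministic(1) by blast

text \<open>By determinism a known \<open>run\<close> fact fixes result and time, so a call is
  rewritten like a primitive instruction.\<close>

lemma run_wpc: "run P f vs v T \<Longrightarrow> wpc P f vs Q \<longleftrightarrow> Q v (cost P f vs)"
  unfolding run_def wpc_def wp_def using eval_cost eval_deterministic(1) by metis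

lemma run_cost: "run P f vs v T \<Longrightarrow> cost P f vs \<le> T"
  unfolding run_def using eval_cost by metis

lemma run_mono: "run P f vs v T \<Longrightarrow> T \<le> T' \<Longrightarrow> run P f vs v T'"
  unfolding run_def using order_trans by blast

text \<open>Inductions give bounds linear in the length of a list; here the length is replaced by
  the global N, so that callers see a bound in N only.\<close>

lemma run_scale: "run P f vs v ((n + 1) * K) \<Longrightarrow> n \<le> N \<Longrightarrow> run P f vs v ((N + 1) * K)"
  by (rule run_mono, assumption, rule mult_le_mono1, simp)

section \<open>The program\<close>

definition "f_eq = (1::nat)"
definition "f_adj = (2::nat)"
definition "f_app = (3::nat)"
definition "f_filt = (4::nat)"
definition "f_grow = (5::nat)"
definition "f_mem = (6::nat)"
definition "f_sub = (7::nat)"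
definition "f_assoc = (8::nat)"
definition "f_minl = (9::nat)"
definition "f_fedge = (10::nat)"
definition "f_newacc = (11::nat)"
definition "f_order = (12::nat)"
definition "f_flat = (13::nat)"
definition "f_match = (14::nat)"
definition "f_len = (15::nat)"
definition "f_tree = (16::nat)"
definition "f_buckets = (17::nat)"
definition "f_ap = (18::nat)"
definition "f_ins = (19::nat)"
definition "f_elim = (20::nat)"
definition "f_solve = (21::nat)"
definition "f_mul = (22::nat)"
definition "f_sumw = (23::nat)"
definition "f_keys = (24::nat)"

lemmas f_defs = f_eq_def f_adj_def f_app_def f_filt_def f_grow_def f_mem_def f_sub_def f_assoc_def
  f_minl_def f_fedge_def f_newacc_def f_order_def f_flat_def f_match_def f_len_def f_tree_def
  f_buckets_def f_ap_def f_ins_def f_elim_def f_solve_def f_mul_def f_sumw_def f_keys_def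

text \<open>With truncated subtraction the two differences add up to 0 exactly for equal
  numbers.\<close>

definition "eq_code = Arith Less (Arith Add (Arith Sub (Var 0) (Var 1)) (Arith Sub (Var 1) (Var 0))) (Const 1)"

text \<open>An edge is a list of two vertices s and t in either order. If x = s holds but y = t
  fails, the other orientation is not tried; this is sound because s and t differ, a condition that
  \<open>small_edges\<close> carries along.\<close>

definition "adj_code =
  Cond (IsNode (Var 2))
    (Cond (Cond (Call f_eq [Var 0, Left (Left (Var 2))]) (Call f_eq [Var 1, Left (Right (Left (Var 2)))])
             (Cond (Call f_eq [Var 0, Left (Right (Left (Var 2)))]) (Call f_eq [Var 1, Left (Left (Var 2))])
               (Const 0)))
      (Const 1) (Call f_adj [Var 0, Var 1, Right (Var 2)]))
    (Const 0)"

definition "app_code =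
  Cond (IsNode (Var 0)) (MkNode (Left (Var 0)) (Call f_app [Right (Var 0), Var 1])) (Var 1)"

text \<open>Keeps the vertices whose adjacency bit with the first argument differs from the last
  argument: neighbours for 0, non-neighbours for 1.\<close>

definition "filt_code =
  Cond (IsNode (Var 1))
    (Cond (Call f_eq [Call f_adj [Var 0, Left (Var 1), Var 2], Var 3])
      (Call f_filt [Var 0, Right (Var 1), Var 2, Var 3])
      (MkNode (Left (Var 1)) (Call f_filt [Var 0, Right (Var 1), Var 2, Var 3])))
    (Const 0)"

text \<open>The arguments are the processed, the queued and the undiscovered vertices, the edges,
  and a bit that selects the graph (0) or its complement (1). Filtering with the flipped bit retains
  exactly what the first filter rejects.\<close>

definition "grow_code =
  Cond (IsNode (Var 1))
    (Call f_grow
      [MkNode (Left (Var 1)) (Var 0),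
       Call f_app [Call f_filt [Left (Var 1), Var 2, Var 3, Var 4], Right (Var 1)],
       Call f_filt [Left (Var 1), Var 2, Var 3, Arith Sub (Const 1) (Var 4)],
       Var 3, Var 4])
    (MkNode (Var 0) (Var 2))"

definition "mem_code =
  Cond (IsNode (Var 1))
    (Cond (Call f_eq [Var 0, Left (Var 1)]) (Const 1) (Call f_mem [Var 0, Right (Var 1)]))
    (Const 0)"

definition "sub_code =
  Cond (IsNode (Var 0))
    (Cond (Call f_mem [Left (Var 0), Var 1]) (Call f_sub [Right (Var 0), Var 1]) (Const 0))
    (Const 1)"

text \<open>The whole entry is returned, not only its value: an entry is a \<open>Node\<close> and a
  failure an atom, so \<open>IsNode\<close> tests for presence.\<close>

definition "assoc_code =
  Cond (IsNode (Var 1))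
    (Cond (Call f_eq [Var 0, Left (Left (Var 1))]) (Left (Var 1)) (Call f_assoc [Var 0, Right (Var 1)]))
    (Const 0)"

definition "minl_code =
  Cond (IsNode (Right (Var 0)))
    (LetIn (Call f_minl [Right (Var 0)])
      (Cond (Arith Less (Left (Var 1)) (Var 0)) (Left (Var 1)) (Var 0)))
    (Left (Var 0))"

text \<open>Looks for an edge with exactly one end among the keys. The other end is wrapped in a
  \<open>Node\<close> to distinguish success from failure.\<close>

definition "fedge_code =
  Cond (IsNode (Var 0))
    (Cond (IsNode (Call f_assoc [Left (Left (Var 0)), Var 1]))
      (Cond (IsNode (Call f_assoc [Left (Right (Left (Var 0))), Var 1]))
        (Call f_fedge [Right (Var 0), Var 1])
        (MkNode (Left (Right (Left (Var 0)))) (Const 0)))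
      (Cond (IsNode (Call f_assoc [Left (Right (Left (Var 0))), Var 1]))
        (MkNode (Left (Left (Var 0))) (Const 0))
        (Call f_fedge [Right (Var 0), Var 1])))
    (Const 0)"

definition "newacc_code =
  Cond (IsNode (Var 0))
    (LetIn (Call f_minl [Left (Var 0)])
      (Call f_newacc [Right (Var 1),
        Cond (IsNode (Call f_assoc [Var 0, Var 2])) (Var 2)
          (MkNode (MkNode (Var 0) (Left (Var 1))) (Var 2))]))
    (Var 1)"

text \<open>The arguments are the visited nodes, the parts collected so far, all nodes and the tree
  edges. New parts are put in front, so the parts found last are eliminated first.\<close>

definition "order_code =
  LetIn (Call f_fedge [Var 3, Var 0])
    (Cond (IsNode (Var 0))
      (LetIn (Call f_assoc [Left (Var 0), Var 3])
        (Call f_order [MkNode (Var 0) (Var 2), Call f_newacc [Right (Var 0), Var 3], Var 4, Var 5]))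
      (Var 2))"

definition "flat_code =
  Cond (IsNode (Var 0)) (Call f_app [Right (Left (Var 0)), Call f_flat [Right (Var 0)]]) (Const 0)"

definition "match_code =
  Cond (IsNode (Var 1))
    (LetIn (Call f_order
        [MkNode (Left (Left (Left (Var 1)))) (Const 0),
         Call f_newacc [Right (Left (Left (Left (Var 1)))), Const 0],
         Left (Left (Var 1)), Right (Left (Var 1))])
      (LetIn (Call f_flat [Var 0])
        (Cond (Cond (Call f_sub [Var 2, Var 0]) (Call f_sub [Var 0, Var 2]) (Const 0))
          (Var 1) (Call f_match [Var 2, Right (Var 3)]))))
    (Const 0)"

definition "len_code =
  Cond (IsNode (Var 0)) (Arith Add (Call f_len [Right (Var 0)]) (Const 1)) (Const 0)"

text \<open>
  A decision tree is a pair of a key and a payload. Key 0 marks a leaf with payload \<open>(m, X)\<close>, where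
  \<open>m = 0\<close> means infeasible and otherwise \<open>m - 1\<close> is the value of the solution \<open>X\<close>. A positive key is
  the position of a variable in the elimination order, counted from its end.
\<close>

abbreviation (input) "leaf_code m X \<equiv> MkNode (Const 0) (MkNode m X)"

definition "tree_code =
  Cond (IsNode (Var 2))
    (Cond (Call f_adj [Var 0, Left (Left (Var 2)), Var 3])
      (MkNode (Call f_len [Var 2])
        (MkNode (Call f_tree [Var 0, Var 1, Right (Var 2), Var 3]) (leaf_code (Const 0) (Const 0))))
      (Call f_tree [Var 0, Var 1, Right (Var 2), Var 3]))
    (Var 1)"

definition "buckets_code =
  Cond (IsNode (Var 0))
    (MkNode
      (MkNode (Call f_len [Var 0])
        (MkNode (leaf_code (Const 1) (Const 0))
          (Call f_tree [Left (Left (Var 0)), Call f_solve [Right (Left (Var 0)), Var 1], Right (Var 0),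
             Right (Left (Right (Var 1)))])))
      (Call f_buckets [Right (Var 0), Var 1]))
    (MkNode (leaf_code (Const 1) (Const 0)) (Const 0))"

text \<open>The first argument selects addition (0) or maximisation (1). The larger root key stays
  on top; common key 0 means that two leaves are combined.\<close>

definition "ap_code =
  Cond (Arith Less (Left (Var 1)) (Left (Var 2)))
    (MkNode (Left (Var 2))
      (MkNode (Call f_ap [Var 0, Var 1, Left (Right (Var 2))])
              (Call f_ap [Var 0, Var 1, Right (Right (Var 2))])))
    (Cond (Arith Less (Left (Var 2)) (Left (Var 1)))
      (MkNode (Left (Var 1))
        (MkNode (Call f_ap [Var 0, Left (Right (Var 1)), Var 2])
                (Call f_ap [Var 0, Right (Right (Var 1)), Var 2])))
      (Cond (Left (Var 1))
        (MkNode (Left (Var 1))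
          (MkNode (Call f_ap [Var 0, Left (Right (Var 1)), Left (Right (Var 2))])
                  (Call f_ap [Var 0, Right (Right (Var 1)), Right (Right (Var 2))])))
        (Cond (Var 0)
          (Cond (Arith Less (Left (Right (Var 1))) (Left (Right (Var 2)))) (Var 2) (Var 1))
          (Cond (Left (Right (Var 1)))
            (Cond (Left (Right (Var 2)))
              (leaf_code
                (Arith Sub (Arith Add (Left (Right (Var 1))) (Left (Right (Var 2)))) (Const 1))
                (Call f_app [Right (Right (Var 1)), Right (Right (Var 2))]))
              (Var 2))
            (Var 1)))))"

text \<open>The end of the list is not tested: callers guarantee a bucket with the required
  key.\<close>

definition "ins_code =
  Cond (Call f_eq [Left (Var 0), Left (Left (Var 1))])
    (MkNode (Call f_ap [Const 0, Left (Var 1), Var 0]) (Right (Var 1)))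
    (MkNode (Left (Var 1)) (Call f_ins [Var 0, Right (Var 1)]))"

definition "elim_code =
  Cond (IsNode (Right (Var 0)))
    (Call f_elim [Call f_ins [Call f_ap [Const 1, Left (Right (Left (Var 0))), Right (Right (Left (Var 0)))],
       Right (Var 0)]])
    (Left (Var 0))"

text \<open>The second argument is a constant context holding the factor \<open>big\<close>, the
  weighted graph and the tree decompositions; its index grows with every enclosing
  \<open>LetIn\<close>. The value of a single vertex is stored plus one, because payload 0 means
  infeasible.\<close>

definition "solve_code =
  Cond (IsNode (Right (Var 0)))
    (LetIn (Call f_grow [Const 0, MkNode (Left (Var 0)) (Const 0), Right (Var 0),
        Right (Left (Right (Var 1))), Const 0])
      (Cond (IsNode (Right (Var 0)))
        (Call f_ap [Const 0, Call f_solve [Left (Var 0), Var 2], Call f_solve [Right (Var 0), Var 2]])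
        (LetIn (Call f_grow [Const 0, MkNode (Left (Var 1)) (Const 0), Right (Var 1),
            Right (Left (Right (Var 2))), Const 1])
          (Cond (IsNode (Right (Var 0)))
            (Call f_ap [Const 1, Call f_solve [Left (Var 0), Var 3], Call f_solve [Right (Var 0), Var 3]])
            (Call f_elim [Call f_buckets [Call f_match [Var 2, Right (Right (Var 3))], Var 3]])))))
    (LetIn (Call f_assoc [Left (Var 0), Left (Left (Right (Var 1)))])
      (leaf_code
        (Arith Add (Arith Add (Call f_mul [Left (Right (Var 0)), Left (Var 2)]) (Right (Right (Var 0))))
          (Const 1))
        (Var 1)))"

definition "mul_code =
  Cond (Var 0) (Arith Add (Call f_mul [Arith Sub (Var 0) (Const 1), Var 1]) (Var 1)) (Const 0)"

definition "sumw_code =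
  Cond (IsNode (Var 0))
    (Arith Add (Call f_sumw [Right (Var 0)]) (Right (Right (Left (Var 0))))) (Const 0)"

definition "keys_code =
  Cond (IsNode (Var 0)) (MkNode (Left (Left (Var 0))) (Call f_keys [Right (Var 0)])) (Const 0)"

text \<open>The graph without vertices is answered directly, since \<open>f_solve\<close> takes a
  first vertex from its list. The two outer \<open>Right\<close> extract the solution from the
  resulting leaf.\<close>

definition "main_code =
  Cond (IsNode (Left (Left (Var 0))))
    (Right (Right (Call f_solve [Call f_keys [Left (Left (Var 0))],
       MkNode (Arith Add (Call f_sumw [Left (Left (Var 0))]) (Const 1)) (Var 0)])))
    (Const 0)"

definition prog :: program where
  "prog = [main_code, eq_code, adj_code, app_code, filt_code, grow_code, mem_code, sub_code, assoc_code,
    minl_code, fedge_code, newacc_code, order_code, flat_code, match_code, len_code, tree_code,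
    buckets_code, ap_code, ins_code, elim_code, solve_code, mul_code, sumw_code, keys_code]"

lemma prog_nth:
  "prog ! f_eq = eq_code" "prog ! f_adj = adj_code" "prog ! f_app = app_code" "prog ! f_filt = filt_code"
  "prog ! f_grow = grow_code" "prog ! f_mem = mem_code" "prog ! f_sub = sub_code"
  "prog ! f_assoc = assoc_code" "prog ! f_minl = minl_code" "prog ! f_fedge = fedge_code"
  "prog ! f_newacc = newacc_code" "prog ! f_order = order_code" "prog ! f_flat = flat_code"
  "prog ! f_match = match_code" "prog ! f_len = len_code" "prog ! f_tree = tree_code"
  "prog ! f_buckets = buckets_code" "prog ! f_ap = ap_code" "prog ! f_ins = ins_code"
  "prog ! f_elim = elim_code" "prog ! f_solve = solve_code" "prog ! f_mul = mul_code"
  "prog ! f_sumw = sumw_code" "prog ! f_keys = keys_code" "prog ! 0 = main_code"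
  by (simp_all add: prog_def f_defs)

lemma prog_length [simp]:
  "f_eq < length prog" "f_adj < length prog" "f_app < length prog" "f_filt < length prog"
  "f_grow < length prog" "f_mem < length prog" "f_sub < length prog" "f_assoc < length prog"
  "f_minl < length prog" "f_fedge < length prog" "f_newacc < length prog" "f_order < length prog"
  "f_flat < length prog" "f_match < length prog" "f_len < length prog" "f_tree < length prog"
  "f_buckets < length prog" "f_ap < length prog" "f_ins < length prog" "f_elim < length prog"
  "f_solve < length prog" "f_mul < length prog" "f_sumw < length prog" "f_keys < length prog"
  "0 < length prog"
  by (simp_all add: prog_def f_defs)

lemmas program_simps = wp_simps prog_nth
  eq_code_def adj_code_def app_code_def filt_code_def grow_code_def mem_code_def
  sub_code_def assoc_code_def minl_code_def fedge_code_def newacc_code_def order_code_def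
  flat_code_def match_code_def len_code_def tree_code_def buckets_code_def ap_code_def
  ins_code_def elim_code_def solve_code_def mul_code_def sumw_code_def keys_code_def
  main_code_def

abbreviation "runs \<equiv> run prog"

abbreviation nl :: "nat list \<Rightarrow> val" where "nl xs \<equiv> val_of_list (map Atom xs)"

abbreviation el :: "(nat \<times> nat) list \<Rightarrow> val" where
  "el es \<equiv> val_of_list (map (\<lambda>(s, t). Node (Atom s) (Node (Atom t) (Atom 0))) es)"

abbreviation kv :: "('a \<Rightarrow> val) \<Rightarrow> (nat \<times> 'a) list \<Rightarrow> val" where
  "kv h l \<equiv> val_of_list (map (\<lambda>(k, x). Node (Atom k) (h x)) l)"

abbreviation nll :: "nat list list \<Rightarrow> val" where "nll b \<equiv> val_of_list (map nl b)"

lemma bit_length_mono: "m \<le> n \<Longrightarrow> bit_length m \<le> bit_length n"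
  by (rule floorlog_mono)

text \<open>Names of vertices and tree nodes are only known to be short, whereas values, lengths and
  keys are themselves at most N; for the latter this crude estimate is enough.\<close>

lemma bit_length_le: "bit_length n \<le> n"
  using floorlog_leD[of 2 n n] less_exp[of n] floorlog_le_iff[of 2 n n] by simp

lemma bit_length_1 [simp]: "bit_length 1 = 1" "bit_length (Suc 0) = 1"
  by (simp_all add: floorlog_def)

lemma bit_length_0 [simp]: "bit_length 0 = 0"
  by (simp add: floorlog_def)

lemma if_nat_bool [simp]: "((if b then Suc 0 else 0) = 0) = (\<not> b)" "((if b then 1 else 0) = (0::nat)) = (\<not> b)"
  "((if b then 0 else Suc 0) = 0) = b" "(0 < (if b then Suc 0 else 0)) = b"
  by simp_all

text \<open>The numerals in this and the following time bounds have no meaning beyond being large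
  enough; the final estimate uses only the growth in N and K.\<close>

definition "tEq N = 8 * N + (20::nat)"

lemma runs_eq:
  assumes "bit_length x \<le> N" "bit_length y \<le> N"
  shows "runs f_eq [Atom x, Atom y] (Atom (if x = y then 1 else 0)) (tEq N)"
proof -
  have "bit_length (x - y + (y - x)) \<le> N"
    by (rule order_trans[OF bit_length_mono[of _ "max x y"]]) (use assms in \<open>auto simp: max_def\<close>)
  moreover have "bit_length (x - y) \<le> N" "bit_length (y - x) \<le> N"
    using assms bit_length_mono[of "x - y" x] bit_length_mono[of "y - x" y] by auto
  ultimately show ?thesis
    using assms by (intro runI) (auto simp: program_simps tEq_def)
qed

text \<open>
  Case splitting would substitute equal numbers for each other, after which the arguments of the
  calls no longer match the lemmas about them.
\<close>

declare if_split [split del] if_weak_cong [cong del]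

section \<open>Running times of the basic functions\<close>

abbreviation "smalls N xs \<equiv> \<forall>x\<in>set xs. bit_length x \<le> (N::nat)"

abbreviation "small_edges N es \<equiv> \<forall>(s, t)\<in>set es. bit_length s \<le> (N::nat) \<and> bit_length t \<le> N \<and> s \<noteq> t"

definition "tAdj N = (N + 1) * (50 + 4 * tEq N)"

lemma runs_adj:
  assumes "bit_length x \<le> N" "bit_length y \<le> N"
    and "small_edges N es"
  shows "runs f_adj [Atom x, Atom y, el es] (Atom (if (x, y) \<in> set es \<or> (y, x) \<in> set es then 1 else 0))
     ((length es + 1) * (50 + 4 * tEq N))"
  using assms(3)
proof (induction es)
  case Nil
  show ?case by (rule runI) (simp add: program_simps)
next
  case (Cons e es)
  obtain s t where e: "e = (s, t)" by fastforce
  have st: "bit_length s \<le> N" "bit_length t \<le> N" "s \<noteq> t" using Cons.prems e by auto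
  have "small_edges N es" using Cons.prems by simp
  note r = Cons.IH[OF this] runs_eq[OF assms(1) st(1)] runs_eq[OF assms(1) st(2)]
     runs_eq[OF assms(2) st(1)] runs_eq[OF assms(2) st(2)]
  note [simp] = r[THEN run_wpc]
  show ?case
    by (intro runI, simp add: program_simps e)
      (use r[THEN run_cost] st(3) in \<open>auto split: if_split\<close>)
qed

lemmas runs_adj' = runs_adj[where N = N, THEN run_scale[where N = N], folded tAdj_def] for N

lemma runs_app:
  "runs f_app [nl xs, nl ys] (nl (xs @ ys)) ((length xs + 1) * 20)"
proof (induction xs)
  case Nil
  show ?case by (rule runI) (simp add: program_simps)
next
  case (Cons x xs)
  note [simp] = Cons.IH[THEN run_wpc, simplified]
  show ?case
    by (intro runI, simp add: program_simps)
      (use Cons.IH[THEN run_cost] in \<open>auto split: if_split\<close>)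
qed

lemma runs_app':
  "length xs \<le> N \<Longrightarrow> runs f_app [nl xs, nl ys] (nl (xs @ ys)) ((N + 1) * 20)"
  by (rule run_mono[OF runs_app]) simp

abbreviation "touches es x y \<equiv> (x, y) \<in> set es \<or> (y, x) \<in> set es"

definition "tFilt N = (N + 1) * (50 + tAdj N + tEq N)"

lemma runs_filt:
  assumes "bit_length x \<le> N" "small_edges N es" "length es \<le> N" "smalls N R" "1 \<le> N"
  shows "runs f_filt [Atom x, nl R, el es, Atom (if q then 1 else 0)]
     (nl (filter (\<lambda>y. touches es x y \<noteq> q) R)) ((length R + 1) * (50 + tAdj N + tEq N))"
  using assms(4)
proof (induction R)
  case Nil
  show ?case by (rule runI) (simp add: program_simps)
next
  case (Cons y R)
  have y: "bit_length y \<le> N" using Cons.prems by auto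
  have b: "bit_length (if touches es x y then 1 else 0) \<le> N" "bit_length (if q then 1 else 0) \<le> N"
    using assms(5) by (auto split: if_split)
  have p: "smalls N R" using Cons.prems by simp_all
  note r = Cons.IH[OF p] runs_adj'[OF assms(1) y assms(2,3)] runs_eq[OF b]
  note [simp] = r[THEN run_wpc, simplified]
  show ?case
    by (intro runI, simp add: program_simps)
      (use r[THEN run_cost] in \<open>auto split: if_split\<close>)
qed

lemmas runs_filt' = runs_filt[where N = N, THEN run_scale[where N = N], folded tFilt_def] for N

definition "tMem N = (N + 1) * (50 + tEq N)"

lemma runs_mem:
  assumes "bit_length x \<le> N" "smalls N L"
  shows "runs f_mem [Atom x, nl L] (Atom (if x \<in> set L then 1 else 0)) ((length L + 1) * (50 + tEq N))"
  using assms(2)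
proof (induction L)
  case Nil
  show ?case by (rule runI) (simp add: program_simps)
next
  case (Cons y L)
  have p: "smalls N L" using Cons.prems by simp_all
  have y: "bit_length y \<le> N" using Cons.prems by auto
  note r = Cons.IH[OF p] runs_eq[OF assms(1) y]
  note [simp] = r[THEN run_wpc, simplified]
  show ?case
    by (intro runI, simp add: program_simps)
      (use r[THEN run_cost] in \<open>auto split: if_split\<close>)
qed

lemmas runs_mem' = runs_mem[where N = N, THEN run_scale[where N = N], folded tMem_def] for N

definition "tSub N = (N + 1) * (50 + tMem N)"

lemma runs_sub:
  assumes "smalls N L" "length L \<le> N" "smalls N A"
  shows "runs f_sub [nl A, nl L] (Atom (if set A \<subseteq> set L then 1 else 0)) ((length A + 1) * (50 + tMem N))"
  using assms(3)
proof (induction A)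
  case Nil
  show ?case by (rule runI) (simp add: program_simps)
next
  case (Cons y A)
  have p: "smalls N A" using Cons.prems by simp_all
  have y: "bit_length y \<le> N" using Cons.prems by auto
  note r = Cons.IH[OF p] runs_mem'[OF y assms(1,2)]
  note [simp] = r[THEN run_wpc, simplified]
  show ?case
    by (intro runI, simp add: program_simps)
      (use r[THEN run_cost] in \<open>auto split: if_split\<close>)
qed

lemmas runs_sub' = runs_sub[where N = N, THEN run_scale[where N = N], folded tSub_def] for N

definition "tAssoc N = (N + 1) * (50 + tEq N)"

abbreviation "entry h x l \<equiv> (case map_of l x of None \<Rightarrow> Atom 0 | Some y \<Rightarrow> Node (Atom x) (h y))"

lemma runs_assoc:
  assumes "bit_length x \<le> N" "smalls N (map fst l)"
  shows "runs f_assoc [Atom x, kv h l] (entry h x l) ((length l + 1) * (50 + tEq N))"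
  using assms(2)
proof (induction l)
  case Nil
  show ?case by (rule runI) (simp add: program_simps)
next
  case (Cons e l)
  have p: "smalls N (map fst l)" using Cons.prems by simp_all
  obtain k z where e: "e = (k, z)" by fastforce
  have k: "bit_length k \<le> N" using Cons.prems e by auto
  note r = Cons.IH[OF p] runs_eq[OF assms(1) k]
  note [simp] = r[THEN run_wpc, simplified]
  show ?case
    by (intro runI, simp add: program_simps e)
      (use r[THEN run_cost] in \<open>auto split: if_split\<close>)
qed

lemmas runs_assoc' = runs_assoc[where N = N, THEN run_scale[where N = N], folded tAssoc_def] for N

definition "tMinl N = (N + 1) * (50 + 2 * N)"

lemma runs_minl:
  assumes "L \<noteq> []" "smalls N L"
  shows "runs f_minl [nl L] (Atom (Min (set L))) ((length L + 1) * (50 + 2 * N))"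
  using assms
proof (induction L rule: list_nonempty_induct)
  case (single x)
  then show ?case by (intro runI) (simp add: program_simps)
next
  case (cons x L)
  have IH: "runs f_minl [nl L] (Atom (Min (set L))) ((length L + 1) * (50 + 2 * N))"
    using cons by auto
  have "Min (set L) \<in> set L" using cons.hyps by simp
  then have b: "bit_length x \<le> N" "bit_length (Min (set L)) \<le> N" using cons.prems by auto
  obtain y L' where L: "L = y # L'" using cons.hyps by (cases L) auto
  have "Min (set (x # L)) = min x (Min (set L))"
    using cons.hyps by simp
  then have m: "Min (set (x # L)) = (if x < Min (set L) then x else Min (set L))"
    unfolding min_def by arith
  note r = IH
  note [simp] = r[THEN run_wpc, simplified L, simplified]
  show ?case unfolding m unfolding L
    by (intro runI, simp add: program_simps)
      (use r[THEN run_cost] b in \<open>auto simp: L split: if_split\<close>)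
qed

lemmas runs_minl' = runs_minl[where N = N, THEN run_scale[where N = N], folded tMinl_def] for N

definition "tLen N = (N + 1) * (50 + N)"

lemma runs_len:
  "length l \<le> N \<Longrightarrow> runs f_len [val_of_list l] (Atom (length l)) ((length l + 1) * (50 + N))"
proof (induction l)
  case Nil
  show ?case by (rule runI) (simp add: program_simps)
next
  case (Cons e l)
  have r: "runs f_len [val_of_list l] (Atom (length l)) ((length l + 1) * (50 + N))"
    using Cons by auto
  have b: "bit_length (length l) \<le> N" using Cons.prems bit_length_le[of "length l"] by simp
  note [simp] = r[THEN run_wpc, simplified]
  show ?case
    by (intro runI, simp add: program_simps)
      (use r[THEN run_cost] b in \<open>auto split: if_split\<close>)
qed

lemma runs_len':
  "length l \<le> N \<Longrightarrow> runs f_len [val_of_list l] (Atom (length l)) (tLen N)"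
  by (rule run_mono[OF runs_len]) (auto simp: tLen_def intro: mult_mono)

text \<open>K holds the processed, Q the discovered and R the untouched elements. A discovery moves
  an element from R to Q, so the total length of Q and R drops exactly by the processed
  element.\<close>

function grow :: "(nat \<Rightarrow> nat \<Rightarrow> bool) \<Rightarrow> nat list \<Rightarrow> nat list \<Rightarrow> nat list \<Rightarrow> nat list \<times> nat list" where
  "grow r K [] R = (K, R)"
| "grow r K (x # Q) R = grow r (x # K) (filter (r x) R @ Q) (filter (\<lambda>y. \<not> r x y) R)"
  by pat_completeness auto
termination
proof (relation "measure (\<lambda>(r, K, Q, R). length Q + length R)")
  show "((r, x # K, filter (r x) R @ Q, filter (\<lambda>y. \<not> r x y) R), r, K, x # Q, R)
    \<in> measure (\<lambda>(r, K, Q, R). length Q + length R)" for r :: "nat \<Rightarrow> nat \<Rightarrow> bool" and x K Q R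
    using sum_length_filter_compl[of "r x" R] by simp
qed simp

definition "tGrow N = (N + 1) * (100 + 2 * tFilt N + (N + 1) * 20)"

lemma runs_grow:
  assumes "small_edges N es" "length es \<le> N" "1 \<le> N"
    and "smalls N Q" "smalls N R" "length Q + length R \<le> N"
  shows "runs f_grow [nl K, nl Q, nl R, el es, Atom (if q then 1 else 0)]
     (let (K', R') = grow (\<lambda>x y. touches es x y \<noteq> q) K Q R in Node (nl K') (nl R'))
     ((length Q + length R + 1) * (100 + 2 * tFilt N + (N + 1) * 20))"
  using assms(4-)
proof (induction "\<lambda>x y. touches es x y \<noteq> q" K Q R rule: grow.induct)
  case (1 K R)
  show ?case by (rule runI) (simp add: program_simps)
next
  case (2 K x Q R)
  let ?r = "\<lambda>x y. touches es x y \<noteq> q"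
  let ?R1 = "filter (?r x) R" and ?R2 = "filter (\<lambda>y. \<not> ?r x y) R"
  have len: "length ?R1 + length ?R2 = length R"
    by (rule sum_length_filter_compl)
  have x: "bit_length x \<le> N" using 2 by simp
  have IH: "runs f_grow [nl (x # K), nl (?R1 @ Q), nl ?R2, el es, Atom (if q then 1 else 0)]
     (let (K', R') = grow ?r (x # K) (?R1 @ Q) ?R2 in Node (nl K') (nl R'))
     ((length (?R1 @ Q) + length ?R2 + 1) * (100 + 2 * tFilt N + (N + 1) * 20))"
    using 2 len by (intro 2(1)) auto
  have "length R \<le> N" "smalls N R" using 2 by auto
  note F = runs_filt'[OF x assms(1,2) this(2) assms(3) this(1)]
  have "length ?R1 \<le> N" using 2(4) len by simp
  note A = runs_app'[OF this, of Q]
  have q2: "(\<lambda>y. touches es x y \<noteq> (\<not> q)) = (\<lambda>y. \<not> ?r x y)"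
    by auto
  have q1: "Suc 0 - (if q then Suc 0 else 0) = (if \<not> q then Suc 0 else 0)"
    by (simp split: if_split)
  have bq: "bit_length (if q then Suc 0 else 0) \<le> 1"
    by (simp split: if_split)
  have len': "length (?R1 @ Q) + length ?R2 + 1 = length Q + length R + 1" using len by simp
  note r = IH[unfolded len'] F[of q] F[of "\<not> q", unfolded q2] A
  note [simp] = r[THEN run_wpc, simplified]
  show ?case
    by (intro runI, simp add: program_simps q1)
      (use r[THEN run_cost] bq in auto)
qed

section \<open>Traversal of a tree decomposition\<close>

fun fedge :: "(nat \<times> nat) list \<Rightarrow> nat set \<Rightarrow> nat option" where
  "fedge [] V = None"
| "fedge ((s, t) # es) V =
    (if s \<in> V then if t \<in> V then fedge es V else Some t else if t \<in> V then Some s else fedge es V)"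

abbreviation opt :: "nat option \<Rightarrow> val" where
  "opt r \<equiv> (case r of None \<Rightarrow> Atom 0 | Some t \<Rightarrow> Node (Atom t) (Atom 0))"

definition "tFedge N = (N + 1) * (100 + 3 * tAssoc N)"

lemma is_node_entry [simp]: "is_node (entry h x l) \<longleftrightarrow> x \<in> fst ` set l"
  by (auto simp: map_of_eq_None_iff split: option.split)
     (metis map_of_eq_None_iff option.distinct(1) image_eqI fst_conv)+

lemma runs_fedge:
  assumes "length l \<le> N" "smalls N (map fst l)" "small_edges N es"
  shows "runs f_fedge [el es, kv h l] (opt (fedge es (fst ` set l))) ((length es + 1) * (100 + 3 * tAssoc N))"
  using assms(3)
proof (induction es)
  case Nil
  show ?case by (rule runI) (simp add: program_simps)
next
  case (Cons e es)
  obtain s t where e: "e = (s, t)" by fastforce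
  have p: "small_edges N es" using Cons.prems by simp_all
  have st: "bit_length s \<le> N" "bit_length t \<le> N" using Cons.prems e by auto
  note r = Cons.IH[OF p] runs_assoc'[OF st(1) assms(2,1), of h] runs_assoc'[OF st(2) assms(2,1), of h]
  note [simp] = r[THEN run_wpc]
  show ?case
    by (intro runI, simp add: program_simps e)
      (use r[THEN run_cost] in \<open>auto split: if_split\<close>)
qed

lemmas runs_fedge' = runs_fedge[where N = N, THEN run_scale[where N = N], folded tFedge_def] for N

text \<open>Different bags may list the same part in different orders. Its minimum is a canonical
  name, which keeps a part from entering twice.\<close>

fun newacc :: "nat list list \<Rightarrow> (nat \<times> nat list) list \<Rightarrow> (nat \<times> nat list) list" where
  "newacc [] acc = acc"
| "newacc (p # b) acc =
    newacc b (if Min (set p) \<in> fst ` set acc then acc else (Min (set p), p) # acc)"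

definition "tNewacc N = (N + 1) * (100 + tMinl N + tAssoc N)"

text \<open>A list without repetition over U has at most N entries, all with short names; this
  settles the size conditions of the basic functions.\<close>

locale universe =
  fixes U :: "nat set" and N :: nat
  assumes U: "finite U" "card U \<le> N" "\<And>u. u \<in> U \<Longrightarrow> bit_length u \<le> N"
begin

definition acc_ok :: "(nat \<times> nat list) list \<Rightarrow> bool" where
  "acc_ok acc \<longleftrightarrow> distinct (map fst acc) \<and> fst ` set acc \<subseteq> U"

definition part_ok :: "nat list \<Rightarrow> bool" where
  "part_ok p \<longleftrightarrow> p \<noteq> [] \<and> distinct p \<and> set p \<subseteq> U"

lemma acc_okD: "acc_ok acc \<Longrightarrow> smalls N (map fst acc)" "acc_ok acc \<Longrightarrow> length acc \<le> N"
proof -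
  assume a: "acc_ok acc"
  then show "smalls N (map fst acc)" using U(3) by (auto simp: acc_ok_def)
  show "length acc \<le> N"
    using a card_mono[OF U(1), of "set (map fst acc)"] U(2) distinct_card[of "map fst acc"]
    by (auto simp: acc_ok_def)
qed

lemma part_okD: "part_ok p \<Longrightarrow> smalls N p" "part_ok p \<Longrightarrow> length p \<le> N"
proof -
  assume a: "part_ok p"
  then show "smalls N p" using U(3) by (auto simp: part_ok_def)
  show "length p \<le> N"
    using a card_mono[OF U(1), of "set p"] U(2) distinct_card[of p]
    by (auto simp: part_ok_def)
qed

lemma acc_ok_step:
  assumes "acc_ok acc" "part_ok p"
  shows "acc_ok (if Min (set p) \<in> fst ` set acc then acc else (Min (set p), p) # acc)"
  using assms Min_in[of "set p"] by (auto simp: acc_ok_def part_ok_def split: if_split)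

lemma acc_ok_newacc:
  "acc_ok acc \<Longrightarrow> \<forall>p\<in>set b. part_ok p \<Longrightarrow> acc_ok (newacc b acc)"
proof (induction b arbitrary: acc)
  case (Cons p b)
  then show ?case using acc_ok_step[of acc p] by simp
qed simp

lemma runs_newacc:
  assumes "acc_ok acc" "\<forall>p\<in>set b. part_ok p"
  shows "runs f_newacc [nll b, kv nl acc] (kv nl (newacc b acc)) ((length b + 1) * (100 + tMinl N + tAssoc N))"
  using assms
proof (induction b arbitrary: acc)
  case Nil
  show ?case by (rule runI) (simp add: program_simps)
next
  case (Cons p b)
  have p: "part_ok p" using Cons.prems by auto
  then have ne: "p \<noteq> []" "Min (set p) \<in> U" using Min_in[of "set p"] by (auto simp: part_ok_def)
  let ?a = "if Min (set p) \<in> fst ` set acc then acc else (Min (set p), p) # acc"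
  have IH: "runs f_newacc [nll b, kv nl ?a] (kv nl (newacc b ?a)) ((length b + 1) * (100 + tMinl N + tAssoc N))"
    using Cons acc_ok_step[OF Cons.prems(1) p] by auto
  note r = IH runs_minl'[OF ne(1) part_okD[OF p]] runs_assoc'[OF U(3)[OF ne(2)] acc_okD[OF Cons.prems(1)], of nl]
  note [simp] = r[THEN run_wpc]
  show ?case
  \<comment> \<open>The conditional is an argument of the recursive call, so each of its two shapes
    is executed separately for the call to match the induction hypothesis.\<close>
  proof (cases "Min (set p) \<in> fst ` set acc")
    case True
    then have "?a = acc" by (simp split: if_split)
    note r = r[unfolded this]
    note [simp] = r[THEN run_wpc]
    show ?thesis using True
    by (intro runI, simp add: program_simps)
      (use r[THEN run_cost] in \<open>auto split: if_split\<close>)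
  next
    case False
    then have "?a = (Min (set p), p) # acc" by (simp split: if_split)
    note r = r[unfolded this]
    note [simp] = r[THEN run_wpc, simplified]
    show ?thesis using False
    by (intro runI, simp add: program_simps)
      (use r[THEN run_cost] in \<open>auto split: if_split\<close>)
  qed
qed

lemmas runs_newacc' = runs_newacc[THEN run_scale[where N = N], folded tNewacc_def]

end

type_synonym td = "(nat \<times> nat list list) list \<times> (nat \<times> nat) list"

text \<open>The checks on t make the recursion terminate on every input. On a well-formed
  decomposition they succeed, and the program omits them.\<close>

function order :: "(nat \<times> nat list list) list \<Rightarrow> (nat \<times> nat) list \<Rightarrow> (nat \<times> nat list list) list \<Rightarrow>
    (nat \<times> nat list) list \<Rightarrow> (nat \<times> nat list) list" where
  "order nds es vis acc =
    (case fedge es (fst ` set vis) of None \<Rightarrow> acc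
     | Some t \<Rightarrow> (case map_of nds t of None \<Rightarrow> acc
       | Some b \<Rightarrow> if t \<in> fst ` set vis then acc else order nds es ((t, b) # vis) (newacc b acc)))"
  by pat_completeness auto
termination
proof (relation "measure (\<lambda>(nds, es, vis, acc). card (fst ` set nds - fst ` set vis))", goal_cases)
  case (2 nds es vis acc t b)
  have "t \<in> fst ` set nds" using 2(2) by (metis map_of_SomeD fst_conv image_eqI)
  then have "fst ` set nds - fst ` set ((t, b) # vis) \<subset> fst ` set nds - fst ` set vis"
    using 2(3) by auto
  then show ?case
    unfolding in_measure prod.case by (intro psubset_card_mono) auto
qed simp

declare order.simps [simp del]

lemma fedge_SomeD:
  "fedge es V = Some t \<Longrightarrow> t \<notin> V \<and> (\<exists>s\<in>V. touches es s t)"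
  by (induction es V rule: fedge.induct) (auto split: if_splits)

lemma fedge_NoneD:
  "fedge es V = None \<Longrightarrow> (s, t) \<in> set es \<Longrightarrow> s \<in> V \<longleftrightarrow> t \<in> V"
  by (induction es V rule: fedge.induct) (auto split: if_splits)

abbreviation tdv :: "td \<Rightarrow> val" where
  "tdv d \<equiv> (case d of (nds, es) \<Rightarrow> Node (kv nll nds) (el es))"

definition start :: "td \<Rightarrow> (nat \<times> nat list) list" where
  "start d = order (fst d) (snd d) [hd (fst d)] (newacc (snd (hd (fst d))) [])"

abbreviation "flat acc \<equiv> concat (map snd acc)"

fun find_td :: "nat list \<Rightarrow> td list \<Rightarrow> (nat \<times> nat list) list" where
  "find_td S [] = []"
| "find_td S (d # D) = (if set S \<subseteq> set (flat (start d)) \<and> set (flat (start d)) \<subseteq> set S then start d else find_td S D)"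

definition parts_disjoint :: "td \<Rightarrow> bool" where
  "parts_disjoint d \<longleftrightarrow> (\<forall>p \<in> \<Union>(set ` snd ` set (fst d)). \<forall>q \<in> \<Union>(set ` snd ` set (fst d)).
     set p \<inter> set q \<noteq> {} \<longrightarrow> set p = set q)"

definition "tOrder N = (N + 1) * (100 + tFedge N + tAssoc N + tNewacc N)"

context universe
begin

definition td_ok :: "td \<Rightarrow> bool" where
  "td_ok d \<longleftrightarrow> (case d of (nds, es) \<Rightarrow>
     nds \<noteq> [] \<and> length nds \<le> N \<and> length es \<le> N \<and> distinct (map fst nds) \<and> smalls N (map fst nds) \<and>
     (\<forall>(s, t)\<in>set es. s \<in> fst ` set nds \<and> t \<in> fst ` set nds \<and> s \<noteq> t) \<and>
     (\<forall>(t, b)\<in>set nds. length b \<le> N \<and> (\<forall>p\<in>set b. part_ok p)))"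

lemma runs_order:
  assumes ok: "td_ok (nds, es)" and "acc_ok acc" "distinct (map fst vis)" "fst ` set vis \<subseteq> fst ` set nds"
  shows "runs f_order [kv nll vis, kv nl acc, kv nll nds, el es] (kv nl (order nds es vis acc))
    ((length nds - length vis + 1) * (100 + tFedge N + tAssoc N + tNewacc N))"
  using assms
proof (induction nds es vis acc rule: order.induct)
  case (1 nds es vis acc)
  note ok = 1(2) and prems = 1(3-)
  have nds: "smalls N (map fst nds)" "small_edges N es" "length es \<le> N" "length nds \<le> N"
    "distinct (map fst nds)" 
    using ok by (auto simp: td_ok_def)
  have "card (fst ` set vis) \<le> card (fst ` set nds)"
    using prems(3) by (intro card_mono) auto
  then have lv: "length vis \<le> length nds"
    using prems(2) nds(5) distinct_card by (metis list.set_map length_map)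
  have vis: "length vis \<le> N" "smalls N (map fst vis)"
    using lv nds(4) apply simp
    using prems(3) nds(1) unfolding set_map by blast
  note F = runs_fedge'[OF vis nds(2,3), of nll]
  show ?case
  proof (cases "fedge es (fst ` set vis)")
    case None
    note [simp] = F[THEN run_wpc]
    show ?thesis
      by (intro runI, simp add: program_simps order.simps[of nds] None)
        (use F[THEN run_cost] in auto)
  next
    case (Some t)
    have t: "t \<notin> fst ` set vis" "t \<in> fst ` set nds"
      using fedge_SomeD[OF Some] ok by (fastforce simp: td_ok_def)+
    then obtain b where b: "map_of nds t = Some b"
      by (metis map_of_eq_None_iff not_Some_eq)
    then have tb: "(t, b) \<in> set nds" by (rule map_of_SomeD)
    then have bs: "\<forall>p\<in>set b. part_ok p" "length b \<le> N" "bit_length t \<le> N"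
      using ok by (auto simp: td_ok_def)
    have lt: "length vis < length nds"
    proof -
      have "card (fst ` set vis) < card (fst ` set nds)"
        using prems(3) t by (intro psubset_card_mono) auto
      then show ?thesis
        using prems(2) nds(5) distinct_card by (metis list.set_map length_map)
    qed
    have IH: "runs f_order [kv nll ((t, b) # vis), kv nl (newacc b acc), kv nll nds, el es]
      (kv nl (order nds es ((t, b) # vis) (newacc b acc)))
      ((length nds - length ((t, b) # vis) + 1) * (100 + tFedge N + tAssoc N + tNewacc N))"
      using Some b t prems acc_ok_newacc[OF prems(1) bs(1)] ok by (intro 1(1)) auto
    have le: "length nds - length ((t, b) # vis) + 1 = length nds - length vis" using lt by simp
    obtain m where m: "length nds - length vis = m" by blast
    note r = IH[unfolded le m] F[unfolded Some] runs_assoc'[OF bs(3) nds(1,4), of nll, unfolded b]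
      runs_newacc'[OF prems(1) bs(1,2)]
    note [simp] = r[THEN run_wpc, simplified]
    show ?thesis
      by (intro runI, simp add: program_simps order.simps[of nds _ vis] Some b t m)
        (use r[THEN run_cost] in auto)
  qed
qed

lemma acc_ok_order:
  assumes ok: "td_ok (nds, es)" and "acc_ok acc"
  shows "acc_ok (order nds es vis acc)"
  using assms
proof (induction nds es vis acc rule: order.induct)
  case (1 nds es vis acc)
  have "acc_ok (newacc b acc)" if "map_of nds t = Some b" for t b
    using map_of_SomeD[OF that] 1(2) by (intro acc_ok_newacc[OF 1(3)]) (auto simp: td_ok_def)
  then show ?case
    using 1 by (subst order.simps) (auto split: option.split if_split)
qed

lemma runs_order':
  assumes ok: "td_ok (nds, es)" and "acc_ok acc" "distinct (map fst vis)" "fst ` set vis \<subseteq> fst ` set nds"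
  shows "runs f_order [kv nll vis, kv nl acc, kv nll nds, el es] (kv nl (order nds es vis acc)) (tOrder N)"
proof (rule run_mono[OF runs_order[OF assms]])
  have "length nds - length vis + 1 \<le> N + 1" using ok by (auto simp: td_ok_def)
  then show "(length nds - length vis + 1) * (100 + tFedge N + tAssoc N + tNewacc N) \<le> tOrder N"
    unfolding tOrder_def by (rule mult_le_mono1)
qed

definition "tFlat = (N + 1) * (50 + (N + 1) * 20)"

lemma runs_flat:
  "\<forall>p\<in>snd ` set acc. part_ok p \<Longrightarrow>
   runs f_flat [kv nl acc] (nl (flat acc)) ((length acc + 1) * (50 + (N + 1) * 20))"
proof (induction acc)
  case Nil
  show ?case by (rule runI) (simp add: program_simps)
next
  case (Cons e acc)
  obtain k p where e: "e = (k, p)" by fastforce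
  have p: "length p \<le> N" using Cons.prems e part_okD(2)[of p] by auto
  have ps: "\<forall>p\<in>snd ` set acc. part_ok p" using Cons.prems by simp_all
  note r = Cons.IH[OF ps] runs_app'[OF p, of "flat acc"]
  note [simp] = r[THEN run_wpc, simplified]
  show ?case
    by (intro runI, simp add: program_simps e)
      (use r[THEN run_cost] in \<open>auto split: if_split\<close>)
qed

lemma runs_flat':
  assumes "acc_ok acc" "\<forall>p\<in>snd ` set acc. part_ok p"
  shows "runs f_flat [kv nl acc] (nl (flat acc)) tFlat"
  by (rule run_mono[OF runs_flat[OF assms(2)]])
    (unfold tFlat_def, use acc_okD(2)[OF assms(1)] in \<open>intro mult_le_mono1, simp\<close>)

lemma newacc_parts: "set (newacc b acc) \<subseteq> set acc \<union> (\<lambda>p. (Min (set p), p)) ` set b"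
  by (induction b acc rule: newacc.induct) (auto split: if_splits)

lemma order_parts:
  assumes "\<And>t b. (t, b) \<in> set nds \<Longrightarrow> (\<lambda>p. (Min (set p), p)) ` set b \<subseteq> X" "set acc \<subseteq> X"
  shows "set (order nds es vis acc) \<subseteq> X"
  using assms
proof (induction nds es vis acc rule: order.induct)
  case (1 nds es vis acc)
  have "set (newacc b acc) \<subseteq> X" if "map_of nds t = Some b" for t b
    using newacc_parts[of b acc] 1(2)[OF map_of_SomeD[OF that]] 1(3) by blast
  then show ?case
    using 1 by (subst order.simps) (auto split: option.split if_split)
qed

end

definition "tFind N = (N + 1) * (200 + tOrder N + tNewacc N + (N + 1) * (50 + (N + 1) * 20) + 2 * tSub N)"

context universe
begin

text \<open>Parts that meet have the same elements and hence the same minimum, so distinct keys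
  force disjoint parts.\<close>

lemma distinct_flat:
  assumes "distinct (map fst acc)" "\<And>k p. (k, p) \<in> set acc \<Longrightarrow> k = Min (set p) \<and> distinct p"
    and "\<And>k p k' p'. (k, p) \<in> set acc \<Longrightarrow> (k', p') \<in> set acc \<Longrightarrow> set p \<inter> set p' \<noteq> {} \<Longrightarrow> set p = set p'"
  shows "distinct (flat acc)"
  using assms
proof (induction acc)
  case (Cons e acc)
  obtain k p where e: "e = (k, p)" by fastforce
  have "distinct (flat acc)"
    using Cons.prems(1) by (intro Cons.IH Cons.prems(2,3)) auto
  moreover have "distinct p" using Cons.prems(2) e by auto
  moreover have "set p \<inter> set p' = {}" if "(k', p') \<in> set acc" for k' p'
  proof (rule ccontr)
    assume "set p \<inter> set p' \<noteq> {}"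
    then have "set p = set p'" using Cons.prems(3)[of k p k' p'] that e by auto
    then have "k = k'" using Cons.prems(2)[of k p] Cons.prems(2)[of k' p'] that e by auto
    then show False using Cons.prems(1) that e by force
  qed
  ultimately show ?case using e by fastforce
qed simp

lemma start_entries:
  assumes "td_ok d"
  shows "acc_ok (start d)" "set (start d) \<subseteq> (\<lambda>p. (Min (set p), p)) ` \<Union>(set ` snd ` set (fst d))"
proof -
  obtain nds es where d: "d = (nds, es)" by fastforce
  obtain t b nds' where nds: "nds = (t, b) # nds'" using assms d by (cases nds) (auto simp: td_ok_def)
  have b: "\<forall>p\<in>set b. part_ok p" using assms d nds by (auto simp: td_ok_def)
  have "acc_ok []" by (simp add: acc_ok_def)
  then show "acc_ok (start d)" unfolding start_def d nds
    using acc_ok_order[OF _ acc_ok_newacc[OF _ b]] assms d nds by simp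
  show "set (start d) \<subseteq> (\<lambda>p. (Min (set p), p)) ` \<Union>(set ` snd ` set (fst d))"
    unfolding start_def d nds fst_conv list.sel snd_conv
    using newacc_parts[of b "[]"] by (intro order_parts) fastforce+
qed

lemma start_parts:
  assumes "td_ok d" "parts_disjoint d"
  shows "\<forall>p\<in>snd ` set (start d). part_ok p" "distinct (flat (start d))" "set (flat (start d)) \<subseteq> U"
    "smalls N (flat (start d))" "length (flat (start d)) \<le> N"
proof -
  note se = start_entries[OF assms(1)]
  show *: "\<forall>p\<in>snd ` set (start d). part_ok p"
    using se(2) assms(1) by (fastforce simp: td_ok_def)
  then have **: "distinct p" if "(k, p) \<in> set (start d)" for k p
    using that by (force simp: part_ok_def)
  show dis: "distinct (flat (start d))"
  proof (rule distinct_flat)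
    show "distinct (map fst (start d))" using se(1) by (simp add: acc_ok_def)
    show "k = Min (set p) \<and> distinct p" if "(k, p) \<in> set (start d)" for k p
      using se(2) **[OF that] that by auto
    show "set p = set p'" if "(k, p) \<in> set (start d)" "(k', p') \<in> set (start d)" "set p \<inter> set p' \<noteq> {}"
      for k p k' p'
    proof -
      have "p \<in> \<Union>(set ` snd ` set (fst d))" "p' \<in> \<Union>(set ` snd ` set (fst d))"
        using se(2) that by auto
      then show ?thesis using assms(2) that(3) unfolding parts_disjoint_def by blast
    qed
  qed
  show sub: "set (flat (start d)) \<subseteq> U" using * by (auto simp: part_ok_def)
  then show "smalls N (flat (start d))" using U(3) by blast
  show "length (flat (start d)) \<le> N"
    using card_mono[OF U(1) sub] U(2) distinct_card[OF dis] by linarith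
qed

lemma runs_find_td:
  assumes "\<forall>d\<in>set D. td_ok d \<and> parts_disjoint d" "smalls N S" "length S \<le> N"
  shows "runs f_match [nl S, val_of_list (map tdv D)] (kv nl (find_td S D))
    ((length D + 1) * (200 + tOrder N + tNewacc N + tFlat + 2 * tSub N))"
  using assms(1)
proof (induction D)
  case Nil
  show ?case by (rule runI) (simp add: program_simps)
next
  case (Cons d D)
  obtain nds es where d: "d = (nds, es)" by fastforce
  have ok: "td_ok d" "parts_disjoint d" using Cons.prems by auto
  obtain t b nds' where nds: "nds = (t, b) # nds'" using ok d by (cases nds) (auto simp: td_ok_def)
  have b: "\<forall>p\<in>set b. part_ok p" "length b \<le> N" using ok d nds by (auto simp: td_ok_def)
  have a: "acc_ok []" by (simp add: acc_ok_def)
  define st where "st = start d"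
  have R: "runs f_order [kv nll [(t, b)], kv nl (newacc b []), kv nll nds, el es] (kv nl st) (tOrder N)"
    using runs_order'[of nds es "newacc b []" "[(t, b)]"] ok(1) acc_ok_newacc[OF a b(1)]
    by (simp add: d nds start_def st_def)
  have F: "find_td S (d # D) =
      (if set S \<subseteq> set (flat st) \<and> set (flat st) \<subseteq> set S then st else find_td S D)"
    by (simp add: st_def)
  note sp = start_parts[OF ok, folded st_def]
  have p: "\<forall>d\<in>set D. td_ok d \<and> parts_disjoint d" using Cons.prems by simp_all
  note r = Cons.IH[OF p] R[unfolded nds] runs_newacc'[OF a b] runs_flat'[OF start_entries(1)[OF ok(1), folded st_def] sp(1)]
    runs_sub'[OF sp(4,5) assms(2,3)] runs_sub'[OF assms(2,3) sp(4,5)]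
  note [simp] = r[THEN run_wpc, simplified]
  show ?case
    unfolding F unfolding d nds
    by (intro runI, simp add: program_simps)
      (use r[THEN run_cost] in \<open>auto split: if_split\<close>)
qed

lemmas runs_find_td' = runs_find_td[THEN run_scale[where N = N], unfolded tFlat_def, folded tFind_def]

end

section \<open>Decision trees\<close>

datatype dt = Lf nat "nat list" | Br nat dt dt

fun enc :: "dt \<Rightarrow> val" where
  "enc (Lf m X) = Node (Atom 0) (Node (Atom m) (nl X))"
| "enc (Br k f g) = Node (Atom k) (Node (enc f) (enc g))"

fun nodes :: "dt \<Rightarrow> nat" where
  "nodes (Lf m X) = 1"
| "nodes (Br k f g) = 1 + nodes f + nodes g"

text \<open>Keys decrease strictly from the root and stay in Z, as in an ordered binary decision
  diagram without sharing. Inner keys are positive because 0 marks a leaf.\<close>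

fun ordered_in :: "nat set \<Rightarrow> dt \<Rightarrow> bool" where
  "ordered_in Z (Lf m X) = True"
| "ordered_in Z (Br k f g) \<longleftrightarrow> k \<in> Z \<and> 0 < k \<and> ordered_in (Z \<inter> {..<k}) f \<and> ordered_in (Z \<inter> {..<k}) g"

text \<open>Summing the length with the value gives a single bound that is subadditive under \<open>pointwise False\<close>.\<close>

fun leaf_bound :: "dt \<Rightarrow> nat" where
  "leaf_bound (Lf m X) = m + length X"
| "leaf_bound (Br k f g) = max (leaf_bound f) (leaf_bound g)"

text \<open>With key 0 a leaf sorts below every variable, so constants end up in the last
  bucket.\<close>

fun key :: "dt \<Rightarrow> nat" where
  "key (Lf m X) = 0"
| "key (Br k f g) = k"

text \<open>Payload 0 absorbs under addition; otherwise \<open>m + n - 1\<close> removes one of the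
  two shifts by one. Under maximisation 0 loses against every feasible value.\<close>

fun leaf_op :: "bool \<Rightarrow> nat \<Rightarrow> nat list \<Rightarrow> nat \<Rightarrow> nat list \<Rightarrow> dt" where
  "leaf_op True m X n Y = (if m < n then Lf n Y else Lf m X)"
| "leaf_op False m X n Y = (if m = 0 then Lf m X else if n = 0 then Lf n Y else Lf (m + n - 1) (X @ Y))"

fun pointwise :: "bool \<Rightarrow> dt \<Rightarrow> dt \<Rightarrow> dt" where
  "pointwise b (Lf m X) (Lf n Y) = leaf_op b m X n Y"
| "pointwise b (Lf m X) (Br l g0 g1) = Br l (pointwise b (Lf m X) g0) (pointwise b (Lf m X) g1)"
| "pointwise b (Br k f0 f1) (Lf n Y) = Br k (pointwise b f0 (Lf n Y)) (pointwise b f1 (Lf n Y))"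
| "pointwise b (Br k f0 f1) (Br l g0 g1) =
    (if k < l then Br l (pointwise b (Br k f0 f1) g0) (pointwise b (Br k f0 f1) g1)
     else if l < k then Br k (pointwise b f0 (Br l g0 g1)) (pointwise b f1 (Br l g0 g1))
     else Br k (pointwise b f0 g0) (pointwise b f1 g1))"

lemma ordered_in_mono: "ordered_in Z t \<Longrightarrow> Z \<subseteq> Z' \<Longrightarrow> ordered_in Z' t"
proof (induction Z t arbitrary: Z' rule: ordered_in.induct)
  case (2 Z k f g)
  then show ?case using Int_mono[OF 2(4) order_refl] by auto
qed simp

lemma ordered_in_leaf_op: "ordered_in Z (leaf_op b m X n Y)"
  by (cases b) (auto split: if_split)

lemma ordered_in_pointwise: "ordered_in Z f \<Longrightarrow> ordered_in Z g \<Longrightarrow> ordered_in Z (pointwise b f g)"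
proof (induction b f g arbitrary: Z rule: pointwise.induct)
  case (1 b m X n Y)
  then show ?case by (simp add: ordered_in_leaf_op)
next
  case (4 b k f0 f1 l g0 g1)
  consider "k < l" | "l < k" | "k = l" by linarith
  then show ?case
  proof cases
    case 1
    have "ordered_in (Z \<inter> {..<l}) (Br k f0 f1)"
      using 4(7) 1 by (auto elim: ordered_in_mono)
    then show ?thesis using 4 1 by (auto simp del: ordered_in.simps(2)) (auto)
  next
    case 2
    have "ordered_in (Z \<inter> {..<k}) (Br l g0 g1)"
      using 4(8) 2 by (auto elim: ordered_in_mono)
    then show ?thesis using 4 2 by (auto simp del: ordered_in.simps(2)) (auto)
  next
    case 3
    then show ?thesis using 4 by auto
  qed
qed auto

text \<open>A path uses every key at most once, so the tree is at most the full binary tree of depth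
  \<open>card Z\<close>.\<close>

lemma nodes_le: "ordered_in Z t \<Longrightarrow> finite Z \<Longrightarrow> nodes t + 1 \<le> 2 ^ (card Z + 1)"
proof (induction t arbitrary: Z)
  case (Br k f g)
  have "card (Z \<inter> {..<k}) < card Z"
    using Br.prems by (intro psubset_card_mono) auto
  then have c: "(2::nat) ^ (card (Z \<inter> {..<k}) + 1) \<le> 2 ^ card Z"
    by (intro power_increasing) auto
  show ?case
    using Br.IH(1)[of "Z \<inter> {..<k}"] Br.IH(2)[of "Z \<inter> {..<k}"] Br.prems c by simp
next
  case (Lf m X)
  have "(1::nat) \<le> 2 ^ card Z" by simp
  then show ?case by (simp only: nodes.simps power_add power_one_right)
qed

lemma leaf_bound_plus: "leaf_bound (pointwise False f g) \<le> leaf_bound f + leaf_bound g"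
  by (induction False f g rule: pointwise.induct) (auto split: if_split)

lemma leaf_bound_max: "leaf_bound (pointwise True f g) \<le> max (leaf_bound f) (leaf_bound g)"
  by (induction True f g rule: pointwise.induct) (auto split: if_split)

definition "tAp N = 400 + 60 * (N::nat)"

text \<open>Every call creates exactly one node of the result, so the time is charged to nodes. The
  factor linear in N pays for arithmetic and for appending solutions at the leaves.\<close>

lemma runs_ap:
  assumes "ordered_in {..N} f" "ordered_in {..N} g" "leaf_bound f + leaf_bound g \<le> N"
  shows "runs f_ap [Atom (if b then 1 else 0), enc f, enc g] (enc (pointwise b f g)) (nodes (pointwise b f g) * tAp N)"
  using assms
proof (induction b f g rule: pointwise.induct)
  case (1 b m X n Y)
  have b: "bit_length m \<le> N" "bit_length n \<le> N" "bit_length (m + n) \<le> N"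
    using 1 bit_length_le[of m] bit_length_le[of n] bit_length_le[of "m + n"] by auto
  have X: "length X \<le> N" using 1 by simp
  note r = runs_app'[OF X, of Y]
  note [simp] = r[THEN run_wpc, simplified]
  show ?case
    by (cases b; intro runI, simp add: program_simps)
      (use r[THEN run_cost] b in \<open>auto simp: tAp_def add_mult_distrib split: if_split\<close>)
next
  case (2 b m X l g0 g1)
  have l: "bit_length l \<le> N" "0 < l" using 2 bit_length_le[of l] by auto
  have "ordered_in {..N} g0" "ordered_in {..N} g1" using 2(4) by (auto elim: ordered_in_mono)
  note r = 2(1)[OF 2(3) this(1)] 2(2)[OF 2(3) this(2)]
  have "leaf_bound (Lf m X) + leaf_bound g0 \<le> N" "leaf_bound (Lf m X) + leaf_bound g1 \<le> N" using 2 by auto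
  note r = r(1)[OF this(1)] r(2)[OF this(2)]
  note [simp] = r[THEN run_wpc, simplified]
  show ?case
    by (intro runI, simp add: program_simps l)
      (use r[THEN run_cost] l in \<open>auto simp: tAp_def add_mult_distrib split: if_split\<close>)
next
  case (3 b k f0 f1 n Y)
  have l: "bit_length k \<le> N" "0 < k" using 3 bit_length_le[of k] by auto
  have "ordered_in {..N} f0" "ordered_in {..N} f1" using 3(3) by (auto elim: ordered_in_mono)
  note r = 3(1)[OF this(1) 3(4)] 3(2)[OF this(2) 3(4)]
  have "leaf_bound f0 + leaf_bound (Lf n Y) \<le> N" "leaf_bound f1 + leaf_bound (Lf n Y) \<le> N" using 3 by auto
  note r = r(1)[OF this(1)] r(2)[OF this(2)]
  note [simp] = r[THEN run_wpc, simplified]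
  show ?case
    by (intro runI, simp add: program_simps l)
      (use r[THEN run_cost] l in \<open>auto simp: tAp_def add_mult_distrib split: if_split\<close>)
next
  case (4 b k f0 f1 l g0 g1)
  have b: "bit_length k \<le> N" "0 < k" "bit_length l \<le> N" "0 < l"
    using 4(7,8) bit_length_le[of k] bit_length_le[of l] by auto
  have o: "ordered_in {..N} f0" "ordered_in {..N} f1" "ordered_in {..N} g0" "ordered_in {..N} g1" using 4(7,8) by (auto elim: ordered_in_mono)
  have d: "leaf_bound f0 + leaf_bound g0 \<le> N" "leaf_bound f1 + leaf_bound g1 \<le> N"
    "leaf_bound (Br k f0 f1) + leaf_bound g0 \<le> N" "leaf_bound (Br k f0 f1) + leaf_bound g1 \<le> N"
    "leaf_bound f0 + leaf_bound (Br l g0 g1) \<le> N" "leaf_bound f1 + leaf_bound (Br l g0 g1) \<le> N"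
    using 4(9) by auto
  consider "k < l" | "l < k" | "k = l" by linarith
  then show ?case
  proof cases
    case 1
    note r = 4(1)[OF 1 4(7) o(3) d(3)] 4(2)[OF 1 4(7) o(4) d(4)]
    note [simp] = r[THEN run_wpc, simplified]
    show ?thesis using 1
      by (intro runI, simp add: program_simps b)
        (use r[THEN run_cost] b in \<open>auto simp: tAp_def add_mult_distrib split: if_split\<close>)
  next
    case 2
    then have n: "\<not> k < l" by simp
    note r = 4(3)[OF n 2 o(1) 4(8) d(5)] 4(4)[OF n 2 o(2) 4(8) d(6)]
    note [simp] = r[THEN run_wpc, simplified]
    show ?thesis using 2 n
      by (intro runI, simp add: program_simps b)
        (use r[THEN run_cost] b in \<open>auto simp: tAp_def add_mult_distrib split: if_split\<close>)
  next
    case 3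
    then have n: "\<not> k < l" "\<not> l < k" by simp_all
    note r = 4(5)[OF n o(1,3) d(1)] 4(6)[OF n o(2,4) d(2)]
    note [simp] = r[THEN run_wpc, simplified]
    show ?thesis using n b 3
      by (intro runI, simp add: program_simps)
        (use r[THEN run_cost] b in \<open>auto simp: tAp_def add_mult_distrib split: if_split\<close>)
  qed
qed

text \<open>The contribution of choosing r, as a chain of tests on the later entries: a chosen
  neighbour makes it infeasible, and if there is none it is l. An entry followed by L has key
  \<open>Suc (length L)\<close>, its position from the end.\<close>

fun tree :: "(nat \<Rightarrow> nat \<Rightarrow> bool) \<Rightarrow> nat \<Rightarrow> dt \<Rightarrow> (nat \<times> nat list) list \<Rightarrow> dt" where
  "tree A r l [] = l"
| "tree A r l (e # L) =
    (if A r (fst e) then Br (Suc (length L)) (tree A r l L) (Lf 0 []) else tree A r l L)"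

definition "tTree N = (N + 1) * (100 + tAdj N + tLen N)"

lemma runs_tree:
  assumes "bit_length x \<le> N" "small_edges N es" "length es \<le> N" "smalls N (map fst L)" "length L \<le> N"
  shows "runs f_tree [Atom x, enc l, kv nl L, el es] (enc (tree (touches es) x l L))
     ((length L + 1) * (100 + tAdj N + tLen N))"
  using assms(4,5)
proof (induction L)
  case Nil
  show ?case by (rule runI) (simp add: program_simps)
next
  case (Cons e L)
  obtain y p where e: "e = (y, p)" by fastforce
  have y: "bit_length y \<le> N" using Cons.prems e by auto
  have p: "smalls N (map fst L)" "length L \<le> N" using Cons.prems by simp_all
  note r = Cons.IH[OF p(1) p(2)] runs_adj'[OF assms(1) y assms(2,3)]
    runs_len'[of "map (\<lambda>(k, x). Node (Atom k) (nl x)) (e # L)" N, simplified, OF Cons.prems(2)[simplified], unfolded e, simplified]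
  note [simp] = r[THEN run_wpc, simplified]
  show ?case
    by (intro runI, simp add: program_simps e)
      (use r[THEN run_cost] in \<open>auto split: if_split\<close>)
qed

lemmas runs_tree' = runs_tree[where N = N, THEN run_scale[where N = N], folded tTree_def] for N

fun ins :: "dt \<Rightarrow> dt list \<Rightarrow> dt list" where
  "ins f [] = []"
| "ins f (F # Fs) = (if key f = key F then pointwise False F f # Fs else F # ins f Fs)"

lemma length_ins [simp]: "length (ins f Fs) = length Fs"
  by (induction Fs) (auto split: if_split)

fun merge :: "dt \<Rightarrow> dt" where
  "merge (Lf m X) = Lf m X"
| "merge (Br k f g) = pointwise True f g"

function elim :: "dt list \<Rightarrow> dt" where
  "elim [] = Lf 0 []"
| "elim [F] = F"
| "elim (F # G # Fs) = elim (ins (merge F) (G # Fs))"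
  by pat_completeness auto
termination by (relation "measure length") (auto split: if_split)

text \<open>The keys are forced to descend to 0, so each key below the length has exactly one
  bucket, and the last bucket is a leaf.\<close>

fun binv :: "(nat \<Rightarrow> nat set) \<Rightarrow> dt list \<Rightarrow> bool" where
  "binv Z [] = True"
| "binv Z (F # Fs) \<longleftrightarrow> key F = length Fs \<and> ordered_in (Z (key F)) F \<and> binv Z Fs"

lemma key_leaf_op [simp]: "key (leaf_op b m X n Y) = 0"
  by (cases b) (auto split: if_split)

lemma key_pointwise [simp]: "key (pointwise b f g) = max (key f) (key g)"
  by (induction b f g rule: pointwise.induct) (auto simp: max_def split: if_split)

lemma binv_ins: "binv Z Fs \<Longrightarrow> ordered_in (Z (key f)) f \<Longrightarrow> binv Z (ins f Fs)"
  by (induction Fs) (auto simp: ordered_in_pointwise split: if_split)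

lemma leaf_bound_ins: "sum_list (map leaf_bound (ins f Fs)) \<le> leaf_bound f + sum_list (map leaf_bound Fs)"
proof (induction Fs)
  case (Cons F Fs)
  then show ?case using leaf_bound_plus[of F f] by (auto split: if_split)
qed simp

lemma leaf_bound_merge: "leaf_bound (merge F) \<le> leaf_bound F"
  using leaf_bound_max by (cases F) auto

text \<open>
  \<open>Z j\<close> is the set of variables allowed in trees with root \<open>j\<close>. Closure makes the tree that remains
  after eliminating \<open>j\<close> fit into the bucket of its own root.
\<close>

locale buckets =
  fixes Z :: "nat \<Rightarrow> nat set" and K :: nat
  assumes Z_le: "Z j \<subseteq> {..j}"
    and card_Z: "card (Z j) \<le> K"
    and Z_closed: "i \<in> Z j \<Longrightarrow> 0 < i \<Longrightarrow> Z j \<inter> {..i} \<subseteq> Z i"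
begin

text \<open>The root i that remains after eliminating k lies in \<open>Z k\<close>, and closure puts
  the smaller keys of \<open>Z k\<close> into \<open>Z i\<close>. So the merged tree obeys the bound
  of the bucket that receives it.\<close>

lemma key_merge_less:
  assumes "ordered_in (Z (key F)) F" "0 < key F"
  shows "key (merge F) < key F" "ordered_in (Z (key (merge F))) (merge F)"
proof -
  obtain k f g where F: "F = Br k f g" using assms(2) by (cases F) auto
  let ?Y = "Z k \<inter> {..<k}"
  have "ordered_in ?Y f" "ordered_in ?Y g" "0 < k" using assms F by auto
  then have m: "ordered_in ?Y (merge F)" using F by (auto intro: ordered_in_pointwise)
  have "key t < k" if "ordered_in ?Y t" for t using that \<open>0 < k\<close> by (cases t) auto
  from this[OF m] show "key (merge F) < key F" using F by simp
  show "ordered_in (Z (key (merge F))) (merge F)"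
  proof (cases "merge F")
    case (Br i f' g')
    have i: "i \<in> Z k" "0 < i" "i < k" using m Br by auto
    have "?Y \<inter> {..<i} \<subseteq> Z i \<inter> {..<i}" using Z_closed[OF i(1,2)] by auto
    moreover have "i \<in> Z i" using Z_closed[OF i(1,2)] i(1) by auto
    moreover have "ordered_in (?Y \<inter> {..<i}) f'" "ordered_in (?Y \<inter> {..<i}) g'" using m Br by auto
    ultimately show ?thesis using Br i(2) by (auto intro: ordered_in_mono)
  qed simp
qed

lemma binv_merge:
  assumes "binv Z (F # Fs)" "Fs \<noteq> []"
  shows "binv Z (ins (merge F) Fs)" "key (merge F) < length Fs"
  using assms key_merge_less[of F] by (auto intro!: binv_ins)

lemma finite_Z: "finite (Z j)"
  using Z_le finite_subset by blast

lemma ordered_in_nodes: "ordered_in (Z j) t \<Longrightarrow> nodes t \<le> 2 ^ (K + 1)"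
proof -
  assume "ordered_in (Z j) t"
  then have "nodes t + 1 \<le> 2 ^ (card (Z j) + 1)" using finite_Z by (rule nodes_le)
  also have "(2::nat) ^ (card (Z j) + 1) \<le> 2 ^ (K + 1)"
    using card_Z by (intro power_increasing) auto
  finally show ?thesis by simp
qed

text \<open>Both summands are ordered within the same set of variables, hence so is the sum: sizes
  do not multiply, and one addition costs at most \<open>2 ^ (K + 1)\<close> nodes.\<close>

lemma runs_ins:
  assumes "binv Z Fs" "ordered_in (Z (key f)) f" "key f < length Fs" "length Fs \<le> N"
    "leaf_bound f + sum_list (map leaf_bound Fs) \<le> N"
  shows "runs f_ins [enc f, val_of_list (map enc Fs)] (val_of_list (map enc (ins f Fs)))
    (length Fs * (100 + tEq N) + 2 ^ (K + 1) * tAp N)"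
  using assms
proof (induction Fs)
  case (Cons F Fs)
  have enc: "\<exists>v. enc t = Node (Atom (key t)) v" for t by (cases t) auto
  obtain vf vF where v: "enc f = Node (Atom (key f)) vf" "enc F = Node (Atom (key F)) vF"
    using enc by blast
  have "key f \<le> N" "key F \<le> N" using Cons.prems by auto
  then have b: "bit_length (key f) \<le> N" "bit_length (key F) \<le> N"
    using bit_length_le order_trans by blast+
  note E = runs_eq[OF b]
  show ?case
  proof (cases "key f = key F")
    case True
    have okF: "ordered_in (Z (key f)) F" using Cons.prems(1) unfolding True binv.simps by blast
    have "Z (key f) \<subseteq> {..N}" using Z_le[of "key f"] \<open>key f \<le> N\<close> by auto
    then have "ordered_in {..N} F" "ordered_in {..N} f" using okF Cons.prems(2) by (auto intro: ordered_in_mono)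
    then have A: "runs f_ap [Atom (if False then 1 else 0), enc F, enc f] (enc (pointwise False F f)) (nodes (pointwise False F f) * tAp N)"
      using Cons.prems by (intro runs_ap) auto
    have A: "runs f_ap [Atom 0, enc F, enc f] (enc (pointwise False F f)) (2 ^ (K + 1) * tAp N)"
      using run_mono[OF A mult_le_mono1[OF ordered_in_nodes[OF ordered_in_pointwise[OF okF Cons.prems(2)]]]] by simp
    note r = A E
    note [simp] = r[THEN run_wpc, simplified, unfolded v True, simplified]
    show ?thesis
      by (intro runI, simp add: program_simps v True)
        (use r[THEN run_cost] in \<open>auto simp: v True split: if_split\<close>)
  next
    case False
    have "runs f_ins [enc f, val_of_list (map enc Fs)] (val_of_list (map enc (ins f Fs)))
      (length Fs * (100 + tEq N) + 2 ^ (K + 1) * tAp N)"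
      using Cons.prems False by (intro Cons.IH) auto
    note r = this E
    note [simp] = r[THEN run_wpc, simplified, unfolded v, simplified]
    show ?thesis using False
      by (intro runI, simp add: program_simps v)
        (use r[THEN run_cost] in \<open>auto simp: v split: if_split\<close>)
  qed
qed simp

text \<open>The sum of the leaf bounds never grows. The factor 2 pays for merging the two sons of
  one tree, since each of them may reach the bound of the whole tree.\<close>

lemma runs_elim:
  assumes "binv Z Fs" "Fs \<noteq> []" "length Fs \<le> N" "2 * sum_list (map leaf_bound Fs) \<le> N"
  shows "runs f_elim [val_of_list (map enc Fs)] (enc (elim Fs))
    (length Fs * (200 + N * (100 + tEq N) + 2 * (2 ^ (K + 1) * tAp N)))"
  using assms
proof (induction Fs rule: elim.induct)
  case (2 F)
  show ?case by (rule runI) (simp add: program_simps)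
next
  case (3 F G Fs)
  let ?L = "G # Fs"
  have kF: "0 < key F" "ordered_in (Z (key F)) F" using 3(2) by auto
  obtain k f g where F: "F = Br k f g" using kF by (cases F) auto
  have mk: "key (merge F) < length ?L" "binv Z (ins (merge F) ?L)"
    using binv_merge[OF 3(2)] by auto
  have "Z (key F) \<subseteq> {..N}" using Z_le[of "key F"] 3(2,4) by auto
  then have kN: "ordered_in {..N} F" using kF(2) by (auto intro: ordered_in_mono)
  then have "ordered_in {..N} f" "ordered_in {..N} g" using F by (auto intro: ordered_in_mono)
  then have A: "runs f_ap [Atom (if True then 1 else 0), enc f, enc g] (enc (pointwise True f g)) (nodes (pointwise True f g) * tAp N)"
    using 3(5) F by (intro runs_ap) auto
  have "ordered_in (Z k) (pointwise True f g)" using kF(2) F by (auto intro!: ordered_in_pointwise intro: ordered_in_mono)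
  then have A: "runs f_ap [Atom 1, enc f, enc g] (enc (merge F)) (2 ^ (K + 1) * tAp N)"
    using run_mono[OF A mult_le_mono1[OF ordered_in_nodes]] F by simp
  have I: "runs f_ins [enc (merge F), val_of_list (map enc ?L)] (val_of_list (map enc (ins (merge F) ?L)))
    (length ?L * (100 + tEq N) + 2 ^ (K + 1) * tAp N)"
    using 3(2,4,5) leaf_bound_merge[of F] key_merge_less[OF kF(2,1)] mk by (intro runs_ins) auto
  have l: "length ?L * (100 + tEq N) \<le> N * (100 + tEq N)" using 3(4) by (intro mult_le_mono1) auto
  have I: "runs f_ins [enc (merge F), val_of_list (map enc ?L)] (val_of_list (map enc (ins (merge F) ?L)))
    (N * (100 + tEq N) + 2 ^ (K + 1) * tAp N)"
    by (rule run_mono[OF I]) (use l in simp)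
  have "runs f_elim [val_of_list (map enc (ins (merge F) ?L))] (enc (elim (ins (merge F) ?L)))
    (length (ins (merge F) ?L) * (200 + N * (100 + tEq N) + 2 * (2 ^ (K + 1) * tAp N)))"
  proof (rule 3(1))
    show "ins (merge F) ?L \<noteq> []" using length_ins[of "merge F" ?L] by (metis length_0_conv list.distinct(1))
    show "length (ins (merge F) ?L) \<le> N" using 3(4) by (simp only: length_ins) simp
    have "sum_list (map leaf_bound (ins (merge F) ?L)) \<le> sum_list (map leaf_bound (F # ?L))"
      by (rule order_trans[OF leaf_bound_ins]) (use leaf_bound_merge[of F] in simp)
    then show "2 * sum_list (map leaf_bound (ins (merge F) ?L)) \<le> N"
      using 3(5) by (meson mult_le_mono2 order_trans)
  qed (rule mk)
  note r = this[unfolded length_ins] A I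
  \<comment> \<open>Opaque names for the list and the bounds keep the simplifier from expanding them
    during the execution.\<close>
  obtain R where R: "ins (merge F) ?L = R" by blast
  obtain M where M: "2 ^ (K + 1) * tAp N = M" by blast
  obtain M' where M': "N * (100 + tEq N) = M'" by blast
  note r = r[unfolded R M M']
  have El: "elim (F # G # Fs) = elim R" using R by simp
  note [simp] = r[THEN run_wpc, unfolded F, simplified]
  show ?case unfolding El M M' unfolding F
    by (intro runI, simp add: program_simps)
      (use r[THEN run_cost] F in \<open>auto split: if_split\<close>)
qed simp

end

section \<open>Arithmetic on costs and weights\<close>

definition "tMul N = (N + 1) * (100 + 6 * N)"

text \<open>Repeated addition takes time linear in the value of x, which is affordable because costs
  are at most N.\<close>

lemma runs_mul:
  "x * y \<le> N \<Longrightarrow> x \<le> N \<Longrightarrow> y \<le> N \<Longrightarrow> runs f_mul [Atom x, Atom y] (Atom (x * y)) ((x + 1) * (100 + 6 * N))"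
proof (induction x)
  case 0
  show ?case by (rule runI) (simp add: program_simps)
next
  case (Suc x)
  have r: "runs f_mul [Atom x, Atom y] (Atom (x * y)) ((x + 1) * (100 + 6 * N))"
    using Suc by auto
  have b: "bit_length (Suc x) \<le> N" "bit_length y \<le> N" "bit_length (x * y) \<le> N"
    using Suc.prems bit_length_le[of "Suc x"] bit_length_le[of y] bit_length_le[of "x * y"] by simp_all
  note [simp] = r[THEN run_wpc, simplified]
  show ?case
    by (intro runI, simp add: program_simps)
      (use r[THEN run_cost] b in \<open>auto simp: add.commute split: if_split\<close>)
qed

abbreviation wv :: "nat \<times> nat \<Rightarrow> val" where "wv p \<equiv> (case p of (c, w) \<Rightarrow> Node (Atom c) (Atom w))"

lemma runs_sumw:
  "(\<Sum>(v, c, w)\<leftarrow>W. w) \<le> N \<Longrightarrow> runs f_sumw [kv wv W] (Atom (\<Sum>(v, c, w)\<leftarrow>W. w)) ((length W + 1) * (50 + 2 * N))"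
proof (induction W)
  case Nil
  show ?case by (rule runI) (simp add: program_simps)
next
  case (Cons e W)
  obtain v c w where e: "e = (v, c, w)" by (cases e) auto
  have r: "runs f_sumw [kv wv W] (Atom (\<Sum>(v, c, w)\<leftarrow>W. w)) ((length W + 1) * (50 + 2 * N))"
    using Cons e by auto
  have b: "bit_length w \<le> N" "bit_length (\<Sum>(v, c, w)\<leftarrow>W. w) \<le> N"
    using Cons.prems e bit_length_le[of w] bit_length_le[of "\<Sum>(v, c, w)\<leftarrow>W. w"] by auto
  note [simp] = r[THEN run_wpc, simplified]
  show ?case
    by (intro runI, simp add: program_simps e)
      (use r[THEN run_cost] b in \<open>auto simp: add.commute split: if_split\<close>)
qed

lemma runs_keys:
  "runs f_keys [kv h W] (nl (map fst W)) ((length W + 1) * 50)"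
proof (induction W)
  case Nil
  show ?case by (rule runI) (simp add: program_simps)
next
  case (Cons e W)
  obtain v c where e: "e = (v, c)" by (cases e) auto
  note r = Cons.IH
  note [simp] = r[THEN run_wpc, simplified]
  show ?case
    by (intro runI, simp add: program_simps e)
      (use r[THEN run_cost] in \<open>auto simp: add.commute split: if_split\<close>)
qed

declare if_split [split] if_weak_cong [cong]

section \<open>Tree decompositions and elimination orders\<close>

text \<open>A walk that returns to a vertex of the path is cut back to the first visit of that
  vertex.\<close>

lemma rtrancl_distinct_path:
  assumes "(x, y) \<in> R\<^sup>*"
  shows "\<exists>xs. xs \<noteq> [] \<and> hd xs = x \<and> last xs = y \<and> distinct xs \<and> successively (\<lambda>a b. (a, b) \<in> R) xs"
  using assms
proof (induction rule: rtrancl_induct)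
  case base
  show ?case by (rule exI[of _ "[x]"]) simp
next
  case (step y z)
  then obtain xs where xs: "xs \<noteq> []" "hd xs = x" "last xs = y" "distinct xs"
    "successively (\<lambda>a b. (a, b) \<in> R) xs" by blast
  show ?case
  proof (cases "z \<in> set xs")
    case True
    then obtain ys zs where "xs = ys @ z # zs" by (meson split_list)
    then have e: "xs = (ys @ [z]) @ zs" by simp
    have "hd (ys @ [z]) = x" using xs(1,2) unfolding e by (cases ys) auto
    moreover have "distinct (ys @ [z])" "successively (\<lambda>a b. (a, b) \<in> R) (ys @ [z])"
      using xs(4,5) unfolding e by (simp_all only: distinct_append successively_append_iff)
    ultimately show ?thesis by (intro exI[of _ "ys @ [z]"]) auto
  next
    case False
    then show ?thesis using xs step(2)
      by (intro exI[of _ "xs @ [z]"]) (auto simp: successively_append_iff)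
  qed
qed

text \<open>A path from u to s that avoids the edge between them would be closed to a cycle by this
  edge.\<close>

lemma is_tree_bridge:
  assumes T: "is_tree T" and us: "adj T u s" "u \<noteq> s"
  shows "(u, s) \<notin> {(a, b). adj T a b \<and> {a, b} \<noteq> {u, s}}\<^sup>*"
proof
  assume "(u, s) \<in> {(a, b). adj T a b \<and> {a, b} \<noteq> {u, s}}\<^sup>*"
  from rtrancl_distinct_path[OF this] obtain xs where xs: "xs \<noteq> []" "hd xs = u" "last xs = s" "distinct xs"
    "successively (\<lambda>a b. adj T a b \<and> {a, b} \<noteq> {u, s}) xs" by auto
  \<comment> \<open>One vertex is impossible since u and s differ, and two vertices since the path
    avoids their edge; a cycle needs at least three.\<close>
  have "length xs \<noteq> 1" using xs us(2) by (auto simp: length_Suc_conv)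
  moreover have "length xs \<noteq> 2"
    using xs by (auto simp: length_Suc_conv numeral_2_eq_2)
  ultimately have len: "3 \<le> length xs"
    using xs(1) by (cases xs rule: remdups_adj.cases) (auto simp: Suc_le_eq numeral_eq_Suc neq_Nil_conv)
  have "{xs ! i, xs ! (Suc i mod length xs)} \<in> edges T" if i: "i < length xs" for i
  proof (cases "Suc i = length xs")
    case True
    then show ?thesis using us(1) xs(1-3) i adj_sym[of u s T]
      by (metis diff_Suc_1 hd_conv_nth last_conv_nth mod_self)
  next
    case False
    then have "Suc i < length xs" using i by simp
    then show ?thesis using xs(5) successively_nth[OF xs(5)] by simp
  qed
  then have "is_cycle T xs" using len xs(4) by (simp add: is_cycle_def)
  then show False using T unfolding is_tree_def by blast
qed

text \<open>If s did not carry v, the connected set of nodes carrying v would lead from u to l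
  without the edge to s. The visited nodes lead from l on to s, also without that edge because u is
  unvisited. Together this contradicts \<open>is_tree_bridge\<close>.\<close>

lemma is_tree_crossing:
  assumes T: "is_tree T" and con: "connected_graph (induced T {t. v \<in> R t})"
    and V: "V \<subseteq> verts T" "(l, s) \<in> {(a, b). adj T a b \<and> a \<in> V \<and> b \<in> V}\<^sup>*"
    and s: "s \<in> V" "adj T s u" "u \<in> verts T - V" and l: "l \<in> V" and v: "v \<in> R u" "v \<in> R l"
  shows "v \<in> R s"
proof (rule ccontr)
  assume n: "v \<notin> R s"
  let ?E = "{(a, b). adj T a b \<and> {a, b} \<noteq> {u, s}}"
  have "(u, l) \<in> {(a, b). adj (induced T {t. v \<in> R t}) a b}\<^sup>*"
    using con s(3) V(1) l v unfolding connected_graph_def by auto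
  moreover have "{(a, b). adj (induced T {t. v \<in> R t}) a b} \<subseteq> ?E"
    using n by (auto simp: doubleton_eq_iff)
  ultimately have 1: "(u, l) \<in> ?E\<^sup>*" using rtrancl_mono by blast
  have "{(a, b). adj T a b \<and> a \<in> V \<and> b \<in> V} \<subseteq> ?E"
    using s(3) by (auto simp: doubleton_eq_iff)
  then have "(l, s) \<in> ?E\<^sup>*" using V(2) rtrancl_mono by blast
  with 1 have "(u, s) \<in> ?E\<^sup>*" by (rule rtrancl_trans)
  then show False using is_tree_bridge[OF T, of u s] s adj_sym[of u s T] by auto
qed

text \<open>Vertices are eliminated from the front of the list; later elements of the list remain.\<close>

fun elim_order :: "nat set set \<Rightarrow> nat list \<Rightarrow> bool" where
  "elim_order \<B> [] = True"
| "elim_order \<B> (x # L) \<longleftrightarrow> elim_order \<B> L \<and> (\<exists>b\<in>\<B>. x \<in> b \<and> (\<forall>b'\<in>\<B>. x \<in> b' \<longrightarrow> b' \<inter> set (x # L) \<subseteq> b))"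

text \<open>For a vertex of C the witness bag contains all that remains of D, and with it all that
  remains of C.\<close>

lemma elim_order_insert:
  "elim_order \<B> L \<Longrightarrow> D \<in> \<B> \<Longrightarrow> C \<inter> set L \<subseteq> D \<Longrightarrow> elim_order (insert C \<B>) L"
proof (induction L)
  case (Cons x L)
  obtain b where b: "b \<in> \<B>" "x \<in> b" "\<And>b'. b' \<in> \<B> \<Longrightarrow> x \<in> b' \<Longrightarrow> b' \<inter> set (x # L) \<subseteq> b"
    using Cons.prems by auto
  have "C \<inter> set (x # L) \<subseteq> b" if "x \<in> C"
    using b(3)[OF Cons.prems(2)] Cons.prems(3) that by auto
  then have "\<exists>b\<in>insert C \<B>. x \<in> b \<and> (\<forall>b'\<in>insert C \<B>. x \<in> b' \<longrightarrow> b' \<inter> set (x # L) \<subseteq> b)"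
    using b by blast
  moreover have "elim_order (insert C \<B>) L" using Cons by auto
  ultimately show ?case by simp
qed simp

definition reps :: "nat list list \<Rightarrow> nat set" where
  "reps b = (\<lambda>p. Min (set p)) ` set b"

lemma fst_newacc: "fst ` set (newacc b acc) = fst ` set acc \<union> reps b"
  by (induction b acc rule: newacc.induct) (auto simp: reps_def split: if_splits)

text \<open>A newly added vertex lies in no earlier bag, so C itself is its witness.\<close>

lemma elim_order_newacc:
  "elim_order (insert C \<B>) (map fst acc) \<Longrightarrow> reps b \<subseteq> C \<Longrightarrow> \<Union>\<B> \<subseteq> fst ` set acc \<Longrightarrow>
   elim_order (insert C \<B>) (map fst (newacc b acc))"
proof (induction b acc rule: newacc.induct)
  case (2 p b acc)
  show ?case
  proof (cases "Min (set p) \<in> fst ` set acc")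
    case True
    then show ?thesis using 2 by (simp add: reps_def split: if_split)
  next
    case False
    have "elim_order (insert C \<B>) (map fst ((Min (set p), p) # acc))"
      using 2(2-4) False by (auto simp: reps_def)
    then show ?thesis using 2 False by (auto simp: reps_def split: if_split)
  qed
qed simp

text \<open>Invariant: the visited nodes are connected, the keys are exactly the vertices of their
  bags, and every key has a witness bag. A new node u is attached to a visited s; by
  \<open>is_tree_crossing\<close> the old vertices in its bag lie in the bag of s, so
  \<open>elim_order_insert\<close> applies. If no edge leaves the visited nodes, connectedness shows
  that all nodes are visited.\<close>

lemma elim_order_order:
  assumes T: "is_tree T" and keys: "fst ` set nds = verts T" and dist: "distinct (map fst nds)"
    and es: "\<And>s t. touches es s t \<longleftrightarrow> adj T s t"
    and con: "\<And>v. connected_graph (induced T {t. \<exists>b. (t, b) \<in> set nds \<and> v \<in> reps b})"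
    and inv: "vis \<noteq> []" "set vis \<subseteq> set nds"
      "\<And>l s. l \<in> fst ` set vis \<Longrightarrow> s \<in> fst ` set vis \<Longrightarrow>
         (l, s) \<in> {(a, b). adj T a b \<and> a \<in> fst ` set vis \<and> b \<in> fst ` set vis}\<^sup>*"
      "fst ` set acc = \<Union>(reps ` snd ` set vis)" "elim_order (reps ` snd ` set vis) (map fst acc)"
  shows "fst ` set (order nds es vis acc) = \<Union>(reps ` snd ` set nds) \<and>
    elim_order (reps ` snd ` set nds) (map fst (order nds es vis acc))"
  using assms
proof (induction nds es vis acc rule: order.induct)
  case (1 nds es vis acc)
  note T = 1(2) and keys = 1(3) and dist = 1(4) and es = 1(5) and con = 1(6) and inv = 1(7-)
  let ?V = "fst ` set vis"
  have V: "?V \<subseteq> verts T" using inv(2) keys by auto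
  show ?case
  proof (cases "fedge es ?V")
    case None
    have step: "b \<in> ?V" if "adj T a b" "a \<in> ?V" for a b
      using fedge_NoneD[OF None] es[of a b] that by blast
    have "verts T \<subseteq> ?V"
    proof
      fix t assume t: "t \<in> verts T"
      obtain s where s: "s \<in> ?V" using inv(1) by (cases vis) auto
      have "(s, t) \<in> {(x, y). adj T x y}\<^sup>*"
        using T s t V unfolding is_tree_def connected_graph_def by blast
      then show "t \<in> ?V" using s by (induction rule: rtrancl_induct) (auto intro: step)
    qed
    then have "fst ` set nds = ?V" using keys V by auto
    moreover have "inj_on fst (set nds)" using dist by (simp add: distinct_map)
    ultimately have "set vis = set nds" using inv(2) by (metis inj_on_image_eq_iff order_refl)
    then show ?thesis using None inv by (subst (1 2) order.simps) simp
  next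
    case (Some u)
    obtain s where s: "s \<in> ?V" "u \<notin> ?V" "adj T s u" using fedge_SomeD[OF Some] es by blast
    have "u \<in> verts T" using s(3) T simple_graphD(2) unfolding is_tree_def by metis
    then obtain b where b: "map_of nds u = Some b"
      using keys by (metis map_of_eq_None_iff not_None_eq)
    then have ub: "(u, b) \<in> set nds" by (rule map_of_SomeD)
    have eq: "order nds es vis acc = order nds es ((u, b) # vis) (newacc b acc)"
      using Some b s by (subst order.simps) simp
    obtain c where c: "(s, c) \<in> set vis" using s(1) by auto
    have uni: "b1 = b2" if "(t, b1) \<in> set nds" "(t, b2) \<in> set nds" for t b1 b2
      using dist that by (metis map_of_eq_Some_iff option.inject)
    let ?R = "\<lambda>t. {v. \<exists>b. (t, b) \<in> set nds \<and> v \<in> reps b}"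
    have sub: "reps b \<inter> set (map fst acc) \<subseteq> reps c"
    proof
      fix v assume "v \<in> reps b \<inter> set (map fst acc)"
      then obtain l d where ld: "(l, d) \<in> set vis" "v \<in> reps d" "v \<in> reps b" using inv(4) by fastforce
      have ll: "l \<in> ?V" using ld(1) by force
      have "connected_graph (induced T {t. v \<in> ?R t})" using con[of v] by simp
      then have "v \<in> ?R s"
        by (rule is_tree_crossing[OF T _ V inv(3)[OF ll s(1)] s(1,3)])
          (use ub ld inv(2) s ll \<open>u \<in> verts T\<close> in auto)
      then show "v \<in> reps c" using c inv(2) uni by auto
    qed
    have rc: "reps c \<in> reps ` snd ` set vis" using c by force
    have g: "elim_order (insert (reps b) (reps ` snd ` set vis)) (map fst acc)"
      using elim_order_insert[OF inv(5) rc sub] .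
    have g: "elim_order (reps ` snd ` set ((u, b) # vis)) (map fst (newacc b acc))"
      using elim_order_newacc[OF g order_refl] inv(4) by simp
    show ?thesis unfolding eq
    proof (rule 1(1)[OF Some b s(2) T keys dist es con])
      let ?E = "{(a, b'). adj T a b' \<and> a \<in> fst ` set ((u, b) # vis) \<and> b' \<in> fst ` set ((u, b) # vis)}"
      show "set ((u, b) # vis) \<subseteq> set nds" using inv(2) ub by auto
      show "fst ` set (newacc b acc) = \<Union>(reps ` snd ` set ((u, b) # vis))"
        using inv(4) by (auto simp: fst_newacc)
      show "elim_order (reps ` snd ` set ((u, b) # vis)) (map fst (newacc b acc))" by (rule g)
      have "{(a, b). adj T a b \<and> a \<in> ?V \<and> b \<in> ?V} \<subseteq> ?E" by auto
      then have old: "(l, l') \<in> ?E\<^sup>*" if "l \<in> ?V" "l' \<in> ?V" for l l'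
        using inv(3)[OF that] rtrancl_mono by blast
      have us: "(u, s) \<in> ?E" "(s, u) \<in> ?E" using s adj_sym[of s u T] by auto
      have new: "(u, l) \<in> ?E\<^sup>*" "(l, u) \<in> ?E\<^sup>*" if "l \<in> ?V" for l
        using converse_rtrancl_into_rtrancl[OF us(1) old[OF s(1) that]]
          rtrancl_into_rtrancl[OF old[OF that s(1)] us(2)] .
      show "(l, l') \<in> ?E\<^sup>*" if "l \<in> fst ` set ((u, b) # vis)" "l' \<in> fst ` set ((u, b) # vis)" for l l'
      proof -
        have "l = u \<or> l \<in> ?V" "l' = u \<or> l' \<in> ?V" using that by auto
        then show ?thesis using new old by blast
      qed
    qed simp
  qed
qed

lemma elim_order_start:
  assumes T: "is_tree T" and keys: "fst ` set nds = verts T" and dist: "distinct (map fst nds)"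
    and es: "\<And>s t. touches es s t \<longleftrightarrow> adj T s t"
    and con: "\<And>v. connected_graph (induced T {t. \<exists>b. (t, b) \<in> set nds \<and> v \<in> reps b})"
    and ne: "nds \<noteq> []"
  shows "fst ` set (start (nds, es)) = \<Union>(reps ` snd ` set nds)"
    "elim_order (reps ` snd ` set nds) (map fst (start (nds, es)))"
proof -
  obtain t b where tb: "hd nds = (t, b)" "(t, b) \<in> set nds" using ne by (cases nds) auto
  have "elim_order (insert (reps b) {}) (map fst (newacc b []))"
    by (rule elim_order_newacc) auto
  then have "fst ` set (order nds es [(t, b)] (newacc b [])) = \<Union>(reps ` snd ` set nds) \<and>
    elim_order (reps ` snd ` set nds) (map fst (order nds es [(t, b)] (newacc b [])))"
    by (intro elim_order_order[OF T keys dist es con]) (use tb in \<open>auto simp: fst_newacc\<close>)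
  then show "fst ` set (start (nds, es)) = \<Union>(reps ` snd ` set nds)"
    "elim_order (reps ` snd ` set nds) (map fst (start (nds, es)))"
    using tb unfolding start_def by auto
qed

section \<open>Correctness of the elimination\<close>

text \<open>Solutions are compared as multisets because insertion into buckets permutes the
  summands, and appending lists is not commutative. \<open>None\<close> is infeasible.\<close>

type_synonym outcome = "(nat \<times> nat multiset) option"

fun look :: "(nat \<Rightarrow> bool) \<Rightarrow> dt \<Rightarrow> outcome" where
  "look \<sigma> (Lf m X) = (if m = 0 then None else Some (m - 1, mset X))"
| "look \<sigma> (Br k f g) = (if \<sigma> k then look \<sigma> g else look \<sigma> f)"

fun join :: "outcome \<Rightarrow> outcome \<Rightarrow> outcome" (infixl "\<oplus>" 65) where
  "Some (x, X) \<oplus> Some (y, Y) = Some (x + y, X + Y)"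
| "_ \<oplus> _ = None"

fun worse :: "outcome \<Rightarrow> outcome \<Rightarrow> bool" (infix "\<preceq>" 50) where
  "None \<preceq> _ \<longleftrightarrow> True"
| "Some (x, X) \<preceq> Some (y, Y) \<longleftrightarrow> x \<le> y"
| "Some (x, X) \<preceq> None \<longleftrightarrow> False"

lemma join_None [simp]: "a \<oplus> None = None" "None \<oplus> a = None"
  by (cases a; simp)+

lemma join_commute: "a \<oplus> b = b \<oplus> a"
  by (cases a; cases b) auto

lemma join_assoc: "a \<oplus> b \<oplus> c = a \<oplus> (b \<oplus> c)"
  by (cases a; cases b; cases c) auto

lemma worse_refl [simp]: "a \<preceq> a"
  by (cases a) auto

lemma worse_trans: "a \<preceq> b \<Longrightarrow> b \<preceq> c \<Longrightarrow> a \<preceq> c"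
  by (cases a; cases b; cases c) auto

lemma worse_join: "a \<preceq> b \<Longrightarrow> a \<oplus> c \<preceq> b \<oplus> c"
  by (cases a; cases b; cases c) auto

lemma look_plus: "look \<sigma> (pointwise False f g) = look \<sigma> f \<oplus> look \<sigma> g"
  by (induction False f g rule: pointwise.induct) (auto split: if_split)

lemma look_max:
  "(look \<sigma> (pointwise True f g) = look \<sigma> f \<or> look \<sigma> (pointwise True f g) = look \<sigma> g) \<and>
   look \<sigma> f \<preceq> look \<sigma> (pointwise True f g) \<and> look \<sigma> g \<preceq> look \<sigma> (pointwise True f g)"
proof (induction True f g rule: pointwise.induct)
  case (4 k f0 f1 l g0 g1)
  consider "k < l" | "l < k" | "k = l" by linarith
  then show ?case
    by cases (use 4 in \<open>auto split: if_split\<close>)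
qed (auto split: if_split)

lemma look_cong: "ordered_in Z t \<Longrightarrow> (\<And>k. k \<in> Z \<Longrightarrow> \<sigma> k = \<sigma>' k) \<Longrightarrow> look \<sigma> t = look \<sigma>' t"
  by (induction Z t rule: ordered_in.induct) (auto split: if_split)

definition combined :: "(nat \<Rightarrow> bool) \<Rightarrow> dt list \<Rightarrow> outcome" where
  "combined \<sigma> Fs = foldr (\<lambda>F a. look \<sigma> F \<oplus> a) Fs (Some (0, {#}))"

lemma combined_simps [simp]:
  "combined \<sigma> [] = Some (0, {#})" "combined \<sigma> (F # Fs) = look \<sigma> F \<oplus> combined \<sigma> Fs"
  by (simp_all add: combined_def)

lemma combined_ins:
  "binv Z Fs \<Longrightarrow> key f < length Fs \<Longrightarrow> combined \<sigma> (ins f Fs) = look \<sigma> f \<oplus> combined \<sigma> Fs"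
proof (induction Fs)
  case (Cons F Fs)
  show ?case
  proof (cases "key f = key F")
    case True
    then show ?thesis by (simp add: look_plus) (metis join_commute join_assoc)
  next
    case False
    then have "combined \<sigma> (ins f Fs) = look \<sigma> f \<oplus> combined \<sigma> Fs"
      using Cons by auto
    then show ?thesis using False by simp (metis join_assoc join_commute)
  qed
qed simp

context buckets
begin

lemma combined_cong:
  assumes "binv Z Fs" "\<And>k. k < length Fs \<Longrightarrow> \<sigma> k = \<sigma>' k"
  shows "combined \<sigma> Fs = combined \<sigma>' Fs"
  using assms
proof (induction Fs)
  case (Cons F Fs)
  have "look \<sigma> F = look \<sigma>' F"
    by (rule look_cong[of "Z (key F)"]) (use Cons.prems Z_le[of "key F"] in \<open>auto intro!: le_imp_less_Suc\<close>)
  then show ?case using Cons by simp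
qed simp

text \<open>The first variable occurs in no tree but the first, so it can be maximised out locally:
  merging dominates every assignment, and an optimal assignment of the rest extends by the son that
  attains the maximum. The assignment \<open>\<lambda>_. False\<close> only serves to read a
  leaf.\<close>

lemma elim_optimal:
  assumes "binv Z Fs" "Fs \<noteq> []"
  shows "\<exists>m X. elim Fs = Lf m X \<and> (\<exists>\<sigma>. look (\<lambda>_. False) (Lf m X) = combined \<sigma> Fs) \<and>
    (\<forall>\<sigma>. combined \<sigma> Fs \<preceq> look (\<lambda>_. False) (Lf m X))"
  using assms
proof (induction Fs rule: elim.induct)
  case (2 F)
  then obtain m X where "F = Lf m X" by (cases F) auto
  then show ?case by (auto simp: join_commute[of _ "Some (0, {#})"] split: if_split)
next
  case (3 F G Fs)
  let ?L = "G # Fs"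
  have kF: "0 < key F" "ordered_in (Z (key F)) F" "binv Z ?L" "key F = length ?L" using 3(2) by auto
  obtain f g where F: "F = Br (length ?L) f g" using kF by (cases F) auto
  let ?n = "length ?L"
  note mk = binv_merge[OF 3(2)]
  have ne: "ins (merge F) ?L \<noteq> []" using length_ins[of "merge F" ?L] by (metis length_0_conv list.distinct(1))
  obtain m X \<sigma>0 where IH: "elim (ins (merge F) ?L) = Lf m X"
    "look (\<lambda>_. False) (Lf m X) = combined \<sigma>0 (ins (merge F) ?L)"
    "\<And>\<sigma>. combined \<sigma> (ins (merge F) ?L) \<preceq> look (\<lambda>_. False) (Lf m X)"
    using 3(1)[OF mk(1) ne] by auto
  have tot: "combined \<sigma> (ins (merge F) ?L) = look \<sigma> (pointwise True f g) \<oplus> combined \<sigma> ?L" for \<sigma>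
    using combined_ins[OF kF(3) mk(2)] F by simp
  have okfg: "ordered_in (Z ?n \<inter> {..<?n}) f" "ordered_in (Z ?n \<inter> {..<?n}) g" using kF(2) F by auto
  \<comment> \<open>Changing the first variable affects the choice between the sons and nothing
    else.\<close>
  have upd: "combined (\<sigma>(?n := b)) (F # ?L) = (if b then look \<sigma> g else look \<sigma> f) \<oplus> combined \<sigma> ?L" for \<sigma> b
  proof -
    have "combined (\<sigma>(?n := b)) ?L = combined \<sigma> ?L"
      by (rule combined_cong[OF kF(3)]) simp
    moreover have "look (\<sigma>(?n := b)) f = look \<sigma> f" "look (\<sigma>(?n := b)) g = look \<sigma> g"
      by (rule look_cong[OF okfg(1)] look_cong[OF okfg(2)], simp)+
    ultimately show ?thesis
      unfolding F combined_simps(2)[of _ "Br _ _ _"] look.simps by (cases b) simp_all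
  qed
  have "\<exists>\<sigma>. look (\<lambda>_. False) (Lf m X) = combined \<sigma> (F # ?L)"
    using look_max[of \<sigma>0 f g] upd[of \<sigma>0 True] upd[of \<sigma>0 False] IH(2) tot[of \<sigma>0] by metis
  moreover have "combined \<sigma> (F # ?L) \<preceq> look (\<lambda>_. False) (Lf m X)" for \<sigma>
  proof (rule worse_trans[OF _ IH(3)[of \<sigma>]])
    have "look \<sigma> F \<preceq> look \<sigma> (pointwise True f g)"
      using look_max[of \<sigma> f g] F by (simp split: if_split)
    then show "combined \<sigma> (F # ?L) \<preceq> combined \<sigma> (ins (merge F) ?L)"
      unfolding tot combined_simps(2)[of \<sigma> F] by (rule worse_join)
  qed
  moreover have "elim (F # ?L) = Lf m X" using IH(1) by simp
  ultimately show ?case by blast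
qed simp

end

text \<open>Not choosing an entry yields value 0, stored as payload 1. An edge is tested only in the
  bucket of its front endpoint, the one eliminated first. The final leaf is the bucket that collects
  constants.\<close>

fun buckets_of :: "(nat \<Rightarrow> nat \<Rightarrow> bool) \<Rightarrow> (nat list \<Rightarrow> dt) \<Rightarrow> (nat \<times> nat list) list \<Rightarrow> dt list" where
  "buckets_of A sol [] = [Lf 1 []]"
| "buckets_of A sol (e # L) = Br (Suc (length L)) (Lf 1 []) (tree A (fst e) (sol (snd e)) L) # buckets_of A sol L"

lemma length_buckets_of [simp]: "length (buckets_of A sol L) = Suc (length L)"
  by (induction L) auto

fun chosen :: "(nat \<Rightarrow> bool) \<Rightarrow> 'b list \<Rightarrow> 'b list" where
  "chosen \<sigma> [] = []"
| "chosen \<sigma> (e # L) = (if \<sigma> (Suc (length L)) then e # chosen \<sigma> L else chosen \<sigma> L)"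

lemma set_chosen: "set (chosen \<sigma> L) \<subseteq> set L"
  by (induction L) (auto split: if_split)

lemma distinct_chosen: "distinct (map f L) \<Longrightarrow> distinct (map f (chosen \<sigma> L))"
proof (induction L)
  case (Cons e L)
  have "f ` set (chosen \<sigma> L) \<subseteq> f ` set L" using set_chosen by (rule image_mono)
  then show ?case using Cons by (auto split: if_split)
qed simp

lemma chosen_cong: "(\<And>k. k \<le> length L \<Longrightarrow> \<sigma> k = \<sigma>' k) \<Longrightarrow> chosen \<sigma> L = chosen \<sigma>' L"
  by (induction L) auto

text \<open>Hence maximising over assignments is maximising over all selections of entries.\<close>

lemma chosen_filter: "\<exists>\<sigma>. chosen \<sigma> L = filter p L"
proof (induction L)
  case (Cons e L)
  then obtain \<sigma> where s: "chosen \<sigma> L = filter p L" by blast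
  define \<tau> where "\<tau> = \<sigma>(Suc (length L) := p e)"
  have "chosen \<tau> L = chosen \<sigma> L" by (rule chosen_cong) (simp add: \<tau>_def)
  moreover have "\<tau> (Suc (length L)) = p e" by (simp add: \<tau>_def)
  ultimately have "chosen \<tau> (e # L) = filter p (e # L)" using s by simp
  then show ?case by blast
qed simp

lemma look_tree:
  "look \<sigma> (tree A r l L) = (if \<exists>e\<in>set (chosen \<sigma> L). A r (fst e) then None else look \<sigma> l)"
  by (induction L) (auto split: if_split)

text \<open>Each pair is tested once, from the front entry towards the entries behind it, which is
  what \<open>sorted_wrt\<close> expresses.\<close>

lemma combined_buckets_of:
  assumes "\<And>e. e \<in> set L \<Longrightarrow> sol (snd e) = Lf (Suc (vl e)) (xl e)"
  shows "combined \<sigma> (buckets_of A sol L) =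
    (if sorted_wrt (\<lambda>e e'. \<not> A (fst e) (fst e')) (chosen \<sigma> L)
     then Some (\<Sum>e\<leftarrow>chosen \<sigma> L. vl e, \<Sum>e\<leftarrow>chosen \<sigma> L. mset (xl e)) else None)"
  using assms
proof (induction L)
  case (Cons e L)
  have "combined \<sigma> (buckets_of A sol L) =
    (if sorted_wrt (\<lambda>e e'. \<not> A (fst e) (fst e')) (chosen \<sigma> L)
     then Some (\<Sum>e\<leftarrow>chosen \<sigma> L. vl e, \<Sum>e\<leftarrow>chosen \<sigma> L. mset (xl e)) else None)"
    using Cons by simp
  moreover have "sol (snd e) = Lf (Suc (vl e)) (xl e)" using Cons.prems by simp
  ultimately show ?case by (auto simp: look_tree split: if_split)
qed (simp split: if_split)

fun positions :: "nat list \<Rightarrow> nat set \<Rightarrow> nat set" where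
  "positions [] b = {}"
| "positions (x # L) b = positions L b \<union> (if x \<in> b then {Suc (length L)} else {})"

lemma positions_le: "positions L b \<subseteq> {1..length L}"
  by (induction L) (auto split: if_splits)

lemma positions_mono: "b \<inter> set L \<subseteq> b' \<Longrightarrow> positions L b \<subseteq> positions L b'"
  by (induction L) (auto split: if_splits)

lemma card_positions:
  assumes "distinct L" "finite b"
  shows "card (positions L b) \<le> card b"
proof -
  have "card (positions L b) \<le> length (filter (\<lambda>x. x \<in> b) L)"
  proof (induction L)
    case (Cons x L)
    have "card (positions L b \<union> {Suc (length L)}) \<le> Suc (card (positions L b))"
      using card_Un_le[of "positions L b" "{Suc (length L)}"] by simp
    then show ?case using Cons by (simp split: if_split)
  qed simp
  also have "\<dots> = card (set (filter (\<lambda>x. x \<in> b) L))"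
    using assms(1) by (intro distinct_card[symmetric]) simp
  also have "\<dots> \<le> card b" using assms(2) by (intro card_mono) auto
  finally show ?thesis .
qed

lemma ordered_in_tree: "positions (map fst L) {y. A r y} \<subseteq> Y \<Longrightarrow> ordered_in Y (tree A r (Lf m X) L)"
proof (induction L arbitrary: Y)
  case (Cons e L)
  have "ordered_in (Y \<inter> {..<Suc (length L)}) (tree A r (Lf m X) L)"
    using Cons.prems positions_le[of "map fst L" "{y. A r y}"] by (intro Cons.IH) force
  then show ?case using Cons.prems by (auto intro: ordered_in_mono split: if_split)
qed simp

lemma binv_cong: "binv Z Fs \<Longrightarrow> (\<And>k. k < length Fs \<Longrightarrow> Z k = Z' k) \<Longrightarrow> binv Z' Fs"
  by (induction Fs) auto

text \<open>The variables allowed for the front vertex are the positions of its witness bag. Closure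
  then asks that each smaller key i of this bag has all keys of the bag up to i in
  \<open>Z i\<close>; the last clause strengthens the induction by exactly this. The clause on empty
  sets keeps sets beyond the list from interfering.\<close>

lemma buckets_exist:
  assumes "elim_order \<B> (map fst acc)" "distinct (map fst acc)"
    and K: "\<And>b. b \<in> \<B> \<Longrightarrow> finite b \<and> card b \<le> K"
    and "\<And>e e'. e \<in> set acc \<Longrightarrow> e' \<in> set acc \<Longrightarrow> A (fst e) (fst e') \<Longrightarrow> \<exists>b\<in>\<B>. fst e \<in> b \<and> fst e' \<in> b"
    and "\<And>e. e \<in> set acc \<Longrightarrow> sol (snd e) = Lf (Suc (vl e)) (xl e)"
  shows "\<exists>Z. buckets Z K \<and> binv Z (buckets_of A sol acc) \<and> (\<forall>j>length acc. Z j = {}) \<and>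
    (\<forall>b\<in>\<B>. \<forall>j\<in>positions (map fst acc) b. positions (map fst acc) b \<inter> {..j} \<subseteq> Z j)"
  using assms(1,2,4,5)
proof (induction acc)
  case Nil
  show ?case by (rule exI[of _ "\<lambda>_. {}"]) (simp add: buckets_def)
next
  case (Cons e acc)
  let ?L = "map fst acc" and ?n = "Suc (length acc)" and ?x = "fst e"
  have "\<exists>Z. buckets Z K \<and> binv Z (buckets_of A sol acc) \<and> (\<forall>j>length acc. Z j = {}) \<and>
    (\<forall>b\<in>\<B>. \<forall>j\<in>positions ?L b. positions ?L b \<inter> {..j} \<subseteq> Z j)"
    using Cons.prems by (intro Cons.IH) auto
  then obtain Z where Z: "buckets Z K" "binv Z (buckets_of A sol acc)" "\<And>j. length acc < j \<Longrightarrow> Z j = {}"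
    "\<And>b j. b \<in> \<B> \<Longrightarrow> j \<in> positions ?L b \<Longrightarrow> positions ?L b \<inter> {..j} \<subseteq> Z j" by blast
  obtain b where b: "b \<in> \<B>" "?x \<in> b" "\<And>b'. b' \<in> \<B> \<Longrightarrow> ?x \<in> b' \<Longrightarrow> b' \<inter> set (?x # ?L) \<subseteq> b"
    using Cons.prems(1) by auto
  define Y where "Y = positions (?x # ?L) b"
  define Z' where "Z' = Z(?n := Y)"
  have old: "Z' j = Z j" if "j < ?n" for j using that by (simp add: Z'_def)
  have new: "Z' ?n = Y" by (simp add: Z'_def)
  have le: "positions ?L c \<subseteq> {..<?n}" for c using positions_le[of ?L c] by auto
  have Yn: "Y = insert ?n (positions ?L b)" using b(2) by (auto simp: Y_def split: if_split)
  have cY: "card Y \<le> K"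
    unfolding Y_def using card_positions[of "?x # ?L" b] Cons.prems(2) K[OF b(1)] by auto
  interpret Z: buckets Z K by (rule Z(1))
  have "buckets Z' K"
  proof
    show "Z' j \<subseteq> {..j}" for j using Z.Z_le[of j] le[of b] by (cases "j = ?n") (auto simp: Z'_def Yn)
    show "card (Z' j) \<le> K" for j using Z.card_Z[of j] cY by (cases "j = ?n") (auto simp: Z'_def)
    show "Z' j \<inter> {..i} \<subseteq> Z' i" if i: "i \<in> Z' j" "0 < i" for i j
    proof (cases "j = ?n")
      case True
      show ?thesis
      proof (cases "i = ?n")
        case False
        then have "i \<in> positions ?L b" using i(1) True new Yn by simp
        then show ?thesis using Z(4)[OF b(1), of i] le[of b] old[of i] True new Yn by auto
      qed (use True in auto)
    next
      case False
      then have j: "i \<in> Z j" using i(1) by (simp add: Z'_def)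
      then have "i \<le> j" "j < ?n" using Z.Z_le[of j] Z(3)[of j] by (auto simp: not_less_eq[symmetric])
      then show ?thesis using Z.Z_closed[OF j i(2)] old by simp
    qed
  qed
  moreover have "binv Z' (buckets_of A sol (e # acc))"
  proof -
    \<comment> \<open>A neighbour shares some bag with the front vertex, and the remainder of that
      bag lies in the witness bag.\<close>
    have "{y. A ?x y} \<inter> set ?L \<subseteq> b"
    proof
      fix y assume "y \<in> {y. A ?x y} \<inter> set ?L"
      then obtain e' where e': "e' \<in> set acc" "y = fst e'" "A ?x y" by auto
      then obtain b' where b': "b' \<in> \<B>" "?x \<in> b'" "y \<in> b'" using Cons.prems(3)[of e e'] by auto
      have "y \<in> b' \<inter> set (?x # ?L)" using b'(3) e' by auto
      then show "y \<in> b" using b(3)[OF b'(1,2)] by (rule subsetD[rotated])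
    qed
    then have "positions ?L {y. A ?x y} \<subseteq> Y \<inter> {..<?n}"
      using positions_mono[of "{y. A ?x y}" ?L b] le[of "{y. A ?x y}"] Yn by auto
    then have "ordered_in (Y \<inter> {..<?n}) (tree A ?x (sol (snd e)) acc)"
      using Cons.prems(4)[of e] by (auto intro: ordered_in_tree)
    moreover have "binv Z' (buckets_of A sol acc)" by (rule binv_cong[OF Z(2)]) (simp add: old)
    ultimately show ?thesis using new Yn by simp
  qed
  moreover have "\<forall>j>length (e # acc). Z' j = {}" using Z(3) by (simp add: Z'_def)
  moreover have "positions (map fst (e # acc)) b' \<inter> {..j} \<subseteq> Z' j"
    if b': "b' \<in> \<B>" "j \<in> positions (map fst (e # acc)) b'" for b' j
  proof (cases "j = ?n")
    case True
    then have "?x \<in> b'" using b'(2) le[of b'] by (auto split: if_splits)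
    then show ?thesis
      using positions_mono[OF b(3)[OF b'(1)]] True new by (auto simp: Y_def)
  next
    case False
    then have j: "j \<in> positions ?L b'" using b'(2) by (auto split: if_splits)
    then show ?thesis using Z(4)[OF b'(1) j] le[of b'] old[of j] by (auto split: if_splits)
  qed
  ultimately show ?case by blast
qed

lemma (in buckets) elim_buckets_of:
  assumes "binv Z (buckets_of A sol acc)"
    and sol: "\<And>e. e \<in> set acc \<Longrightarrow> sol (snd e) = Lf (Suc (vl e)) (xl e)"
  shows "\<exists>v X \<sigma>. elim (buckets_of A sol acc) = Lf (Suc v) X \<and>
    sorted_wrt (\<lambda>e e'. \<not> A (fst e) (fst e')) (chosen \<sigma> acc) \<and>
    v = (\<Sum>e\<leftarrow>chosen \<sigma> acc. vl e) \<and> mset X = (\<Sum>e\<leftarrow>chosen \<sigma> acc. mset (xl e)) \<and>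
    (\<forall>p. sorted_wrt (\<lambda>e e'. \<not> A (fst e) (fst e')) (filter p acc) \<longrightarrow> (\<Sum>e\<leftarrow>filter p acc. vl e) \<le> v)"
proof -
  have "buckets_of A sol acc \<noteq> []" by (cases acc) auto
  from elim_optimal[OF assms(1) this] obtain m X \<sigma> where e: "elim (buckets_of A sol acc) = Lf m X"
    "look (\<lambda>_. False) (Lf m X) = combined \<sigma> (buckets_of A sol acc)"
    "\<And>\<sigma>. combined \<sigma> (buckets_of A sol acc) \<preceq> look (\<lambda>_. False) (Lf m X)"
    by blast
  note tot = combined_buckets_of[where L = acc and sol = sol and vl = vl and xl = xl, OF sol]
  have opt: "Some (\<Sum>e\<leftarrow>filter p acc. vl e, \<Sum>e\<leftarrow>filter p acc. mset (xl e)) \<preceq> look (\<lambda>_. False) (Lf m X)"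
    if "sorted_wrt (\<lambda>e e'. \<not> A (fst e) (fst e')) (filter p acc)" for p
  proof -
    obtain \<tau> where "chosen \<tau> acc = filter p acc" using chosen_filter by blast
    then show ?thesis using e(3)[of \<tau>] that by (simp add: tot)
  qed
  \<comment> \<open>The empty selection is always feasible.\<close>
  have m: "m \<noteq> 0"
  proof
    assume "m = 0"
    then show False using opt[of "\<lambda>_. False"] by simp
  qed
  then obtain v where v: "m = Suc v" by (cases m) auto
  have "sorted_wrt (\<lambda>e e'. \<not> A (fst e) (fst e')) (chosen \<sigma> acc)"
    "v = (\<Sum>e\<leftarrow>chosen \<sigma> acc. vl e)" "mset X = (\<Sum>e\<leftarrow>chosen \<sigma> acc. mset (xl e))"
    using e(2) v tot[where \<sigma> = \<sigma> and A = A] by (auto split: if_splits)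
  then show ?thesis using e(1) v opt by (intro exI[of _ v] exI[of _ X] exI[of _ \<sigma>]) (auto split: if_split)
qed

section \<open>Optimal independent sets\<close>

lemma grow_mset:
  "grow r K Q R = (K', R') \<Longrightarrow> mset K' + mset R' = mset K + mset Q + mset R"
proof (induction r K Q R rule: grow.induct)
  case (2 r K x Q R)
  have "mset (filter (r x) R) + mset (filter (\<lambda>y. \<not> r x y) R) = mset R"
    by (simp add: mset_filter multiset_partition[symmetric])
  then show ?case using 2 by simp
qed simp

lemma grow_separated:
  "grow r K Q R = (K', R') \<Longrightarrow> \<forall>x\<in>set K. \<forall>y\<in>set R. \<not> r x y \<Longrightarrow>
   set Q \<subseteq> set K' \<and> (\<forall>x\<in>set K'. \<forall>y\<in>set R'. \<not> r x y) \<and> set K \<subseteq> set K'"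
proof (induction r K Q R rule: grow.induct)
  case (2 r K x Q R)
  have "set (filter (r x) R @ Q) \<subseteq> set K' \<and> (\<forall>x\<in>set K'. \<forall>y\<in>set R'. \<not> r x y) \<and> set (x # K) \<subseteq> set K'"
    using 2(2,3) by (intro 2(1)) auto
  then show ?case by auto
qed simp

lemma grow_least:
  "grow r K Q R = (K', R') \<Longrightarrow> set K \<union> set Q \<subseteq> A \<Longrightarrow> \<forall>x\<in>A. \<forall>y\<in>set R. r x y \<longrightarrow> y \<in> A \<Longrightarrow> set K' \<subseteq> A"
proof (induction r K Q R rule: grow.induct)
  case (2 r K x Q R)
  show ?case using 2(2-4) by (intro 2(1)) auto
qed simp

text \<open>A set containing s that no pair leaves absorbs the whole search, hence everything. A set
  without s is treated through its complement, by symmetry of r.\<close>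

lemma grow_all_cohesive:
  assumes "grow r [] [s] R = (K', [])" "symp r"
  shows "cohesive r (set (s # R))"
  unfolding cohesive_def
proof (intro allI impI)
  have K': "set K' = set (s # R)"
    by (rule mset_eq_setD) (use grow_mset[OF assms(1)] in simp)
  have *: "\<exists>x\<in>A. \<exists>y\<in>set (s # R) - A. r x y" if "A \<subseteq> set (s # R)" "s \<in> A" "A \<noteq> set (s # R)" for A
  proof (rule ccontr)
    assume n: "\<not> ?thesis"
    have "set K' \<subseteq> A"
      using grow_least[OF assms(1), of A] that(2) n by auto
    then show False using that K' by blast
  qed
  fix A assume A: "A \<subseteq> set (s # R) \<and> A \<noteq> {} \<and> A \<noteq> set (s # R)"
  show "\<exists>x\<in>A. \<exists>y\<in>set (s # R) - A. r x y"
  proof (cases "s \<in> A")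
    case True
    then show ?thesis using * A by blast
  next
    case False
    have "\<exists>x\<in>set (s # R) - A. \<exists>y\<in>set (s # R) - (set (s # R) - A). r x y"
      using A False by (intro *) auto
    then show ?thesis using assms(2) A unfolding symp_def by blast
  qed
qed

text \<open>A vertex of \<open>S - A\<close> sees A uniformly by hypothesis, and a vertex outside S
  does so because S is a module. Both values of q occur: components and co-components.\<close>

lemma module_split:
  assumes "is_module G S" "A \<subseteq> S" "\<And>x y. x \<in> A \<Longrightarrow> y \<in> S - A \<Longrightarrow> adj G x y = q"
  shows "is_module G A"
  unfolding is_module_iff
proof (intro conjI ballI allI impI)
  show "A \<subseteq> verts G" using assms(1,2) by (auto simp: is_module_iff)
  fix v w u assume *: "v \<in> A" "w \<in> A" "u \<notin> A"
  show "adj G u v = adj G u w"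
  proof (cases "u \<in> S")
    case True
    then show ?thesis using assms(3)[of v u] assms(3)[of w u] * adj_sym[of u v G] adj_sym[of u w G] by simp
  next
    case False
    then show ?thesis using is_moduleD[OF assms(1), of v w u] * assms(2) by blast
  qed
qed

section \<open>Optima of unions, joins and quotients\<close>

definition indep :: "nat ugraph \<Rightarrow> nat set \<Rightarrow> bool" where
  "indep G Y \<longleftrightarrow> (\<forall>u\<in>Y. \<forall>v\<in>Y. \<not> adj G u v)"

lemma indep_subset: "indep G Y \<Longrightarrow> Y' \<subseteq> Y \<Longrightarrow> indep G Y'"
  unfolding indep_def by blast

definition is_opt :: "nat ugraph \<Rightarrow> (nat \<Rightarrow> nat) \<Rightarrow> nat set \<Rightarrow> nat \<Rightarrow> nat list \<Rightarrow> bool" where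
  "is_opt G wt S v xs \<longleftrightarrow> distinct xs \<and> set xs \<subseteq> S \<and> indep G (set xs) \<and> v = sum wt (set xs) \<and>
     (\<forall>Y. Y \<subseteq> S \<longrightarrow> indep G Y \<longrightarrow> sum wt Y \<le> v)"

lemma is_opt_single: "simple_graph G \<Longrightarrow> is_opt G wt {x} (wt x) [x]"
  using simple_graphD(3)[of G x] by (auto simp: is_opt_def indep_def subset_singleton_iff)

lemma is_opt_union:
  assumes A: "is_opt G wt A v xs" and B: "is_opt G wt B u ys" and fin: "finite A" "finite B"
    and disj: "A \<inter> B = {}" and no: "\<And>x y. x \<in> A \<Longrightarrow> y \<in> B \<Longrightarrow> \<not> adj G x y"
  shows "is_opt G wt (A \<union> B) (v + u) (xs @ ys)"
proof -
  have "set xs \<inter> set ys = {}" using A B disj by (auto simp: is_opt_def)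
  moreover have "sum wt Y \<le> v + u" if Y: "Y \<subseteq> A \<union> B" "indep G Y" for Y
  proof -
    have "Y = (Y \<inter> A) \<union> (Y \<inter> B)" using Y(1) by blast
    then have "sum wt Y = sum wt (Y \<inter> A) + sum wt (Y \<inter> B)"
      using fin disj by (subst sum.union_disjoint[symmetric]) auto
    moreover have "sum wt (Y \<inter> A) \<le> v" "sum wt (Y \<inter> B) \<le> u"
      using A B indep_subset[OF Y(2)] by (auto simp: is_opt_def)
    ultimately show ?thesis by simp
  qed
  moreover have "indep G (set xs \<union> set ys)"
    using A B no adj_sym[of _ _ G] unfolding is_opt_def indep_def by (metis Un_iff subsetD)
  ultimately show ?thesis using A B by (auto simp: is_opt_def sum.union_disjoint)
qed

text \<open>An independent set cannot meet both sides of a complete join.\<close>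

lemma is_opt_join:
  assumes A: "is_opt G wt A v xs" and B: "is_opt G wt B u ys"
    and all: "\<And>x y. x \<in> A \<Longrightarrow> y \<in> B \<Longrightarrow> adj G x y"
  shows "is_opt G wt (A \<union> B) (if v < u then u else v) (if v < u then ys else xs)"
proof -
  have "Y \<subseteq> A \<or> Y \<subseteq> B" if "Y \<subseteq> A \<union> B" "indep G Y" for Y
    using that all unfolding indep_def by blast
  then have "sum wt Y \<le> max v u" if "Y \<subseteq> A \<union> B" "indep G Y" for Y
    using A B that unfolding is_opt_def by (metis le_max_iff_disj)
  moreover have "max v u = (if v < u then u else v)" by (simp add: max_def split: if_split)
  ultimately show ?thesis using A B by (cases "v < u") (auto simp: is_opt_def)
qed

lemma sum_flat:
  assumes "distinct (flat acc)"
  shows "sum wt (Y \<inter> set (flat acc)) = (\<Sum>e\<leftarrow>acc. sum wt (Y \<inter> set (snd e)))"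
  using assms
proof (induction acc)
  case (Cons e acc)
  have "Y \<inter> set (flat (e # acc)) = (Y \<inter> set (snd e)) \<union> (Y \<inter> set (flat acc))" by auto
  then have "sum wt (Y \<inter> set (flat (e # acc))) = sum wt (Y \<inter> set (snd e)) + sum wt (Y \<inter> set (flat acc))"
    using Cons.prems by (subst sum.union_disjoint[symmetric]) auto
  then show ?case using Cons by simp
qed simp

lemma sum_list_filter_bound:
  assumes "\<And>e. e \<in> set acc \<Longrightarrow> f e \<le> g e" "\<And>e. e \<in> set acc \<Longrightarrow> \<not> p e \<Longrightarrow> f e = 0"
  shows "(\<Sum>e\<leftarrow>acc. f e) \<le> (\<Sum>e\<leftarrow>filter p acc. g e :: nat)"
  using assms by (induction acc) (auto intro: add_mono split: if_split)

lemma distinct_concat_sub: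
  assumes "distinct (flat acc)" "distinct (map fst sl)" "set sl \<subseteq> set acc"
    and "\<And>e. e \<in> set acc \<Longrightarrow> distinct (xl e) \<and> set (xl e) \<subseteq> set (snd e)"
    and disj: "\<And>e e'. e \<in> set acc \<Longrightarrow> e' \<in> set acc \<Longrightarrow> fst e \<noteq> fst e' \<Longrightarrow> set (snd e) \<inter> set (snd e') = {}"
  shows "distinct (concat (map xl sl))"
  using assms(2,3)
proof (induction sl)
  case (Cons e sl)
  have "set (xl e) \<inter> set (xl e') = {}" if "e' \<in> set sl" for e'
  proof -
    have "e \<in> set acc" "e' \<in> set acc" "fst e \<noteq> fst e'" using Cons.prems that by auto
    then show ?thesis using disj[of e e'] assms(4)[of e] assms(4)[of e'] by blast
  qed
  then show ?case using Cons assms(4)[of e] by auto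
qed simp

lemma distinct_imp_sorted_wrt: "distinct (map f xs) \<Longrightarrow> sorted_wrt (\<lambda>a b. f a \<noteq> f b) xs"
  by (induction xs) auto

text \<open>An independent set meets pairwise non-adjacent parts and has in each at most the optimum
  of that part; conversely, optima of pairwise non-adjacent parts are jointly independent. By the
  module property adjacency of parts can be read off their keys.\<close>

lemma is_opt_quotient:
  assumes part: "distinct (map fst acc)" "distinct (flat acc)"
    "\<And>e. e \<in> set acc \<Longrightarrow> fst e \<in> set (snd e) \<and> is_module G (set (snd e))"
    and opt: "\<And>e. e \<in> set acc \<Longrightarrow> is_opt G wt (set (snd e)) (vl e) (xl e)"
    and sl: "set sl \<subseteq> set acc" "distinct (map fst sl)"
      "sorted_wrt (\<lambda>e e'. \<not> adj G (fst e) (fst e')) sl"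
    and v: "v = (\<Sum>e\<leftarrow>sl. vl e)" "mset X = (\<Sum>e\<leftarrow>sl. mset (xl e))"
    and max: "\<And>p. sorted_wrt (\<lambda>e e'. \<not> adj G (fst e) (fst e')) (filter p acc) \<Longrightarrow>
       (\<Sum>e\<leftarrow>filter p acc. vl e) \<le> v"
  shows "is_opt G wt (set (flat acc)) v X"
proof -
  have disj: "set (snd e) \<inter> set (snd e') = {}"
    if "e \<in> set acc" "e' \<in> set acc" "fst e \<noteq> fst e'" for e e'
  proof -
    show ?thesis using part(2) that
    proof (induction acc)
      case (Cons a acc)
      then show ?case by auto
    qed simp
  qed
  have adj_rep: "adj G x y \<longleftrightarrow> adj G (fst e) (fst e')"
    if "e \<in> set acc" "e' \<in> set acc" "fst e \<noteq> fst e'" "x \<in> set (snd e)" "y \<in> set (snd e')" for e e' x y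
  proof -
    note d = disj[OF that(1-3)]
    have "adj G x y = adj G x (fst e')"
      by (rule is_moduleD[of G "set (snd e')"]) (use part(3) that d in auto)
    moreover have "adj G (fst e') x = adj G (fst e') (fst e)"
      by (rule is_moduleD[of G "set (snd e)"]) (use part(3) that d in auto)
    ultimately show ?thesis using adj_sym[of x "fst e'" G] adj_sym[of "fst e" "fst e'" G] by simp
  qed
  have xl: "distinct (xl e) \<and> set (xl e) \<subseteq> set (snd e)" if "e \<in> set acc" for e
    using opt[OF that] by (auto simp: is_opt_def)
  let ?X = "concat (map xl sl)"
  have X: "mset X = mset ?X" using v(2) by (simp add: mset_concat o_def)
  have dX: "distinct ?X"
    by (rule distinct_concat_sub[OF part(2) sl(2,1) xl disj])
  then have dX': "distinct X" using mset_eq_imp_distinct_iff[OF X] by simp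
  have sX: "set X = set ?X" using X by (rule mset_eq_setD)
  have inj: "e = e'" if "e \<in> set acc" "e' \<in> set acc" "fst e = fst e'" for e e'
    using part(1) that by (meson distinct_map inj_onD)
  have nonadj: "\<not> adj G (fst e) (fst e')" if "e \<in> set sl" "e' \<in> set sl" "e \<noteq> e'" for e e'
  proof -
    obtain i j where ij: "i < length sl" "j < length sl" "sl ! i = e" "sl ! j = e'"
      using \<open>e \<in> set sl\<close> \<open>e' \<in> set sl\<close> by (meson in_set_conv_nth)
    then have "i < j \<or> j < i" using that(3) by (metis linorder_neqE_nat)
    then show ?thesis
      using sorted_wrt_nth_less[OF sl(3), of i j] sorted_wrt_nth_less[OF sl(3), of j i] ij
        adj_sym[of "fst e" "fst e'" G] by auto
  qed
  have "indep G (set X)"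
    unfolding indep_def
  proof (intro ballI)
    fix x y assume "x \<in> set X" "y \<in> set X"
    then obtain e e' where e: "e \<in> set sl" "x \<in> set (xl e)" "e' \<in> set sl" "y \<in> set (xl e')"
      using sX by auto
    have ea: "e \<in> set acc" "e' \<in> set acc" using e sl(1) by auto
    show "\<not> adj G x y"
    proof (cases "e = e'")
      case True
      then show ?thesis using opt[OF ea(1)] e by (auto simp: is_opt_def indep_def)
    next
      case False
      have ne: "fst e \<noteq> fst e'" using inj[OF ea] False by blast
      have "x \<in> set (snd e)" "y \<in> set (snd e')" using xl[OF ea(1)] xl[OF ea(2)] e by auto
      then show ?thesis using adj_rep[OF ea ne] nonadj[OF e(1,3) False] by simp
    qed
  qed
  moreover have "set X \<subseteq> set (flat acc)"
  proof
    fix x assume "x \<in> set X"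
    then obtain e where e: "e \<in> set sl" "x \<in> set (xl e)" using sX by auto
    then have "e \<in> set acc" using sl(1) by auto
    then show "x \<in> set (flat acc)" using xl[of e] e by auto
  qed
  moreover have "v = sum wt (set X)"
  proof -
    have "sum wt (set X) = sum_list (map wt ?X)"
      using sX dX by (simp add: sum_list_distinct_conv_sum_set)
    also have "\<dots> = (\<Sum>e\<leftarrow>sl. sum_list (map wt (xl e)))"
      by (induction sl) auto
    also have "\<dots> = (\<Sum>e\<leftarrow>sl. vl e)"
    proof (intro arg_cong[of _ _ sum_list] map_cong refl)
      fix e assume "e \<in> set sl"
      then have "e \<in> set acc" using sl(1) by blast
      then have "is_opt G wt (set (snd e)) (vl e) (xl e)" by (rule opt)
      then show "sum_list (map wt (xl e)) = vl e"
        using sum_list_distinct_conv_sum_set[of "xl e" wt] unfolding is_opt_def by metis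
    qed
    finally show ?thesis using v(1) by simp
  qed
  moreover have "sum wt Y \<le> v" if Y: "Y \<subseteq> set (flat acc)" "indep G Y" for Y
  proof -
    \<comment> \<open>The selection to compare with consists of the parts that Y meets; all other
      parts contribute 0.\<close>
    let ?p = "\<lambda>e. Y \<inter> set (snd e) \<noteq> {}"
    have "Y = Y \<inter> set (flat acc)" using Y(1) by blast
    then have "sum wt Y = (\<Sum>e\<leftarrow>acc. sum wt (Y \<inter> set (snd e)))"
      using sum_flat[OF part(2), of wt Y] by simp
    also have "\<dots> \<le> (\<Sum>e\<leftarrow>filter ?p acc. vl e)"
    proof (rule sum_list_filter_bound)
      show "sum wt (Y \<inter> set (snd e)) \<le> vl e" if "e \<in> set acc" for e
        using opt[OF that] indep_subset[OF Y(2)] by (auto simp: is_opt_def)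
    qed simp
    also have "\<dots> \<le> v"
    proof (rule max, rule sorted_wrt_mono_rel)
      show "sorted_wrt (\<lambda>e e'. fst e \<noteq> fst e') (filter ?p acc)"
        by (rule distinct_imp_sorted_wrt, rule distinct_map_filter, rule part(1))
      fix e e' assume e: "e \<in> set (filter ?p acc)" "e' \<in> set (filter ?p acc)" "fst e \<noteq> fst e'"
      then obtain x y where "x \<in> Y" "x \<in> set (snd e)" "y \<in> Y" "y \<in> set (snd e')" by auto
      then show "\<not> adj G (fst e) (fst e')"
        using adj_rep[of e e' x y] e Y(2) by (auto simp: indep_def)
    qed
    finally show ?thesis .
  qed
  ultimately show ?thesis using dX' by (simp add: is_opt_def)
qed

section \<open>The recursion over modules\<close>

definition tBk where "tBk N = 200 + tLen N + tTree (N::nat)"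

definition tElim where
  "tElim N K = N * (200 + N * (100 + tEq N) + 2 * (2 ^ (K + 1) * tAp (N::nat)))"

text \<open>The budget of one call without its recursive calls.\<close>

definition tSolve where
  "tSolve N K = 1000 + 20 * N + 2 * tGrow N + 2 * tAp N + tFind N + (N + 1) * tBk N + tElim N K
    + tAssoc N + tMul (N::nat)"

lemma leaf_bound_tree: "leaf_bound (tree A r l L) \<le> leaf_bound l"
  by (induction L) (auto split: if_split)

lemma leaf_bound_buckets_of:
  assumes "\<And>e. e \<in> set acc \<Longrightarrow> sol (snd e) = Lf (Suc (vl e)) (xl e)"
  shows "sum_list (map leaf_bound (buckets_of A sol acc)) \<le> (\<Sum>e\<leftarrow>acc. vl e + length (xl e) + 1) + 1"
  using assms
proof (induction acc)
  case (Cons e acc)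
  have "leaf_bound (tree A (fst e) (sol (snd e)) acc) \<le> Suc (vl e) + length (xl e)"
    using leaf_bound_tree[of A "fst e" "sol (snd e)" acc] Cons.prems[of e] by simp
  then show ?case using Cons by simp
qed simp

text \<open>The interface between graph theory and solver: a partition into modules with
  representatives, together with bags that witness the elimination order and bound the size of the
  trees.\<close>

definition splits_into :: "nat ugraph \<Rightarrow> nat \<Rightarrow> nat set \<Rightarrow> (nat \<times> nat list) list \<Rightarrow> bool" where
  "splits_into G K S acc \<longleftrightarrow> set (flat acc) = S \<and> 2 \<le> length acc \<and>
     distinct (map fst acc) \<and> distinct (flat acc) \<and>
     (\<forall>e\<in>set acc. fst e \<in> set (snd e) \<and> is_module G (set (snd e))) \<and>
     (\<exists>\<B>. elim_order \<B> (map fst acc) \<and> (\<forall>b\<in>\<B>. finite b \<and> card b \<le> K) \<and>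
       (\<forall>e\<in>set acc. \<forall>e'\<in>set acc. adj G (fst e) (fst e') \<longrightarrow> (\<exists>b\<in>\<B>. fst e \<in> b \<and> fst e' \<in> b)))"

lemma sum_list_length_flat: "(\<Sum>e\<leftarrow>acc. length (snd e)) = length (flat acc)"
  by (induction acc) auto

lemma sum_list_add_one: "(\<Sum>e\<leftarrow>acc. f e + g e + 1) = sum_list (map f acc) + sum_list (map g acc) + (length acc :: nat)"
  by (induction acc) auto

text \<open>Each part of length l is entitled to \<open>2 * l - 1\<close> calls. With at least two
  parts the sum stays at least one below \<open>2 * length S - 1\<close>, which pays for the call
  itself.\<close>

lemma sum_list_odd:
  assumes "\<forall>e\<in>set acc. snd e \<noteq> []"
  shows "(\<Sum>e\<leftarrow>acc. (2 * length (snd e) - 1)) + length acc = 2 * (\<Sum>e\<leftarrow>acc. length (snd e))"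
  using assms
proof (induction acc)
  case (Cons e acc)
  obtain x p where "snd e = x # p" using Cons.prems by (cases "snd e") auto
  then show ?case using Cons by simp
qed simp

lemma part_shorter:
  assumes "e \<in> set acc" "2 \<le> length acc" "\<forall>e\<in>set acc. snd e \<noteq> []"
  shows "length (snd e) < length (flat acc)"
proof -
  obtain pre post where acc: "acc = pre @ e # post" using assms(1) by (meson split_list)
  then have "pre \<noteq> [] \<or> post \<noteq> []" using assms(2) by auto
  then show ?thesis
  proof
    assume "pre \<noteq> []"
    then obtain a pre' where "pre = a # pre'" by (cases pre) auto
    then show ?thesis using acc assms(3) by simp
  next
    assume "post \<noteq> []"
    then obtain a post' where "post = a # post'" by (cases post) auto
    then show ?thesis using acc assms(3) by simp
  qed
qed

text \<open>\<open>found\<close> condenses what is required of the looked-up decomposition.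
  \<open>bound\<close> leaves room for twice the total leaf bound of the buckets, which is at most
  the total value, the solution entries, one unit per part and one for the constant bucket; entries
  and parts each number at most \<open>card U\<close>.\<close>

locale solver = universe U N for U N +
  fixes G :: "nat ugraph" and es :: "(nat \<times> nat) list" and W :: "(nat \<times> nat \<times> nat) list"
    and D :: "td list" and big K :: nat and wt :: "nat \<Rightarrow> nat"
  assumes G: "simple_graph G" and UG: "U = verts G"
    and es: "\<And>x y. touches es x y \<longleftrightarrow> adj G x y" "length es \<le> N"
    and W: "fst ` set W = verts G" "distinct (map fst W)"
    and wt: "\<And>v c w. (v, c, w) \<in> set W \<Longrightarrow> wt v = c * big + w" and big: "1 \<le> big" "big \<le> N"
    and bound: "2 * sum wt U + 4 * card U + 10 \<le> N"
    and D: "\<forall>d\<in>set D. td_ok d \<and> parts_disjoint d" "length D \<le> N"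
    and found: "\<And>S. distinct S \<Longrightarrow> is_module G (set S) \<Longrightarrow> 2 \<le> length S \<Longrightarrow>
      cohesive (adj G) (set S) \<Longrightarrow> cohesive (\<lambda>x y. \<not> adj G x y) (set S) \<Longrightarrow>
      splits_into G K (set S) (find_td S D)"
begin

definition ctx :: val where
  "ctx = Node (Atom big) (Node (Node (kv wv W) (el es)) (val_of_list (map tdv D)))"

lemma small_edges: "small_edges N es"
proof clarify
  fix s t assume "(s, t) \<in> set es"
  then have "adj G s t" using es(1) by blast
  then show "bit_length s \<le> N \<and> bit_length t \<le> N \<and> s \<noteq> t"
    using simple_graphD(2)[OF G] U(3) UG by blast
qed

lemma touches_adj: "touches es = adj G"
  using es(1) by blast

lemma N1: "1 \<le> N" using bound by simp

lemma finU: "finite U" by (rule U(1))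

lemma module_sub: "is_module G S \<Longrightarrow> S \<subseteq> U"
  by (simp add: is_module_iff UG)

lemma length_le_card:
  assumes "distinct S" "set S \<subseteq> U"
  shows "length S \<le> card U" "length S \<le> N" "smalls N S"
proof -
  show "length S \<le> card U" using card_mono[OF finU assms(2)] distinct_card[OF assms(1)] by simp
  then show "length S \<le> N" using bound by simp
  show "smalls N S" using assms(2) U(3) by blast
qed

lemma is_opt_bounds:
  assumes "is_opt G wt S v xs" "S \<subseteq> U"
  shows "v \<le> sum wt U" "length xs \<le> card U"
proof -
  have "set xs \<subseteq> U" using assms by (auto simp: is_opt_def)
  then show "length xs \<le> card U" using length_le_card(1) assms(1) by (simp add: is_opt_def)
  have "v = sum wt (set xs)" using assms(1) by (simp add: is_opt_def)
  also have "\<dots> \<le> sum wt U" using \<open>set xs \<subseteq> U\<close> finU by (intro sum_mono2) auto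
  finally show "v \<le> sum wt U" .
qed

lemma runs_ap_leaves:
  assumes "is_opt G wt A v xs" "A \<subseteq> U" "is_opt G wt B u ys" "B \<subseteq> U"
  shows "runs f_ap [Atom (if b then 1 else 0), enc (Lf (Suc v) xs), enc (Lf (Suc u) ys)]
     (enc (leaf_op b (Suc v) xs (Suc u) ys)) (2 * tAp N)"
proof -
  have d: "leaf_bound (Lf (Suc v) xs) + leaf_bound (Lf (Suc u) ys) \<le> N"
    using is_opt_bounds[OF assms(1,2)] is_opt_bounds[OF assms(3,4)] bound by simp
  have "nodes (leaf_op b (Suc v) xs (Suc u) ys) = 1" by (cases b) (auto split: if_split)
  then show ?thesis using runs_ap[of N "Lf (Suc v) xs" "Lf (Suc u) ys" b] d
    by (auto intro: run_mono)
qed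

lemma runs_single:
  assumes "x \<in> U"
  shows "runs f_solve [nl [x], ctx] (enc (Lf (Suc (wt x)) [x])) (tSolve N K)"
proof -
  obtain c w where cw: "(x, c, w) \<in> set W" using assms W(1) UG by force
  then have m: "map_of W x = Some (c, w)" using W(2) by simp
  have "wt x \<le> sum wt U" using assms finU by (intro member_le_sum) auto
  then have b: "c * big + w \<le> N" "wt x = c * big + w" using bound wt[OF cw] by auto
  have "c \<le> c * big" using big(1) by simp
  then have c: "c \<le> N" using b(1) by linarith
  have W': "smalls N (map fst W)" "length W \<le> N"
    using length_le_card[OF W(2)] W(1) UG by simp_all
  have M: "runs f_mul [Atom c, Atom big] (Atom (c * big)) (tMul N)"
    by (rule run_mono[OF runs_mul[of c big N]]) (use b c big(2) in \<open>auto simp: tMul_def intro: mult_le_mono1\<close>)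
  note r = runs_assoc'[OF U(3)[OF assms] W', of wv, unfolded m, simplified] M
  note [simp] = r[THEN run_wpc, simplified]
  have bl: "bit_length (c * big) \<le> N" "bit_length w \<le> N" "bit_length (c * big + w) \<le> N"
    using b(1) bit_length_le[of "c * big"] bit_length_le[of w] bit_length_le[of "c * big + w"] by auto
  show ?thesis unfolding ctx_def
    by (intro runI, simp add: program_simps)
      (use r[THEN run_cost] bl b(2) in \<open>auto simp: tSolve_def split: if_split\<close>)
qed

lemma runs_buckets:
  assumes "\<And>e. e \<in> set acc \<Longrightarrow> runs f_solve [nl (snd e), ctx] (enc (sol (snd e))) (T e)"
    and "smalls N (map fst acc)" "length acc \<le> N" "\<And>e. e \<in> set acc \<Longrightarrow> \<exists>m X. sol (snd e) = Lf m X"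
  shows "runs f_buckets [kv nl acc, ctx] (val_of_list (map enc (buckets_of (adj G) sol acc)))
    ((\<Sum>e\<leftarrow>acc. T e) + (length acc + 1) * tBk N)"
  using assms
proof (induction acc)
  case Nil
  show ?case by (rule runI) (simp add: program_simps tBk_def)
next
  case (Cons e acc)
  obtain r p where e: "e = (r, p)" by fastforce
  obtain m X where mX: "sol p = Lf m X" using Cons.prems(4)[of e] e by auto
  have IH: "runs f_buckets [kv nl acc, ctx] (val_of_list (map enc (buckets_of (adj G) sol acc)))
    ((\<Sum>e\<leftarrow>acc. T e) + (length acc + 1) * tBk N)"
    using Cons by auto
  have S: "runs f_solve [nl p, ctx] (enc (sol p)) (T e)"
    using Cons.prems(1)[of e] e by simp
  have rs: "bit_length r \<le> N" "smalls N (map fst acc)" "length acc \<le> N" using Cons.prems(2,3) e by auto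
  note t = runs_tree'[OF rs(1) small_edges es(2) rs(2,3,3), of "sol p", unfolded touches_adj]
  note len = runs_len'[of "map (\<lambda>(k, x). Node (Atom k) (nl x)) (e # acc)" N, simplified, OF Cons.prems(3)[simplified], unfolded e, simplified]
  obtain ts where ts: "(\<Sum>e\<leftarrow>acc. T e) = ts" by blast
  note r = IH[unfolded ts] S[unfolded e] t len
  note [simp] = r[THEN run_wpc, simplified, unfolded ctx_def, simplified]
  show ?case unfolding ctx_def
    by (intro runI, simp add: program_simps e)
      (use r[THEN run_cost, unfolded ctx_def] in \<open>auto simp: ts tBk_def split: if_split\<close>)
qed

lemma cohesive_from_grow:
  assumes "grow (\<lambda>x y. adj G x y \<noteq> q) [] [s] R = (K', [])"
  shows "cohesive (\<lambda>x y. adj G x y \<noteq> q) (set (s # R))"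
  by (rule grow_all_cohesive[OF assms]) (simp add: symp_def adj_sym)

text \<open>The search only moves elements, so all partition facts follow from equality of
  multisets; uniform adjacency across the split makes both sides modules.\<close>

lemma grow_parts:
  assumes g: "grow (\<lambda>x y. adj G x y \<noteq> q) [] [s] R = (K', R')" and S: "distinct (s # R)" "is_module G (set (s # R))"
    and ne: "R' \<noteq> []"
  shows "distinct K'" "distinct R'" "set K' \<union> set R' = set (s # R)" "set K' \<inter> set R' = {}"
    "is_module G (set K')" "is_module G (set R')" "K' \<noteq> []"
    "length K' + length R' = length (s # R)"
    "\<And>x y. x \<in> set K' \<Longrightarrow> y \<in> set R' \<Longrightarrow> adj G x y = q"
proof -
  have "mset (K' @ R') = mset (s # R)" using grow_mset[OF g] by simp
  note m = this
  have "distinct (K' @ R')" using mset_eq_imp_distinct_iff[OF m] S(1) by simp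
  then show d: "distinct K'" "distinct R'" "set K' \<inter> set R' = {}" by auto
  show un: "set K' \<union> set R' = set (s # R)" using mset_eq_setD[OF m] by simp
  show "length K' + length R' = length (s # R)" using mset_eq_length[OF m] by simp
  have sep: "s \<in> set K'" "\<And>x y. x \<in> set K' \<Longrightarrow> y \<in> set R' \<Longrightarrow> adj G x y = q"
    using grow_separated[OF g] by auto
  then show "K' \<noteq> []" "\<And>x y. x \<in> set K' \<Longrightarrow> y \<in> set R' \<Longrightarrow> adj G x y = q" by auto
  show "is_module G (set K')"
    by (rule module_split[OF S(2), where q = q]) (use un sep in auto)
  show "is_module G (set R')"
  proof (rule module_split[OF S(2), where q = q])
    show "set R' \<subseteq> set (s # R)" using un by auto
    fix x y assume "x \<in> set R'" "y \<in> set (s # R) - set R'"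
    then show "adj G x y = q" using sep(2)[of y x] un adj_sym[of x y G] by auto
  qed
qed

text \<open>The intermediate values \<open>acc\<close>, \<open>L\<close> and \<open>t\<close> are
  exposed because executing \<open>solve_code\<close> needs one \<open>run\<close> fact per call.
  The inequality states that, up to the fixed cost of building buckets, one full
  \<open>tSolve N K\<close> is left for the present call.\<close>

lemma prime_case:
  assumes S: "distinct S" "is_module G (set S)" "2 \<le> length S"
    and coh: "cohesive (adj G) (set S)" "cohesive (\<lambda>x y. \<not> adj G x y) (set S)"
    and IH: "\<And>S'. length S' < length S \<Longrightarrow> distinct S' \<Longrightarrow> is_module G (set S') \<Longrightarrow> S' \<noteq> [] \<Longrightarrow>
      \<exists>v xs. is_opt G wt (set S') v xs \<and>
        runs f_solve [nl S', ctx] (enc (Lf (Suc v) xs)) ((2 * length S' - 1) * tSolve N K)"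
  shows "\<exists>v X acc L t. is_opt G wt (set S) v X \<and>
    runs f_match [nl S, val_of_list (map tdv D)] (kv nl acc) (tFind N) \<and>
    runs f_buckets [kv nl acc, ctx] (val_of_list (map enc L)) t \<and>
    runs f_elim [val_of_list (map enc L)] (enc (Lf (Suc v) X)) (tElim N K) \<and>
    t + tSolve N K \<le> (2 * length S - 1) * tSolve N K + (N + 1) * tBk N"
proof -
  define acc where "acc = find_td S D"
  note f = found[OF S coh, folded acc_def, unfolded splits_into_def]
  have SU: "set S \<subseteq> U" by (rule module_sub[OF S(2)])
  note lS = length_le_card[OF S(1) SU]
  have flat: "set (flat acc) = set S" "distinct (flat acc)" and acc: "2 \<le> length acc" "distinct (map fst acc)"
    and part: "\<And>e. e \<in> set acc \<Longrightarrow> fst e \<in> set (snd e) \<and> is_module G (set (snd e))"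
    using f by auto
  have lflat: "length (flat acc) = length S"
    using flat S(1) by (metis distinct_card)
  have ne: "\<forall>e\<in>set acc. snd e \<noteq> []" using part by fastforce
  have dp: "distinct (snd e)" "set (snd e) \<subseteq> set S" if "e \<in> set acc" for e
    using flat that distinct_concat_iff[of "map snd acc"] by auto
  have "\<forall>p\<in>snd ` set acc. \<exists>r. is_opt G wt (set p) (fst r) (snd r) \<and>
      runs f_solve [nl p, ctx] (enc (Lf (Suc (fst r)) (snd r))) ((2 * length p - 1) * tSolve N K)"
  proof
    fix p assume "p \<in> snd ` set acc"
    then obtain e where e: "e \<in> set acc" "p = snd e" by auto
    have "length p < length S" using part_shorter[OF e(1) acc(1) ne] e(2) lflat by simp
    then show "\<exists>r. is_opt G wt (set p) (fst r) (snd r) \<and>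
      runs f_solve [nl p, ctx] (enc (Lf (Suc (fst r)) (snd r))) ((2 * length p - 1) * tSolve N K)"
      using IH[of p] dp(1)[OF e(1)] part[OF e(1)] ne e by auto
  qed
  from bchoice[OF this] obtain r where r: "\<And>e. e \<in> set acc \<Longrightarrow> is_opt G wt (set (snd e)) (fst (r (snd e))) (snd (r (snd e)))"
    "\<And>e. e \<in> set acc \<Longrightarrow> runs f_solve [nl (snd e), ctx] (enc (Lf (Suc (fst (r (snd e)))) (snd (r (snd e)))))
       ((2 * length (snd e) - 1) * tSolve N K)"
    by auto
  define sol where "sol p = Lf (Suc (fst (r p))) (snd (r p))" for p
  define vl where "vl e = fst (r (snd e))" for e :: "nat \<times> nat list"
  define xl where "xl e = snd (r (snd e))" for e :: "nat \<times> nat list"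
  have sol: "sol (snd e) = Lf (Suc (vl e)) (xl e)" for e
    by (simp add: sol_def vl_def xl_def)
  have opt: "is_opt G wt (set (snd e)) (vl e) (xl e)" if "e \<in> set acc" for e
    using r(1)[OF that] by (simp add: vl_def xl_def)
  have keys: "set (map fst acc) \<subseteq> U" using part dp(2) SU by fastforce
  note lacc = length_le_card[OF acc(2) keys, unfolded length_map]
  have M: "runs f_match [nl S, val_of_list (map tdv D)] (kv nl acc) (tFind N)"
    unfolding acc_def by (rule runs_find_td'[OF D(1) lS(3,2) D(2)])
  let ?L = "buckets_of (adj G) sol acc"
  let ?t = "(\<Sum>e\<leftarrow>acc. (2 * length (snd e) - 1) * tSolve N K) + (length acc + 1) * tBk N"
  have B: "runs f_buckets [kv nl acc, ctx] (val_of_list (map enc ?L)) ?t"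
    by (rule runs_buckets) (use r(2) lacc in \<open>auto simp: sol_def\<close>)
  obtain \<B> where \<B>: "elim_order \<B> (map fst acc)" "\<And>b. b \<in> \<B> \<Longrightarrow> finite b \<and> card b \<le> K"
    "\<And>e e'. e \<in> set acc \<Longrightarrow> e' \<in> set acc \<Longrightarrow> adj G (fst e) (fst e') \<Longrightarrow> \<exists>b\<in>\<B>. fst e \<in> b \<and> fst e' \<in> b"
    using f by blast
  obtain Z where Z: "buckets Z K" "binv Z ?L"
    using buckets_exist[where A = "adj G" and sol = sol and vl = vl and xl = xl and \<B> = \<B> and acc = acc and K = K,
        OF \<B>(1) acc(2) \<B>(2,3) sol] by blast
  interpret buckets Z K by (rule Z(1))
  have lens: "(\<Sum>e\<leftarrow>acc. length (snd e)) = length S" by (simp only: sum_list_length_flat lflat)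
  have "sum_list (map leaf_bound ?L) \<le> (\<Sum>e\<leftarrow>acc. vl e + length (xl e) + 1) + 1"
    by (rule leaf_bound_buckets_of) (rule sol)
  \<comment> \<open>The intersection with \<open>UNIV\<close> matches the form of
    \<open>sum_flat\<close>.\<close>
  also have "(\<Sum>e\<leftarrow>acc. vl e + length (xl e) + 1) \<le> (\<Sum>e\<leftarrow>acc. sum wt (UNIV \<inter> set (snd e)) + length (snd e) + 1)"
  proof (rule sum_list_mono)
    fix e assume e: "e \<in> set acc"
    have o: "distinct (xl e)" "set (xl e) \<subseteq> set (snd e)" "vl e = sum wt (set (xl e))"
      using opt[OF e] by (auto simp: is_opt_def)
    have "length (xl e) \<le> length (snd e)"
      using o(1,2) dp(1)[OF e] by (metis List.finite_set card_mono distinct_card)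
    moreover have "vl e \<le> sum wt (set (snd e))" using o by (auto intro: sum_mono2)
    ultimately show "vl e + length (xl e) + 1 \<le> sum wt (UNIV \<inter> set (snd e)) + length (snd e) + 1" by simp
  qed
  also have "\<dots> = sum wt (set S) + length S + length acc"
    using sum_flat[OF flat(2), of wt UNIV] by (simp only: sum_list_add_one flat(1) lens Int_UNIV_left)
  also have "sum wt (set S) \<le> sum wt U" using SU finU by (intro sum_mono2) auto
  finally have "2 * sum_list (map leaf_bound ?L) \<le> N" using lS(1) lacc(1) bound by simp
  moreover have lL: "length ?L \<le> N" using lacc(1) bound by simp
  moreover have "?L \<noteq> []" by (metis length_buckets_of list.size(3) nat.distinct(1))
  ultimately have E: "runs f_elim [val_of_list (map enc ?L)] (enc (elim ?L)) (tElim N K)"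
    unfolding tElim_def using run_mono[OF runs_elim[OF Z(2)] mult_le_mono1[OF lL]] by blast
  from elim_buckets_of[where A = "adj G" and sol = sol and vl = vl and xl = xl and acc = acc, OF Z(2) sol] obtain v X \<sigma> where v: "elim ?L = Lf (Suc v) X"
    "sorted_wrt (\<lambda>e e'. \<not> adj G (fst e) (fst e')) (chosen \<sigma> acc)"
    "v = (\<Sum>e\<leftarrow>chosen \<sigma> acc. vl e)" "mset X = (\<Sum>e\<leftarrow>chosen \<sigma> acc. mset (xl e))"
    "\<And>p. sorted_wrt (\<lambda>e e'. \<not> adj G (fst e) (fst e')) (filter p acc) \<Longrightarrow> (\<Sum>e\<leftarrow>filter p acc. vl e) \<le> v"
    by blast
  have "is_opt G wt (set (flat acc)) v X"
    by (rule is_opt_quotient[OF acc(2) flat(2) part opt set_chosen distinct_chosen[OF acc(2)] v(2-5)])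
  then have O: "is_opt G wt (set S) v X" using flat(1) by simp
  have "(\<Sum>e\<leftarrow>acc. (2 * length (snd e) - 1)) + length acc = 2 * length S"
    using sum_list_odd[OF ne] unfolding lens .
  then have "(\<Sum>e\<leftarrow>acc. (2 * length (snd e) - 1)) + 1 \<le> 2 * length S - 1"
    using acc(1) by linarith
  then have "((\<Sum>e\<leftarrow>acc. (2 * length (snd e) - 1)) + 1) * tSolve N K \<le> (2 * length S - 1) * tSolve N K"
    by (rule mult_le_mono1)
  then have "(\<Sum>e\<leftarrow>acc. (2 * length (snd e) - 1) * tSolve N K) + tSolve N K \<le> (2 * length S - 1) * tSolve N K"
    by (simp only: sum_list_mult_const add_mult_distrib mult_1)
  moreover have "(length acc + 1) * tBk N \<le> (N + 1) * tBk N" using lacc(2) by (intro mult_le_mono1) simp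
  ultimately have "?t + tSolve N K \<le> (2 * length S - 1) * tSolve N K + (N + 1) * tBk N" by linarith
  then show ?thesis using O M B E[unfolded v(1)] by blast
qed

text \<open>\<open>2 * length S - 1\<close> bounds the number of nodes of a tree with
  \<open>length S\<close> leaves whose inner nodes have at least two sons.\<close>

lemma runs_solve:
  assumes "distinct S" "is_module G (set S)" "S \<noteq> []"
  shows "\<exists>v xs. is_opt G wt (set S) v xs \<and>
    runs f_solve [nl S, ctx] (enc (Lf (Suc v) xs)) ((2 * length S - 1) * tSolve N K)"
  using assms
proof (induction S rule: length_induct)
  case (1 S)
  have IH: "\<exists>v xs. is_opt G wt (set S') v xs \<and>
      runs f_solve [nl S', ctx] (enc (Lf (Suc v) xs)) ((2 * length S' - 1) * tSolve N K)"
    if "length S' < length S" "distinct S'" "is_module G (set S')" "S' \<noteq> []" for S'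
    using 1(1) that by blast
  note S = 1(2-)
  obtain s R where sR: "S = s # R" using S(3) by (cases S) auto
  have SU: "set S \<subseteq> U" by (rule module_sub[OF S(2)])
  note lS = length_le_card[OF S(1) SU]
  show ?case
  proof (cases R)
    case Nil
    have "runs f_solve [nl [s], ctx] (enc (Lf (Suc (wt s)) [s])) (tSolve N K)"
      using SU sR by (intro runs_single) auto
    then show ?thesis
      unfolding sR Nil using is_opt_single[OF G, of wt s]
      by (intro exI[of _ "wt s"] exI[of _ "[s]"]) (simp del: enc.simps)
  next
    case (Cons s2 R2)
    have Rs: "smalls N [s]" "smalls N R" "length [s] + length R \<le> N" using lS sR by auto
    have gr: "runs f_grow [nl [], nl [s], nl R, el es, Atom (if q then 1 else 0)]
        (let (K', R') = grow (\<lambda>x y. adj G x y \<noteq> q) [] [s] R in Node (nl K') (nl R')) (tGrow N)" for q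
    proof (rule run_mono[OF runs_grow[OF small_edges es(2) N1 Rs, of "[]" q, unfolded es(1)]])
      show "(length [s] + length R + 1) * (100 + 2 * tFilt N + (N + 1) * 20) \<le> tGrow N"
        unfolding tGrow_def using Rs(3) by (intro mult_le_mono1) simp
    qed
    obtain K0 R0 where g0: "grow (\<lambda>x y. adj G x y \<noteq> False) [] [s] R = (K0, R0)" by fastforce
    obtain K1 R1 where g1: "grow (\<lambda>x y. adj G x y \<noteq> True) [] [s] R = (K1, R1)" by fastforce
    note G0 = gr[of False, unfolded g0, simplified] and G1 = gr[of True, unfolded g1, simplified]
    \<comment> \<open>Components (q = False, optima added) and co-components (q = True, better
      optimum kept) share this argument. They take different paths through the program, so the
      execution is abstracted into the hypothesis \<open>run\<close>.\<close>
    have split: ?thesis if g: "grow (\<lambda>x y. adj G x y \<noteq> q) [] [s] R = (K', R')" "R' \<noteq> []"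
      and run: "\<And>v xs u ys. runs f_solve [nl K', ctx] (enc (Lf (Suc v) xs)) ((2 * length K' - 1) * tSolve N K) \<Longrightarrow>
        runs f_solve [nl R', ctx] (enc (Lf (Suc u) ys)) ((2 * length R' - 1) * tSolve N K) \<Longrightarrow>
        runs f_ap [Atom (if q then 1 else 0), enc (Lf (Suc v) xs), enc (Lf (Suc u) ys)]
          (enc (leaf_op q (Suc v) xs (Suc u) ys)) (2 * tAp N) \<Longrightarrow>
        runs f_solve [nl S, ctx] (enc (leaf_op q (Suc v) xs (Suc u) ys))
          ((2 * length K' - 1) * tSolve N K + (2 * length R' - 1) * tSolve N K + tSolve N K)" for q K' R'
    proof -
      note gp = grow_parts[OF g(1) S(1,2)[unfolded sR] g(2)]
      have l: "length K' < length S" "length R' < length S" "0 < length K'" "0 < length R'"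
        using gp(7,8) g(2) sR by (cases K'; cases R'; simp)+
      obtain v xs where v: "is_opt G wt (set K') v xs"
        "runs f_solve [nl K', ctx] (enc (Lf (Suc v) xs)) ((2 * length K' - 1) * tSolve N K)"
        using IH[OF l(1) gp(1,5,7)] by blast
      obtain u ys where u: "is_opt G wt (set R') u ys"
        "runs f_solve [nl R', ctx] (enc (Lf (Suc u) ys)) ((2 * length R' - 1) * tSolve N K)"
        using IH[OF l(2) gp(2,6) g(2)] by blast
      have sub: "set K' \<subseteq> U" "set R' \<subseteq> U" using gp(3) SU sR by auto
      note r = run[OF v(2) u(2) runs_ap_leaves[OF v(1) sub(1) u(1) sub(2)]]
      have "2 * length S - 1 = (2 * length K' - 1) + (2 * length R' - 1) + 1"
      proof -
        have "length K' + length R' = length S" using gp(8) sR by simp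
        then show ?thesis using l(3,4) by arith
      qed
      then have t: "(2 * length K' - 1) * tSolve N K + (2 * length R' - 1) * tSolve N K + tSolve N K
          = (2 * length S - 1) * tSolve N K"
        by (simp only: add_mult_distrib mult_1)
      have SKR: "set S = set K' \<union> set R'" using gp(3) sR by simp
      show ?thesis
      proof (cases q)
        case True
        have "is_opt G wt (set S) (if v < u then u else v) (if v < u then ys else xs)"
          unfolding SKR by (rule is_opt_join[OF v(1) u(1)]) (use gp(9) True in auto)
        moreover have "leaf_op q (Suc v) xs (Suc u) ys = Lf (Suc (if v < u then u else v)) (if v < u then ys else xs)"
          using True by (simp split: if_split)
        ultimately show ?thesis using r t by metis
      next
        case False
        have "is_opt G wt (set S) (v + u) (xs @ ys)"
          unfolding SKR by (rule is_opt_union[OF v(1) u(1)]) (use gp(4,9) False in auto)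
        moreover have "leaf_op q (Suc v) xs (Suc u) ys = Lf (Suc (v + u)) (xs @ ys)"
          using False by simp
        ultimately show ?thesis using r t by metis
      qed
    qed
    show ?thesis
    proof (cases "R0 = []")
      case False
      then obtain r0 R0' where R0: "R0 = r0 # R0'" by (cases R0) auto
      show ?thesis
      proof (rule split[OF g0 False])
        fix v xs u ys
        assume a: "runs f_solve [nl K0, ctx] (enc (Lf (Suc v) xs)) ((2 * length K0 - 1) * tSolve N K)"
          "runs f_solve [nl R0, ctx] (enc (Lf (Suc u) ys)) ((2 * length R0 - 1) * tSolve N K)"
          "runs f_ap [Atom (if False then 1 else 0), enc (Lf (Suc v) xs), enc (Lf (Suc u) ys)]
             (enc (leaf_op False (Suc v) xs (Suc u) ys)) (2 * tAp N)"
        obtain L where L: "leaf_op False (Suc v) xs (Suc u) ys = L" by blast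
        obtain t1 t2 where t: "(2 * length K0 - 1) * tSolve N K = t1" "(2 * length R0 - 1) * tSolve N K = t2"
          by blast
        note r = a[unfolded L t] G0
        note [simp] = r[unfolded R0, THEN run_wpc, simplified, unfolded ctx_def, simplified]
        show "runs f_solve [nl S, ctx] (enc (leaf_op False (Suc v) xs (Suc u) ys))
          ((2 * length K0 - 1) * tSolve N K + (2 * length R0 - 1) * tSolve N K + tSolve N K)"
          unfolding L t unfolding sR Cons ctx_def
          by (intro runI, simp add: program_simps R0 Cons[symmetric])
            (use r[unfolded R0, THEN run_cost, unfolded ctx_def] in \<open>auto simp: tSolve_def Cons\<close>)
      qed
    next
      case True
      note G0 = G0[unfolded True]
      show ?thesis
      proof (cases "R1 = []")
        case False
        then obtain r1 R1' where R1: "R1 = r1 # R1'" by (cases R1) auto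
        show ?thesis
        proof (rule split[OF g1 False])
          fix v xs u ys
          assume a: "runs f_solve [nl K1, ctx] (enc (Lf (Suc v) xs)) ((2 * length K1 - 1) * tSolve N K)"
            "runs f_solve [nl R1, ctx] (enc (Lf (Suc u) ys)) ((2 * length R1 - 1) * tSolve N K)"
            "runs f_ap [Atom (if True then 1 else 0), enc (Lf (Suc v) xs), enc (Lf (Suc u) ys)]
               (enc (leaf_op True (Suc v) xs (Suc u) ys)) (2 * tAp N)"
          obtain L where L: "leaf_op True (Suc v) xs (Suc u) ys = L" by blast
          obtain t1 t2 where t: "(2 * length K1 - 1) * tSolve N K = t1" "(2 * length R1 - 1) * tSolve N K = t2"
            by blast
          note r = a[unfolded L t] G0 G1
          note [simp] = r[unfolded R1, THEN run_wpc, simplified, unfolded ctx_def, simplified]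
          show "runs f_solve [nl S, ctx] (enc (leaf_op True (Suc v) xs (Suc u) ys))
            ((2 * length K1 - 1) * tSolve N K + (2 * length R1 - 1) * tSolve N K + tSolve N K)"
            unfolding L t unfolding sR Cons ctx_def
            by (intro runI, simp add: program_simps R1 Cons[symmetric])
              (use r[unfolded R1, THEN run_cost, unfolded ctx_def] in \<open>auto simp: tSolve_def Cons\<close>)
        qed
      next
        case R1: True
        note G1 = G1[unfolded R1]
        have coh: "cohesive (adj G) (set S)" "cohesive (\<lambda>x y. \<not> adj G x y) (set S)"
          using cohesive_from_grow[OF g0[unfolded True]] cohesive_from_grow[OF g1[unfolded R1]] sR by simp_all
        have len2: "2 \<le> length S" using sR Cons by simp
        from prime_case[OF S(1,2) len2 coh IH] obtain v X acc L t where p: "is_opt G wt (set S) v X"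
          "runs f_match [nl S, val_of_list (map tdv D)] (kv nl acc) (tFind N)"
          "runs f_buckets [kv nl acc, ctx] (val_of_list (map enc L)) t"
          "runs f_elim [val_of_list (map enc L)] (enc (Lf (Suc v) X)) (tElim N K)"
          "t + tSolve N K \<le> (2 * length S - 1) * tSolve N K + (N + 1) * tBk N" by blast
        note r = G0 G1 p(2)[unfolded sR] p(3,4)
        note [simp] = r[THEN run_wpc, simplified, unfolded ctx_def, simplified]
        have "runs f_solve [nl S, ctx] (enc (Lf (Suc v) X)) ((2 * length S - 1) * tSolve N K)"
          unfolding sR Cons ctx_def
          by (intro runI, simp add: program_simps Cons[symmetric])
            (use r[THEN run_cost, unfolded ctx_def] p(5) sR Cons in \<open>auto simp: tSolve_def\<close>)
        then show ?thesis using p(1) by blast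
      qed
    qed
  qed
qed

end

section \<open>Decoding of instances\<close>

text \<open>A relation is needed because an object may be decoded in many ways: a quotient graph
  does not determine the lists of its decomposition. In \<open>rep_set_fun\<close> the decoded form
  determines the object.\<close>

lemma rep_set_rel:
  assumes "rep_set R A v" "\<And>a v. a \<in> A \<Longrightarrow> R a v \<Longrightarrow> \<exists>c. v = e c \<and> Q a c"
  shows "\<exists>as cs. v = val_of_list (map e cs) \<and> distinct as \<and> set as = A \<and> list_all2 Q as cs"
proof -
  obtain as vs where as: "distinct as" "set as = A" "list_all2 R as vs" "v = val_of_list vs"
    using assms(1) unfolding rep_set_def by blast
  have "\<exists>cs. vs = map e cs \<and> list_all2 Q as cs"
    using as(3) assms(2)[folded as(2)]
  proof (induction as vs rule: list_all2_induct)
    case (Cons x xs y ys)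
    then obtain cs where "ys = map e cs" "list_all2 Q xs cs" by auto
    moreover obtain c where "y = e c" "Q x c" using Cons by force
    ultimately show ?case by (intro exI[of _ "c # cs"]) simp
  qed simp
  then show ?thesis using as by blast
qed

lemma rep_set_fun:
  assumes "rep_set R A v" "\<And>a v. a \<in> A \<Longrightarrow> R a v \<Longrightarrow> \<exists>c. v = e c \<and> h c = a \<and> P c"
  shows "\<exists>cs. v = val_of_list (map e cs) \<and> distinct (map h cs) \<and> set (map h cs) = A \<and> (\<forall>c\<in>set cs. P c)"
proof -
  obtain as cs where c: "v = val_of_list (map e cs)" "distinct as" "set as = A"
    "list_all2 (\<lambda>a c. h c = a \<and> P c) as cs"
    using rep_set_rel[OF assms(1), of e "\<lambda>a c. h c = a \<and> P c"] assms(2) by blast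
  from c(4) have "as = map h cs \<and> (\<forall>c\<in>set cs. P c)"
    by (induction rule: list_all2_induct) auto
  then show ?thesis using c by blast
qed

lemma rep_set_nat: "rep_set rep_nat A v \<Longrightarrow> \<exists>xs. v = nl xs \<and> distinct xs \<and> set xs = A"
  using rep_set_fun[of rep_nat A v Atom id "\<lambda>_. True"] by (auto simp: rep_nat_def)

text \<open>A list of two distinct vertices fixes an orientation that the edge does not have, hence
  the symmetric \<open>touches\<close>.\<close>

lemma rep_set_edges:
  assumes "rep_set (rep_set rep_nat) E v" "\<And>e. e \<in> E \<Longrightarrow> \<exists>x y. e = {x, y} \<and> x \<noteq> y"
  shows "\<exists>es. v = el es \<and> (\<forall>x y. touches es x y \<longleftrightarrow> {x, y} \<in> E) \<and> (\<forall>(s, t)\<in>set es. s \<noteq> t)"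
proof -
  have "\<exists>c. u = (\<lambda>(s, t). Node (Atom s) (Node (Atom t) (Atom 0))) c \<and> (case c of (s, t) \<Rightarrow> {s, t}) = e \<and>
      (case c of (s, t) \<Rightarrow> s \<noteq> t)" if e: "e \<in> E" "rep_set rep_nat e u" for e u
  proof -
    obtain xs where xs: "u = nl xs" "distinct xs" "set xs = e" using rep_set_nat[OF e(2)] by blast
    obtain x y where "e = {x, y}" "x \<noteq> y" using assms(2)[OF e(1)] by blast
    then have "card (set xs) = 2" using xs(3) by simp
    then have "length xs = 2" using xs(2) distinct_card by force
    then obtain s t where st: "xs = [s, t]" by (auto simp: length_Suc_conv numeral_2_eq_2)
    then show ?thesis using xs by (intro exI[of _ "(s, t)"]) auto
  qed
  from rep_set_fun[OF assms(1) this] obtain es where es: "v = el es"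
    "set (map (\<lambda>(s, t). {s, t}) es) = E" "\<forall>(s, t)\<in>set es. s \<noteq> t"
    by blast
  have "touches es x y \<longleftrightarrow> {x, y} \<in> E" for x y
  proof
    assume "touches es x y"
    then have "{x, y} \<in> (\<lambda>(s, t). {s, t}) ` set es"
    proof
      assume "(x, y) \<in> set es"
      then show ?thesis by (intro image_eqI[of _ _ "(x, y)"]) auto
    next
      assume "(y, x) \<in> set es"
      then show ?thesis by (intro image_eqI[of _ _ "(y, x)"]) auto
    qed
    then show "{x, y} \<in> E" using es(2) by simp
  next
    assume "{x, y} \<in> E"
    then obtain s t where "(s, t) \<in> set es" "{s, t} = {x, y}" using es(2) by auto
    then show "touches es x y" by (auto simp: doubleton_eq_iff)
  qed
  then show ?thesis using es(1,3) by blast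
qed

lemma simple_graph_edge:
  "simple_graph G \<Longrightarrow> e \<in> edges G \<Longrightarrow> \<exists>x y. e = {x, y} \<and> x \<noteq> y"
  unfolding simple_graph_def by blast

definition td_rep :: "nat ugraph \<Rightarrow> (nat \<Rightarrow> nat set set) \<Rightarrow> td \<Rightarrow> bool" where
  "td_rep T B d \<longleftrightarrow> (case d of (nds, es) \<Rightarrow>
     distinct (map fst nds) \<and> fst ` set nds = verts T \<and>
     (\<forall>(t, b)\<in>set nds. set ` set b = B t \<and> (\<forall>p\<in>set b. distinct p)) \<and>
     (\<forall>s t. touches es s t \<longleftrightarrow> adj T s t) \<and> (\<forall>(s, t)\<in>set es. s \<noteq> t))"

lemma rep_td_decode:
  assumes "rep_td (T, B) v" "simple_graph T"
  shows "\<exists>d. v = tdv d \<and> td_rep T B d"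
proof -
  obtain v1 v2 where v: "v = Node v1 v2"
    "rep_set (rep_prod rep_nat (rep_set (rep_set rep_nat))) ((\<lambda>t. (t, B t)) ` verts T) v1"
    "rep_set (rep_set rep_nat) (edges T) v2"
    using assms(1) unfolding rep_td_def rep_prod_def by auto
  obtain es where es: "v2 = el es" "\<And>x y. touches es x y \<longleftrightarrow> adj T x y" "\<forall>(s, t)\<in>set es. s \<noteq> t"
    using rep_set_edges[OF v(3) simple_graph_edge[OF assms(2)]] by auto
  let ?e = "\<lambda>(k, x). Node (Atom k) (nll x)" and ?h = "\<lambda>(t, b). (t, set ` set b)"
    and ?P = "\<lambda>(t, b). \<forall>p\<in>set b. distinct p"
  have "\<exists>c. u = ?e c \<and> ?h c = a \<and> ?P c"
    if a: "rep_prod rep_nat (rep_set (rep_set rep_nat)) a u" for a u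
  proof -
    obtain t bs where t: "a = (t, bs)" by fastforce
    obtain u2 where u: "u = Node (Atom t) u2" "rep_set (rep_set rep_nat) bs u2"
      using a t unfolding rep_prod_def rep_nat_def by auto
    have "\<exists>c. x = nl c \<and> set c = p \<and> distinct c" if "rep_set rep_nat p x" for p x
      using rep_set_nat[OF that] by blast
    from rep_set_fun[OF u(2) this] obtain b where "u2 = nll b" "set (map set b) = bs" "\<forall>c\<in>set b. distinct c"
      by blast
    then show ?thesis using t u by (intro exI[of _ "(t, b)"]) auto
  qed
  from rep_set_fun[OF v(2) this] obtain nds where nds: "v1 = kv nll nds" "distinct (map ?h nds)"
    "set (map ?h nds) = (\<lambda>t. (t, B t)) ` verts T" "\<forall>c\<in>set nds. ?P c" by blast
  have hB: "set ` set b = B t \<and> t \<in> verts T" if "(t, b) \<in> set nds" for t b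
  proof -
    have "?h (t, b) \<in> set (map ?h nds)" using that by force
    then show ?thesis unfolding nds(3) by auto
  qed
  have fst: "map fst (map ?h nds) = map fst nds" by (induction nds) auto
  have "fst ` set nds = fst ` set (map ?h nds)" using fst by (metis set_map)
  also have "\<dots> = verts T" unfolding nds(3) by force
  finally have vT: "fst ` set nds = verts T" .
  have "inj_on fst (set (map ?h nds))" unfolding nds(3) by (auto simp: inj_on_def)
  then have "distinct (map fst (map ?h nds))" using nds(2) distinct_map by blast
  moreover have "\<forall>(t, b)\<in>set nds. set ` set b = B t \<and> (\<forall>p\<in>set b. distinct p)"
    using hB nds(4) by blast
  ultimately have "td_rep T B (nds, es)"
    unfolding td_rep_def fst prod.case using vT es(2,3) by (intro conjI) simp_all
  then show ?thesis using v(1) nds(1) es(1) by (intro exI[of _ "(nds, es)"]) simp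
qed

lemma list_all2_set1: "list_all2 Q as cs \<Longrightarrow> a \<in> set as \<Longrightarrow> \<exists>c\<in>set cs. Q a c"
  by (induction rule: list_all2_induct) auto

lemma list_all2_set2: "list_all2 Q as cs \<Longrightarrow> c \<in> set cs \<Longrightarrow> \<exists>a\<in>set as. Q a c"
  by (induction rule: list_all2_induct) auto

lemma length_le_val_size: "length vs \<le> val_size (val_of_list vs)"
  by (induction vs) auto

lemma val_size_elem: "v \<in> set vs \<Longrightarrow> val_size v \<le> val_size (val_of_list vs)"
  by (induction vs) auto

text \<open>Bags are unconstrained away from the nodes of T, so the node sets to be compared agree
  only on \<open>verts T\<close>.\<close>

lemma connected_induced_cong:
  assumes "simple_graph T" "\<And>t. t \<in> verts T \<Longrightarrow> t \<in> X \<longleftrightarrow> t \<in> Y"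
  shows "connected_graph (induced T X) = connected_graph (induced T Y)"
proof -
  have "e \<subseteq> X \<longleftrightarrow> e \<subseteq> Y" if "e \<in> edges T" for e
    using assms that unfolding simple_graph_def by blast
  then have "induced T X = induced T Y" using assms(2) unfolding induced_def by auto
  then show ?thesis by simp
qed

text \<open>One decoded decomposition together with the strong module it belongs to. The program
  does not see M; \<open>flat_acc\<close> recovers it.\<close>

locale quotient_td = universe U N for U N +
  fixes G :: "nat ugraph" and M :: "nat set" and T :: "nat ugraph" and B :: "nat \<Rightarrow> nat set set"
    and k :: nat and nds :: "(nat \<times> nat list list) list" and tes :: "(nat \<times> nat) list"
  assumes G: "simple_graph G" and UG: "U = verts G"
    and M: "strong_module G M" "2 \<le> card M"
    and td: "tree_decomposition (quotient_graph (induced G M) (Pi_mod (induced G M))) T B" "td_width T B \<le> k"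
    and d: "td_rep T B (nds, tes)"
    and size: "val_size (tdv (nds, tes)) \<le> N"
begin

abbreviation "H \<equiv> induced G M"

lemma M_verts: "verts H = M" "M \<subseteq> U"
  using strong_moduleD(1)[OF M(1)] UG by (auto simp: is_module_iff)

lemma simple_H: "simple_graph H" by (rule simple_graph_induced[OF G])

lemmas partition = Pi_mod_partition[of H, unfolded M_verts(1),
    OF simple_graphD(1)[OF simple_H, unfolded M_verts(1)] M(2)]

lemma T: "is_tree T" "simple_graph T" "verts T \<noteq> {}"
  using td(1) by (auto simp: tree_decomposition_def is_tree_def)

lemma bags: "(\<Union>t\<in>verts T. B t) = Pi_mod H"
  using td(1) by (simp add: tree_decomposition_def)

lemma nds_props: "distinct (map fst nds)" "fst ` set nds = verts T"
  "\<And>t b. (t, b) \<in> set nds \<Longrightarrow> set ` set b = B t" "\<And>t b p. (t, b) \<in> set nds \<Longrightarrow> p \<in> set b \<Longrightarrow> distinct p"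
  "\<And>s t. touches tes s t \<longleftrightarrow> adj T s t" "\<And>s t. (s, t) \<in> set tes \<Longrightarrow> s \<noteq> t"
proof -
  note d' = d[unfolded td_rep_def prod.case]
  note d2 = d'[THEN conjunct2] note d3 = d2[THEN conjunct2] note d4 = d3[THEN conjunct2]
  show "distinct (map fst nds)" "fst ` set nds = verts T"
    by (rule d'[THEN conjunct1], rule d2[THEN conjunct1])
  show "touches tes s t \<longleftrightarrow> adj T s t" for s t
    by (rule d4[THEN conjunct1, rule_format])
  show "set ` set b = B t" if "(t, b) \<in> set nds" for t b
    using bspec[OF d3[THEN conjunct1] that] by (simp only: prod.case)
  show "distinct p" if "(t, b) \<in> set nds" "p \<in> set b" for t b p
    using bspec[OF d3[THEN conjunct1] that(1)] that(2) by simp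
  show "s \<noteq> t" if "(s, t) \<in> set tes" for s t
    using bspec[OF d4[THEN conjunct2] that] by simp
qed

definition "all_parts = \<Union>(set ` snd ` set nds)"

lemma part_in_Pi: "p \<in> all_parts \<Longrightarrow> set p \<in> Pi_mod H"
proof -
  assume "p \<in> all_parts"
  then obtain t b where tb: "(t, b) \<in> set nds" "p \<in> set b" by (auto simp: all_parts_def)
  then have "set p \<in> B t" "t \<in> verts T" using nds_props(2) nds_props(3)[OF tb(1)] by force+
  then show ?thesis using bags by blast
qed

lemma Pi_in_parts: "P \<in> Pi_mod H \<Longrightarrow> \<exists>p\<in>all_parts. set p = P"
proof -
  assume "P \<in> Pi_mod H"
  then obtain t where t: "t \<in> verts T" "P \<in> B t" using bags by blast
  then obtain b where b: "(t, b) \<in> set nds" using nds_props(2) by force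
  then have "P \<in> set ` set b" using nds_props(3) t by blast
  then show ?thesis using b by (force simp: all_parts_def)
qed

lemma part_ok: "p \<in> all_parts \<Longrightarrow> part_ok p"
proof -
  assume p: "p \<in> all_parts"
  then have P: "set p \<in> Pi_mod H" by (rule part_in_Pi)
  have "set p \<noteq> {}" "set p \<subseteq> M" using partition(2) P partition(1) by (metis, blast)
  moreover have "distinct p" using p nds_props(4) by (auto simp: all_parts_def)
  ultimately show ?thesis unfolding part_ok_def using M_verts(2) by auto
qed

lemma val_size_parts:
  "val_size (kv nll nds) \<le> N" "val_size (el tes) \<le> N"
  using size by auto

lemma td_ok: "td_ok (nds, tes)"
  unfolding td_ok_def prod.case
proof (intro conjI)
  show "nds \<noteq> []" using nds_props(2) T(3) by auto
  show "length nds \<le> N" "length tes \<le> N"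
    using val_size_parts length_le_val_size order_trans length_map by metis+
  show "distinct (map fst nds)" by (rule nds_props(1))
  have elem: "1 + val_size (Atom t) + val_size (nll b) \<le> N" if "(t, b) \<in> set nds" for t b
  proof -
    have "Node (Atom t) (nll b) \<in> set (map (\<lambda>(k, x). Node (Atom k) (nll x)) nds)" using that by force
    from val_size_elem[OF this] val_size_parts(1) show ?thesis by simp
  qed
  then show "smalls N (map fst nds)" by fastforce
  show "\<forall>(s, t)\<in>set tes. s \<in> fst ` set nds \<and> t \<in> fst ` set nds \<and> s \<noteq> t"
  proof clarify
    fix s t assume "(s, t) \<in> set tes"
    then have "adj T s t" using nds_props(5) by blast
    then show "s \<in> fst ` set nds \<and> t \<in> fst ` set nds \<and> s \<noteq> t"
      using simple_graphD(2)[OF T(2)] nds_props(2) by blast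
  qed
  show "\<forall>(t, b)\<in>set nds. length b \<le> N \<and> (\<forall>p\<in>set b. part_ok p)"
  proof clarify
    fix t b assume tb: "(t, b) \<in> set nds"
    have "length b \<le> val_size (nll b)" using length_le_val_size[of "map nl b"] by simp
    then have "length b \<le> N" using elem[OF tb] by linarith
    moreover have "\<forall>p\<in>set b. part_ok p" using tb part_ok by (force simp: all_parts_def)
    ultimately show "length b \<le> N \<and> (\<forall>p\<in>set b. part_ok p)" ..
  qed
qed

lemma parts_disjoint: "parts_disjoint (nds, tes)"
  unfolding parts_disjoint_def fst_conv all_parts_def[symmetric]
  using Pi_mod_disjoint part_in_Pi by blast

definition "acc = start (nds, tes)"

lemma acc_entries: "e \<in> set acc \<Longrightarrow> snd e \<in> all_parts \<and> fst e = Min (set (snd e))"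
proof -
  assume "e \<in> set acc"
  then have "e \<in> (\<lambda>p. (Min (set p), p)) ` all_parts"
    using start_entries(2)[OF td_ok] unfolding acc_def fst_conv all_parts_def by blast
  then show ?thesis by auto
qed

lemma Min_part: "p \<in> all_parts \<Longrightarrow> Min (set p) \<in> set p"
  using part_ok[of p] by (intro Min_in) (auto simp: part_ok_def)

text \<open>Different parts are disjoint, so a common minimum identifies them.\<close>

lemma Min_inj: "p \<in> all_parts \<Longrightarrow> q \<in> all_parts \<Longrightarrow> Min (set p) = Min (set q) \<Longrightarrow> set p = set q"
  using Min_part[of p] Min_part[of q] part_in_Pi Pi_mod_disjoint by (metis disjoint_iff)

text \<open>For the minimum of a part this is the connectivity condition on that part; any other v
  lies in no bag, and the empty graph is connected.\<close>

lemma connected_reps: "connected_graph (induced T {t. \<exists>b. (t, b) \<in> set nds \<and> v \<in> reps b})"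
proof (cases "\<exists>p\<in>all_parts. v = Min (set p)")
  case True
  then obtain p where p: "p \<in> all_parts" "v = Min (set p)" by blast
  have "connected_graph (induced T {t. set p \<in> B t})"
    using td(1) part_in_Pi[OF p(1)] by (simp add: tree_decomposition_def)
  moreover have "t \<in> {t. \<exists>b. (t, b) \<in> set nds \<and> v \<in> reps b} \<longleftrightarrow> t \<in> {t. set p \<in> B t}" if tv: "t \<in> verts T" for t
  proof -
    obtain b where b: "(t, b) \<in> set nds" using tv nds_props(2) by force
    have uni: "b' = b" if "(t, b') \<in> set nds" for b'
      using nds_props(1) that b by (metis map_of_eq_Some_iff option.inject)
    have "v \<in> reps b \<longleftrightarrow> set p \<in> set ` set b"
    proof
      assume "v \<in> reps b"
      then obtain q where q: "q \<in> set b" "v = Min (set q)" by (auto simp: reps_def)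
      then have "q \<in> all_parts" using b by (force simp: all_parts_def)
      then show "set p \<in> set ` set b" using Min_inj[OF p(1)] p(2) q by blast
    next
      assume "set p \<in> set ` set b"
      then show "v \<in> reps b" using p(2) by (auto simp: reps_def)
    qed
    then show ?thesis using b uni nds_props(3) by blast
  qed
  ultimately show ?thesis using connected_induced_cong[OF T(2)] by blast
next
  case False
  then have e: "{t. \<exists>b. (t, b) \<in> set nds \<and> v \<in> reps b} = {}"
    by (force simp: reps_def all_parts_def)
  show ?thesis unfolding e connected_graph_def by simp
qed

lemma reps_all: "\<Union>(reps ` snd ` set nds) = (\<lambda>p. Min (set p)) ` all_parts"
  by (auto simp: reps_def all_parts_def)

lemma elim_order_acc: "fst ` set acc = (\<lambda>p. Min (set p)) ` all_parts" "elim_order (reps ` snd ` set nds) (map fst acc)"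
  using elim_order_start[OF T(1) nds_props(2,1,5) connected_reps] td_ok
  unfolding acc_def reps_all by (auto simp: td_ok_def)

lemma flat_acc: "set (flat acc) = M"
proof
  show "set (flat acc) \<subseteq> M"
    using acc_entries part_in_Pi partition(1) by fastforce
  show "M \<subseteq> set (flat acc)"
  proof
    fix x assume "x \<in> M"
    then obtain P where P: "P \<in> Pi_mod H" "x \<in> P" using partition(1) by blast
    then obtain p where p: "p \<in> all_parts" "set p = P" using Pi_in_parts by blast
    then obtain e where e: "e \<in> set acc" "fst e = Min (set p)" using elim_order_acc(1) by force
    then have "set (snd e) = P" using acc_entries[OF e(1)] Min_inj p by metis
    then show "x \<in> set (flat acc)" using e P by auto
  qed
qed

lemma acc_props:
  "2 \<le> length acc" "distinct (map fst acc)" "distinct (flat acc)"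
  "\<And>e. e \<in> set acc \<Longrightarrow> fst e \<in> set (snd e) \<and> is_module G (set (snd e))"
proof -
  show "distinct (map fst acc)" using start_entries(1)[OF td_ok] by (simp add: acc_def acc_ok_def)
  show "distinct (flat acc)" using start_parts(2)[OF td_ok parts_disjoint] by (simp add: acc_def)
  show "fst e \<in> set (snd e) \<and> is_module G (set (snd e))" if e: "e \<in> set acc" for e
    using acc_entries[OF e] Min_part Pi_mod_module[OF part_in_Pi]
      module_trans[OF strong_moduleD(1)[OF M(1)]] by metis
  \<comment> \<open>A single part would be M itself, whereas members of \<open>Pi_mod\<close> are
    proper.\<close>
  show "2 \<le> length acc"
  proof (rule ccontr)
    assume "\<not> ?thesis"
    then consider "acc = []" | e where "acc = [e]"
      by (cases acc rule: remdups_adj.cases) auto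
    then show False
    proof cases
      case 1
      then show False using flat_acc M(2) by auto
    next
      case 2
      then have "set (snd e) = M" "set (snd e) \<in> Pi_mod H"
        using flat_acc acc_entries[of e] part_in_Pi by auto
      then show False using M_verts(1) unfolding Pi_mod_def by auto
    qed
  qed
qed

lemma acc_bags:
  "b \<in> reps ` snd ` set nds \<Longrightarrow> finite b \<and> card b \<le> k + 1"
  "e \<in> set acc \<Longrightarrow> e' \<in> set acc \<Longrightarrow> adj G (fst e) (fst e') \<Longrightarrow>
    \<exists>b\<in>reps ` snd ` set nds. fst e \<in> b \<and> fst e' \<in> b"
proof -
  assume "b \<in> reps ` snd ` set nds"
  then obtain t b' where b: "(t, b') \<in> set nds" "b = reps b'" by force
  have eq: "reps b' = Min ` B t" unfolding nds_props(3)[OF b(1), symmetric] reps_def by (auto simp: image_image)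
  have t: "t \<in> verts T" using b(1) nds_props(2) by force
  have "B t \<subseteq> Pi_mod H" using bags t by blast
  then have "finite (B t)" using partition(3) by (rule finite_subset)
  then have "card b \<le> card (B t)" unfolding b(2) eq by (rule card_image_le)
  also have "card (B t) \<le> Max ((\<lambda>t. card (B t)) ` verts T)"
    using t simple_graphD(1)[OF T(2)] by (intro Max_ge) auto
  \<comment> \<open>The width is the maximal bag size minus one.\<close>
  also have "\<dots> \<le> k + 1" using td(2) unfolding td_width_def by linarith
  finally show "finite b \<and> card b \<le> k + 1" using b(2) by (simp add: reps_def)
next
  assume e: "e \<in> set acc" "e' \<in> set acc" "adj G (fst e) (fst e')"
  note p = acc_entries[OF e(1)] acc_entries[OF e(2)]
  have Pi: "set (snd e) \<in> Pi_mod H" "set (snd e') \<in> Pi_mod H" using p part_in_Pi by auto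
  have m: "fst e \<in> set (snd e)" "fst e' \<in> set (snd e')" using p Min_part by auto
  have "adj H (fst e) (fst e')" using e(3) m Pi partition(1) by auto
  \<comment> \<open>Equal parts would have equal minima, giving a loop.\<close>
  moreover have "set (snd e) \<noteq> set (snd e')"
    using p e(3) simple_graphD(2)[OF G] by metis
  ultimately have q: "adj (quotient_graph H (Pi_mod H)) (set (snd e)) (set (snd e'))"
    using adj_quotient[OF Pi m] by blast
  have cov: "\<forall>f\<in>edges (quotient_graph H (Pi_mod H)). \<exists>t\<in>verts T. f \<subseteq> B t"
    using td(1) unfolding tree_decomposition_def by (elim conjE)
  from bspec[OF cov q] obtain t where "t \<in> verts T" "{set (snd e), set (snd e')} \<subseteq> B t" by blast
  then have t: "t \<in> verts T" "set (snd e) \<in> B t" "set (snd e') \<in> B t" by auto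
  obtain b where b: "(t, b) \<in> set nds" using t(1) nds_props(2) by force
  have "reps b = Min ` B t" unfolding nds_props(3)[OF b, symmetric] reps_def by (auto simp: image_image)
  then have "fst e \<in> reps b" "fst e' \<in> reps b" using p t by auto
  then show "\<exists>b\<in>reps ` snd ` set nds. fst e \<in> b \<and> fst e' \<in> b" using b by force
qed

lemma splits_into_acc: "splits_into G (k + 1) M acc"
  unfolding splits_into_def
  by (intro conjI ballI impI flat_acc acc_props exI[of _ "reps ` snd ` set nds"] elim_order_acc(2) acc_bags)
    (use acc_props(4) acc_bags(1) in blast)+

end

section \<open>The main function and the final bound\<close>

definition inst_val :: "(nat \<times> nat \<times> nat) list \<Rightarrow> (nat \<times> nat) list \<Rightarrow> td list \<Rightarrow> val" where
  "inst_val W es D = Node (Node (kv wv W) (el es)) (val_of_list (map tdv D))"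

definition tMain where
  "tMain N K = 200 + (N + 1) * 50 + (N + 1) * (50 + 2 * N) + 2 * N + 2 * N * tSolve N K"

lemma (in solver) runs_main:
  assumes "big = (\<Sum>(v, c, w)\<leftarrow>W. w) + 1"
  shows "\<exists>v xs. is_opt G wt U v xs \<and> runs 0 [inst_val W es D] (nl xs) (tMain N K)"
proof (cases W)
  case Nil
  then have "is_opt G wt U 0 []" using W(1) UG by (auto simp: is_opt_def indep_def)
  moreover have "runs 0 [inst_val W es D] (nl []) (tMain N K)"
    unfolding inst_val_def Nil
    by (rule runI) (simp add: program_simps tMain_def)
  ultimately show ?thesis by blast
next
  case (Cons e W')
  obtain u c w where e: "e = (u, c, w)" by (cases e) auto
  have keys: "set (map fst W) = U" using W(1) UG by simp
  have m: "is_module G (set (map fst W))" unfolding keys UG is_module_iff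
    using simple_graphD(2)[OF G] by blast
  have ne: "map fst W \<noteq> []" using Cons by simp
  obtain v xs where s: "is_opt G wt U v xs"
    "runs f_solve [nl (map fst W), ctx] (enc (Lf (Suc v) xs)) ((2 * length (map fst W) - 1) * tSolve N K)"
    using runs_solve[OF W(2) m ne] unfolding keys by blast
  have lW: "length W \<le> N" using length_le_card(2)[OF W(2)] keys by simp
  have "(2 * length (map fst W) - 1) * tSolve N K \<le> 2 * N * tSolve N K"
    using lW by (intro mult_le_mono1) simp
  note S = run_mono[OF s(2) this]
  have "(\<Sum>(v, c, w)\<leftarrow>W. w) \<le> N" using assms big(2) by simp
  note SW = run_mono[OF runs_sumw[OF this] mult_le_mono1[of "length W + 1" "N + 1"]]
  have SW: "runs f_sumw [kv wv W] (Atom (\<Sum>(v, c, w)\<leftarrow>W. w)) ((N + 1) * (50 + 2 * N))"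
    by (rule SW) (use lW in simp)
  have KW: "runs f_keys [kv wv W] (nl (map fst W)) ((N + 1) * 50)"
    by (rule run_mono[OF runs_keys]) (use lW in simp)
  have b: "bit_length (\<Sum>(v, c, w)\<leftarrow>W. w) \<le> N"
    using bit_length_le[of "\<Sum>(v, c, w)\<leftarrow>W. w"] assms big(2) by simp
  obtain sw where sw: "(\<Sum>(v, c, w)\<leftarrow>W. w) = sw" by blast
  note r = S SW[unfolded sw] KW
  obtain n1 n2 where kvW: "kv wv W = Node n1 n2" using Cons by simp
  obtain ks where ks: "nl (map fst W) = ks" by blast
  note r = r[unfolded ctx_def, unfolded assms sw kvW ks]
  note [simp] = r[THEN run_wpc, simplified]
  have "runs 0 [inst_val W es D] (nl xs) (tMain N K)"
    unfolding inst_val_def kvW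
    by (intro runI, simp add: program_simps)
      (use r[THEN run_cost] b[unfolded sw] in \<open>auto simp: tMain_def\<close>)
  then show ?thesis using s(1) by blast
qed

text \<open>The two extra steps are the variable and the call of the main function.\<close>

lemma computes_if_runs:
  assumes "runs 0 [inp] out T"
  shows "\<exists>t\<le>T + 2. computes prog inp out t"
proof -
  obtain t where t: "t \<le> T" "eval prog [inp] (prog ! 0) out t" using assms by (auto simp: run_def)
  have "eval prog [inp] (Var 0) ([inp] ! 0) 1" by (rule eval_Var) simp
  then have "evals prog [inp] [Var 0] [inp] (1 + 0)"
    using evals_Cons[OF _ evals_Nil] by fastforce
  then have "eval prog [inp] (Call 0 [Var 0]) out (1 + 0 + t + 1)"
    by (rule eval_Call[OF _ _ t(2)]) (simp add: prog_def)
  then show ?thesis using t(1) unfolding computes_def by (intro exI[of _ "t + 2"]) simp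
qed

text \<open>Every weight sum is below \<open>big\<close>, so cost and weight act as two digits in
  base \<open>big\<close>, and comparing numbers is comparing lexicographically.\<close>

lemma lex_max_if_is_opt:
  assumes "simple_graph G" "is_opt G (\<lambda>v. c v * big + w v) (verts G) v xs" "sum w (verts G) < big"
  shows "lex_max_independent_set G c w (set xs)"
  unfolding lex_max_independent_set_def
proof (intro conjI allI impI)
  have fin: "finite (verts G)" by (rule simple_graphD(1)[OF assms(1)])
  have wsmall: "sum w Y < big" if "Y \<subseteq> verts G" for Y
    using sum_mono2[OF fin that, of w] assms(3) by simp
  have val: "(\<Sum>v\<in>Y. c v * big + w v) = sum c Y * big + sum w Y" for Y
    by (simp add: sum.distrib sum_distrib_right)
  show "independent_set G (set xs)"
    using assms(2) by (auto simp: independent_set_def is_opt_def indep_def)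
  fix Y assume Y: "independent_set G Y"
  have le: "sum c Y * big + sum w Y \<le> sum c (set xs) * big + sum w (set xs)"
    using assms(2) Y unfolding val[symmetric] by (auto simp: independent_set_def is_opt_def indep_def)
  note le
  moreover have "sum w (set xs) < big" using wsmall assms(2) by (simp add: is_opt_def)
  moreover have "sum c (set xs) * big + big \<le> sum c Y * big" if "sum c (set xs) < sum c Y"
    using mult_le_mono1[of "Suc (sum c (set xs))" "sum c Y" big] that by simp
  ultimately have "\<not> sum c (set xs) < sum c Y" by linarith
  moreover have "sum w Y \<le> sum w (set xs)" if "sum c Y = sum c (set xs)"
    using le that by simp
  ultimately show "sum c Y < sum c (set xs) \<or> sum c Y = sum c (set xs) \<and> sum w Y \<le> sum w (set xs)"
    by linarith
qed

lemma rep_weighted_graph_decode: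
  assumes "rep_weighted_graph (G, c, w) g" "simple_graph G"
  shows "\<exists>W es. g = Node (kv wv W) (el es) \<and> distinct (map fst W) \<and>
    set W = (\<lambda>v. (v, c v, w v)) ` verts G \<and> (\<forall>x y. touches es x y \<longleftrightarrow> adj G x y)"
proof -
  obtain v1 v2 where g: "g = Node v1 v2"
    "rep_set (rep_prod rep_nat (rep_prod rep_nat rep_nat)) ((\<lambda>v. (v, c v, w v)) ` verts G) v1"
    "rep_set (rep_set rep_nat) (edges G) v2"
    using assms(1) unfolding rep_weighted_graph_def rep_prod_def by auto
  obtain es where es: "v2 = el es" "\<And>x y. touches es x y \<longleftrightarrow> adj G x y"
    using rep_set_edges[OF g(3) simple_graph_edge[OF assms(2)]] by auto
  let ?e = "\<lambda>(k, x). Node (Atom k) (wv x)"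
  have "\<exists>p. u = ?e p \<and> id p = a \<and> True" if "rep_prod rep_nat (rep_prod rep_nat rep_nat) a u" for a u
    using that unfolding rep_prod_def rep_nat_def by (intro exI[of _ a]) (auto split: prod.split)
  from rep_set_fun[OF g(2) this] obtain W where W: "v1 = kv wv W" "distinct W"
    "set W = (\<lambda>v. (v, c v, w v)) ` verts G" by auto
  have "inj_on fst (set W)" unfolding W(3) by (auto simp: inj_on_def)
  then have "distinct (map fst W)" using W(2) by (simp add: distinct_map)
  then show ?thesis using g(1) W es by blast
qed

text \<open>In N the input size bounds decoded lists and names, and the remaining terms bound the
  leaves of decision trees.\<close>

lemma rep_instance_solver:
  assumes G: "simple_graph G" and c: "\<forall>v\<in>verts G. 1 \<le> c v"
    and td: "\<forall>H\<in>prime_quotients G. tree_decomposition H (T H) (B H) \<and> td_width (T H) (B H) \<le> k"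
    and inp: "rep_instance G c w T B inp"
  defines "big \<equiv> sum w (verts G) + 1"
  defines "wt \<equiv> \<lambda>v. c v * big + w v"
  defines "N \<equiv> val_size inp + 2 * sum wt (verts G) + 4 * card (verts G) + 10"
  shows "\<exists>W es D. inp = inst_val W es D \<and> big = (\<Sum>(v, c, w)\<leftarrow>W. w) + 1 \<and>
    solver (verts G) N G es W D big (k + 1) wt"
proof -
  obtain g ds where v: "inp = Node g ds" "rep_weighted_graph (G, c, w) g"
    "rep_set (\<lambda>H. rep_td (T H, B H)) (prime_quotients G) ds"
    using inp unfolding rep_instance_def by blast
  obtain W es where W: "g = Node (kv wv W) (el es)" "distinct (map fst W)"
    "set W = (\<lambda>v. (v, c v, w v)) ` verts G" "\<And>x y. touches es x y \<longleftrightarrow> adj G x y"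
    using rep_weighted_graph_decode[OF v(2) G] by blast
  have "\<exists>d. u = tdv d \<and> td_rep (T H) (B H) d" if "H \<in> prime_quotients G" "rep_td (T H, B H) u" for H u
    using that td by (intro rep_td_decode) (auto simp: tree_decomposition_def is_tree_def)
  from rep_set_rel[where e = tdv and Q = "\<lambda>H. td_rep (T H) (B H)", OF v(3) this] obtain Hs D where D: "ds = val_of_list (map tdv D)"
    "set Hs = prime_quotients G" "list_all2 (\<lambda>H. td_rep (T H) (B H)) Hs D"
    by blast
  have inp_eq: "inp = inst_val W es D" using v(1) W(1) D(1) by (simp add: inst_val_def)
  have fin: "finite (verts G)" by (rule simple_graphD(1)[OF G])
  have sizes: "val_size (kv wv W) \<le> N" "val_size (el es) \<le> N" "val_size (val_of_list (map tdv D)) \<le> N"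
    by (simp_all add: N_def inp_eq inst_val_def)
  have keys: "fst ` set W = verts G" unfolding W(3) by force
  have sumw: "(\<Sum>(v, c, w)\<leftarrow>W. w) = sum w (verts G)"
  proof -
    have "(\<Sum>(v, c, w)\<leftarrow>W. w) = (\<Sum>v\<leftarrow>map fst W. w v)"
      unfolding map_map by (intro arg_cong[of _ _ sum_list] map_cong refl) (use W(3) in auto)
    then show ?thesis using sum_list_distinct_conv_sum_set[OF W(2), of w] keys by simp
  qed
  have elemW: "bit_length u \<le> N" if "u \<in> verts G" for u
  proof -
    have "Node (Atom u) (wv (c u, w u)) \<in> set (map (\<lambda>(k, x). Node (Atom k) (wv x)) W)"
      using that W(3) by force
    from val_size_elem[OF this] sizes(1) show ?thesis by simp
  qed
  have univ: "universe (verts G) N"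
    by unfold_locales (use fin elemW in \<open>auto simp: N_def\<close>)
  have quot: "\<exists>M. strong_module G M \<and> 2 \<le> card M \<and> H = quotient_graph (induced G M) (Pi_mod (induced G M)) \<and>
      quotient_td (verts G) N G M (T H) (B H) k (fst d) (snd d)"
    if H: "H \<in> prime_quotients G" "td_rep (T H) (B H) d" "d \<in> set D" for H d
  proof -
    obtain M where M: "strong_module G M" "2 \<le> card M" "H = quotient_graph (induced G M) (Pi_mod (induced G M))"
      using H(1) unfolding prime_quotients_def by blast
    have "val_size (tdv d) \<le> N"
      using val_size_elem[of "tdv d" "map tdv D"] H(3) sizes(3) by (auto intro: order_trans)
    then have "quotient_td (verts G) N G M (T H) (B H) k (fst d) (snd d)"
      using univ G M td H unfolding quotient_td_def quotient_td_axioms_def by (simp split: prod.split)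
    then show ?thesis using M by blast
  qed
  have allD: "\<exists>H M. H \<in> prime_quotients G \<and> strong_module G M \<and> 2 \<le> card M \<and>
      H = quotient_graph (induced G M) (Pi_mod (induced G M)) \<and>
      quotient_td (verts G) N G M (T H) (B H) k (fst d) (snd d)" if "d \<in> set D" for d
    using list_all2_set2[OF D(3) that] quot[OF _ _ that] D(2) by blast
  have "solver (verts G) N G es W D big (k + 1) wt"
    unfolding solver_def solver_axioms_def
  proof (intro conjI allI impI univ G refl W(2,4) keys)
    show "length es \<le> N"
      using length_le_val_size[of "map (\<lambda>(s, t). Node (Atom s) (Node (Atom t) (Atom 0))) es"] sizes(2) by simp
    show "length D \<le> N" using length_le_val_size[of "map tdv D"] sizes(3) by simp
    show "wt v = c' * big + w'" if "(v, c', w') \<in> set W" for v c' w'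
      using that W(3) by (auto simp: wt_def)
    show "1 \<le> big" by (simp add: big_def)
    show "big \<le> N"
    \<comment> \<open>Costs are at least 1, so the combined weight of any single vertex already
      exceeds \<open>big\<close>, or equals it up to its own weight; without vertices
      \<open>big\<close> is 1.\<close>
    proof (cases "verts G = {}")
      case True
      then show ?thesis by (simp add: big_def N_def)
    next
      case False
      then obtain v where v: "v \<in> verts G" by blast
      have "1 * big \<le> c v * big" using c v by (intro mult_le_mono1) auto
      then have "big \<le> wt v" unfolding wt_def mult_1 by linarith
      also have "\<dots> \<le> sum wt (verts G)" using v fin by (intro member_le_sum) auto
      finally show ?thesis by (simp add: N_def)
    qed
    show "2 * sum wt (verts G) + 4 * card (verts G) + 10 \<le> N" by (simp add: N_def)
    show "\<forall>d\<in>set D. universe.td_ok (verts G) N d \<and> parts_disjoint d"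
    proof
      fix d assume "d \<in> set D"
      from allD[OF this] obtain H M where q: "quotient_td (verts G) N G M (T H) (B H) k (fst d) (snd d)"
        by (elim exE conjE)
      show "universe.td_ok (verts G) N d \<and> parts_disjoint d"
        using quotient_td.td_ok[OF q] quotient_td.parts_disjoint[OF q] by simp
    qed
    fix S assume S: "distinct S" "is_module G (set S)" "2 \<le> length S"
      and coh: "cohesive (adj G) (set S)" "cohesive (\<lambda>x y. \<not> adj G x y) (set S)"
    let ?H = "induced G (set S)"
    have strong: "strong_module G (set S)" by (rule strong_if_cohesive[OF S(2) coh])
    have vH: "verts ?H = set S" using S(2) by (auto simp: is_module_iff)
    have card: "2 \<le> card (set S)" using S(1,3) distinct_card by metis
    have "cohesive (adj ?H) (set S)" "cohesive (\<lambda>x y. \<not> adj ?H x y) (set S)"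
      by (rule cohesive_cong[OF coh(1)], simp) (rule cohesive_cong[OF coh(2)], simp)
    then have "prime_graph (quotient_graph ?H (Pi_mod ?H))"
      by (intro prime_quotient_if_cohesive) (use simple_graph_induced[OF G] vH card in auto)
    then have Hin: "quotient_graph ?H (Pi_mod ?H) \<in> prime_quotients G"
      unfolding prime_quotients_def using strong card by blast
    have flatM: "set (flat (start d)) = M" if "quotient_td (verts G) N G M T' B' k (fst d) (snd d)" for d M T' B'
      using quotient_td.flat_acc[OF that] quotient_td.acc_def[OF that] by simp
    have "quotient_graph ?H (Pi_mod ?H) \<in> set Hs" using Hin D(2) by simp
    from list_all2_set1[OF D(3) this] obtain d where d: "d \<in> set D"
      "td_rep (T (quotient_graph ?H (Pi_mod ?H))) (B (quotient_graph ?H (Pi_mod ?H))) d" by (elim bexE)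
    obtain M where M: "quotient_graph ?H (Pi_mod ?H) = quotient_graph (induced G M) (Pi_mod (induced G M))"
      "quotient_td (verts G) N G M (T (quotient_graph ?H (Pi_mod ?H))) (B (quotient_graph ?H (Pi_mod ?H))) k (fst d) (snd d)"
      using quot[OF Hin d(2,1)] by (elim exE conjE)
    \<comment> \<open>The union of the vertices of a quotient graph recovers its module, so equal
      quotients force M to be \<open>set S\<close>.\<close>
    have P: "Pi_mod ?H = Pi_mod (induced G M)" using arg_cong[OF M(1), of verts] unfolding verts_quotient .
    have "set (flat (start d)) = M" by (rule flatM[OF M(2)])
    also have "\<dots> = \<Union>(Pi_mod (induced G M))" by (rule quotient_td.partition(1)[OF M(2), symmetric])
    also have "\<dots> = \<Union>(Pi_mod ?H)" unfolding P ..
    also have "\<dots> = set S"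
      using Pi_mod_partition(1)[of ?H] vH card by simp
    finally have "set (flat (start d)) = set S" .
    \<comment> \<open>The search may stop at an earlier decomposition d' than d. Having the same
      union, it also belongs to the module \<open>set S\<close> and serves equally well.\<close>
    with d(1) have "\<exists>d'\<in>set D. find_td S D = start d' \<and> set (flat (start d')) = set S"
      by (induction D) (auto split: if_split)
    then obtain d' where d': "d' \<in> set D" "find_td S D = start d'" "set (flat (start d')) = set S" by blast
    from allD[OF d'(1)] obtain H' M' where q: "quotient_td (verts G) N G M' (T H') (B H') k (fst d') (snd d')"
      by (elim exE conjE)
    have "M' = set S" using flatM[OF q] d'(3) by simp
    then show "splits_into G (k + 1) (set S) (find_td S D)"
      using quotient_td.splits_into_acc[OF q] quotient_td.acc_def[OF q] d'(2) by simp
  qed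
  moreover have "big = (\<Sum>(v, c, w)\<leftarrow>W. w) + 1" unfolding big_def sumw ..
  ultimately show ?thesis using inp_eq by (intro exI[of _ W] exI[of _ es] exI[of _ D] conjI)
qed

text \<open>From 1 on, powers grow with the exponent, so monomials can be brought to a common
  exponent.\<close>

definition poly_bounded :: "(nat \<Rightarrow> nat) \<Rightarrow> bool" where
  "poly_bounded f \<longleftrightarrow> (\<exists>C d. \<forall>n\<ge>1. f n \<le> C * n ^ d)"

lemma poly_bounded_const: "poly_bounded (\<lambda>n. c)"
  unfolding poly_bounded_def by (intro exI[of _ c] exI[of _ 0]) simp

lemma poly_bounded_id: "poly_bounded (\<lambda>n. n)"
  unfolding poly_bounded_def by (intro exI[of _ 1]) simp

lemma poly_bounded_add: "poly_bounded f \<Longrightarrow> poly_bounded g \<Longrightarrow> poly_bounded (\<lambda>n. f n + g n)"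
proof -
  assume "poly_bounded f" "poly_bounded g"
  then obtain C d C' d' where f: "\<And>n. 1 \<le> n \<Longrightarrow> f n \<le> C * n ^ d" and g: "\<And>n. 1 \<le> n \<Longrightarrow> g n \<le> C' * n ^ d'"
    unfolding poly_bounded_def by blast
  have "f n + g n \<le> (C + C') * n ^ (d + d')" if "1 \<le> n" for n :: nat
  proof -
    have "n ^ d \<le> n ^ (d + d')" "n ^ d' \<le> n ^ (d + d')" using that by (intro power_increasing; simp)+
    then have "C * n ^ d \<le> C * n ^ (d + d')" "C' * n ^ d' \<le> C' * n ^ (d + d')" by simp_all
    then show ?thesis using f[OF that] g[OF that] unfolding add_mult_distrib by linarith
  qed
  then show ?thesis unfolding poly_bounded_def by blast
qed

lemma poly_bounded_mult: "poly_bounded f \<Longrightarrow> poly_bounded g \<Longrightarrow> poly_bounded (\<lambda>n. f n * g n)"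
proof -
  assume "poly_bounded f" "poly_bounded g"
  then obtain C d C' d' where f: "\<And>n. 1 \<le> n \<Longrightarrow> f n \<le> C * n ^ d" and g: "\<And>n. 1 \<le> n \<Longrightarrow> g n \<le> C' * n ^ d'"
    unfolding poly_bounded_def by blast
  have "f n * g n \<le> (C * C') * n ^ (d + d')" if "1 \<le> n" for n
    using mult_le_mono[OF f[OF that] g[OF that]] by (simp add: power_add mult_ac)
  then show ?thesis unfolding poly_bounded_def by blast
qed

lemma poly_bounded_power: "poly_bounded f \<Longrightarrow> poly_bounded (\<lambda>n. f n ^ a)"
  by (induction a) (auto intro: poly_bounded_const poly_bounded_mult)

text \<open>The number N is only known to be at most a polynomial in the input size. Ranging over
  all m up to \<open>g n\<close> avoids monotonicity of f; the bounding monomial is monotone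
  anyway.\<close>

lemma poly_bounded_compose:
  assumes "poly_bounded f" "poly_bounded g"
  shows "\<exists>C d. \<forall>n m. 1 \<le> n \<longrightarrow> 1 \<le> m \<longrightarrow> m \<le> g n \<longrightarrow> f m \<le> C * n ^ d"
proof -
  obtain C d C' d' where f: "\<And>n. 1 \<le> n \<Longrightarrow> f n \<le> C * n ^ d" and g: "\<And>n. 1 \<le> n \<Longrightarrow> g n \<le> C' * n ^ d'"
    using assms unfolding poly_bounded_def by blast
  have "f m \<le> (C * C' ^ d) * n ^ (d' * d)" if "1 \<le> n" "1 \<le> m" "m \<le> g n" for n m
  proof -
    have "m ^ d \<le> (C' * n ^ d') ^ d" using that g[OF that(1)] by (intro power_mono) auto
    then have "C * m ^ d \<le> C * (C' * n ^ d') ^ d" by simp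
    with f[OF that(2)] have "f m \<le> C * (C' * n ^ d') ^ d" by (rule order_trans)
    then show ?thesis by (simp only: power_mult_distrib power_mult mult.assoc)
  qed
  then show ?thesis by blast
qed

lemmas time_defs = tMain_def tSolve_def tElim_def tBk_def tGrow_def tAp_def tFind_def tOrder_def tNewacc_def
  tSub_def tMem_def tFedge_def tAssoc_def tMinl_def tLen_def tTree_def tAdj_def tFilt_def tEq_def tMul_def

text \<open>At K = 0 the exponential is a constant; \<open>tMain_le\<close> restores it as the
  factor \<open>2 ^ K\<close>.\<close>

lemma poly_bounded_tMain: "poly_bounded (\<lambda>N. tMain N 0)"
  unfolding time_defs by (intro poly_bounded_add poly_bounded_mult poly_bounded_const poly_bounded_id)

lemma tElim_le: "tElim N K \<le> 2 ^ K * tElim N 0"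
proof -
  have "tElim N K = N * (200 + N * (100 + tEq N)) + 2 ^ K * (N * (2 * (2 * tAp N)))"
    by (simp add: tElim_def algebra_simps)
  moreover have "1 * (N * (200 + N * (100 + tEq N))) \<le> 2 ^ K * (N * (200 + N * (100 + tEq N)))"
    by (intro mult_le_mono1) simp
  moreover have "tElim N 0 = N * (200 + N * (100 + tEq N)) + N * (2 * (2 * tAp N))"
    by (simp add: tElim_def algebra_simps)
  ultimately show ?thesis by (simp add: add_mult_distrib2)
qed

lemma tMain_le: "tMain N K \<le> 2 ^ K * tMain N 0"
proof -
  have mono: "x + y * tElim N K \<le> 2 ^ K * (x + y * tElim N 0)" for x y :: nat
  proof -
    have "1 * x \<le> 2 ^ K * x" by (intro mult_le_mono1) simp
    moreover have "y * tElim N K \<le> y * (2 ^ K * tElim N 0)" using tElim_le by (rule mult_le_mono2)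
    moreover have "2 ^ K * (x + y * tElim N 0) = 2 ^ K * x + y * (2 ^ K * tElim N 0)"
      by (simp add: algebra_simps)
    ultimately show ?thesis by linarith
  qed
  define x where "x = 200 + (N + 1) * 50 + (N + 1) * (50 + 2 * N) + 2 * N + 2 * N * (1000 + 20 * N +
    2 * tGrow N + 2 * tAp N + tFind N + (N + 1) * tBk N + tAssoc N + tMul N)"
  have "tMain N K = x + 2 * N * tElim N K" for K
    unfolding tMain_def tSolve_def x_def add_mult_distrib2 by linarith
  then show ?thesis using mono[of x "2 * N"] by simp
qed

text \<open>Here s is the input size and \<open>sum w V + 1\<close> is the base \<open>big\<close>;
  the right-hand side is a polynomial in s for fixed a and b.\<close>

lemma size_bound:
  assumes "finite V" "card V \<le> s" "\<And>v. v \<in> V \<Longrightarrow> c v \<le> b * s ^ a" "\<And>v. v \<in> V \<Longrightarrow> w v \<le> b * s ^ a"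
  shows "s + 2 * (\<Sum>v\<in>V. c v * (sum w V + 1) + w v) + 4 * card V + 10 \<le>
    s + 2 * (s * (b * s ^ a * (s * (b * s ^ a) + 1) + b * s ^ a)) + 4 * s + (10 :: nat)"
proof -
  have "sum w V \<le> card V * (b * s ^ a)" using sum_bounded_above[of V w "b * s ^ a"] assms(4) by simp
  also have "\<dots> \<le> s * (b * s ^ a)" using assms(2) by (rule mult_le_mono1)
  finally have w: "sum w V + 1 \<le> s * (b * s ^ a) + 1" by simp
  have "(\<Sum>v\<in>V. c v * (sum w V + 1) + w v) \<le> card V * (b * s ^ a * (s * (b * s ^ a) + 1) + b * s ^ a)"
    using sum_bounded_above[of V "\<lambda>v. c v * (sum w V + 1) + w v" "b * s ^ a * (s * (b * s ^ a) + 1) + b * s ^ a"]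
      add_mono[OF mult_le_mono[OF assms(3) w] assms(4)] by simp
  also have "\<dots> \<le> s * (b * s ^ a * (s * (b * s ^ a) + 1) + b * s ^ a)" using assms(2) by (rule mult_le_mono1)
  finally show ?thesis using assms(2) by linarith
qed

theorem theorem13:
  fixes a b :: nat
  shows "\<exists>(P :: program) (C :: nat) (d :: nat).
    \<forall>(G :: nat ugraph) (c :: nat \<Rightarrow> nat) (w :: nat \<Rightarrow> nat) (Nc :: nat) (Nw :: nat) (k :: nat)
      (T :: nat set ugraph \<Rightarrow> nat ugraph) (B :: nat set ugraph \<Rightarrow> nat \<Rightarrow> nat set set) (inp :: val).
      simple_graph G \<longrightarrow>
      (\<forall>v\<in>verts G. c v \<in> {1..Nc}) \<longrightarrow>
      (\<forall>v\<in>verts G. w v \<in> {1..Nw}) \<longrightarrow>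
      Nc \<le> b * card (verts G) ^ a \<longrightarrow>
      Nw \<le> b * card (verts G) ^ a \<longrightarrow>
      (\<forall>H\<in>prime_quotients G.
         tree_decomposition H (T H) (B H) \<and> td_width (T H) (B H) \<le> k) \<longrightarrow>
      rep_instance G c w T B inp \<longrightarrow>
      (\<exists>X out t.
         computes P inp out t \<and>
         rep_set rep_nat X out \<and>
         lex_max_independent_set G c w X \<and>
         t \<le> C * 2 ^ k * val_size inp ^ d)"
proof -
  \<comment> \<open>The polynomial bound on N provided by \<open>size_bound\<close>.\<close>
  let ?g = "\<lambda>s. s + 2 * (s * (b * s ^ a * (s * (b * s ^ a) + 1) + b * s ^ a)) + 4 * s + (10 :: nat)"
  have "poly_bounded ?g" by (intro poly_bounded_add poly_bounded_mult poly_bounded_const poly_bounded_id poly_bounded_power)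
  moreover have "poly_bounded (\<lambda>N. 2 * tMain N 0 + 2)" by (intro poly_bounded_add poly_bounded_mult poly_bounded_const poly_bounded_tMain)
  ultimately obtain C d where Cd: "\<And>s N. 1 \<le> s \<Longrightarrow> 1 \<le> N \<Longrightarrow> N \<le> ?g s \<Longrightarrow> 2 * tMain N 0 + 2 \<le> C * s ^ d"
    using poly_bounded_compose[of "\<lambda>N. 2 * tMain N 0 + 2" ?g] by blast
  show ?thesis
  proof (rule exI[of _ prog], rule exI[of _ C], rule exI[of _ d], intro allI impI)
    fix G :: "nat ugraph" and c w :: "nat \<Rightarrow> nat" and Nc Nw k :: nat
      and T :: "nat set ugraph \<Rightarrow> nat ugraph" and B :: "nat set ugraph \<Rightarrow> nat \<Rightarrow> nat set set" and inp :: val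
    assume G: "simple_graph G" and c: "\<forall>v\<in>verts G. c v \<in> {1..Nc}" and w: "\<forall>v\<in>verts G. w v \<in> {1..Nw}"
      and Nc: "Nc \<le> b * card (verts G) ^ a" and Nw: "Nw \<le> b * card (verts G) ^ a"
      and td: "\<forall>H\<in>prime_quotients G. tree_decomposition H (T H) (B H) \<and> td_width (T H) (B H) \<le> k"
      and inp: "rep_instance G c w T B inp"
    define big where "big = sum w (verts G) + 1"
    let ?wt = "\<lambda>v. c v * big + w v"
    define N where "N = val_size inp + 2 * sum ?wt (verts G) + 4 * card (verts G) + 10"
    have c1: "\<forall>v\<in>verts G. 1 \<le> c v" using c by auto
    obtain W es D where s: "inp = inst_val W es D" "big = (\<Sum>(v, c, w)\<leftarrow>W. w) + 1"
      "solver (verts G) N G es W D big (k + 1) ?wt"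
      using rep_instance_solver[OF G c1 td inp] unfolding big_def N_def by blast
    obtain v xs where opt: "is_opt G ?wt (verts G) v xs" and run: "runs 0 [inp] (nl xs) (tMain N (k + 1))"
      using solver.runs_main[OF s(3,2)] s(1) by blast
    obtain t where t: "t \<le> tMain N (k + 1) + 2" "computes prog inp (nl xs) t"
      using computes_if_runs[OF run] by blast
    have card: "card (verts G) \<le> val_size inp"
    proof -
      have "fst ` set W = verts G" using s(3) by (simp add: solver_def solver_axioms_def)
      then have "card (verts G) \<le> length W" using card_image_le[of "set W" fst] card_length[of W] by simp
      also have "length W \<le> val_size inp"
        using length_le_val_size[of "map (\<lambda>(k, x). Node (Atom k) (wv x)) W"] unfolding s(1) inst_val_def by simp
      finally show ?thesis .
    qed
    have pow: "b * card (verts G) ^ a \<le> b * val_size inp ^ a"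
      using card by (intro mult_le_mono2 power_mono) auto
    have "N \<le> ?g (val_size inp)"
      unfolding N_def big_def
    proof (rule size_bound)
      show "finite (verts G)" by (rule simple_graphD(1)[OF G])
      show "c v \<le> b * val_size inp ^ a" if "v \<in> verts G" for v
        using c that Nc pow by (meson atLeastAtMost_iff order_trans)
      show "w v \<le> b * val_size inp ^ a" if "v \<in> verts G" for v
        using w that Nw pow by (meson atLeastAtMost_iff order_trans)
    qed (rule card)
    moreover have "1 \<le> val_size inp" by (cases inp) auto
    moreover have "1 \<le> N" by (simp add: N_def)
    ultimately have poly: "2 * tMain N 0 + 2 \<le> C * val_size inp ^ d" by (intro Cd)
    \<comment> \<open>Bags have up to k + 1 elements, one more than the width. The resulting factor
      2 and the two steps of the outer call are absorbed in \<open>2 * tMain N 0 + 2\<close>, for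
      which C and d were chosen.\<close>
    have "t \<le> 2 ^ (k + 1) * tMain N 0 + 2" using t(1) tMain_le[of N "k + 1"] by linarith
    also have "\<dots> \<le> 2 ^ k * (2 * tMain N 0 + 2)" by (simp add: algebra_simps)
    also have "\<dots> \<le> 2 ^ k * (C * val_size inp ^ d)" using poly by (rule mult_le_mono2)
    finally have "t \<le> C * 2 ^ k * val_size inp ^ d" by (simp add: mult_ac)
    moreover have "rep_set rep_nat (set xs) (nl xs)"
      unfolding rep_set_def rep_nat_def using opt
      by (intro exI[of _ xs] exI[of _ "map Atom xs"]) (simp add: is_opt_def list_all2_map2 list.rel_refl)
    moreover have "lex_max_independent_set G c w (set xs)"
      by (rule lex_max_if_is_opt[OF G opt]) (simp add: big_def)
    ultimately show "\<exists>X out t. computes prog inp out t \<and> rep_set rep_nat X out \<and>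
        lex_max_independent_set G c w X \<and> t \<le> C * 2 ^ k * val_size inp ^ d"
      using t(2) by blast
  qed
qed

end
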